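(* Let $G$ be a discrete group. Assume that $\dim H_o=\infty$ and that $\mathscr R(G)$ has no (nonzero) minimal projections. Let $R$ be a projection in $\mathscr R(G)$ with $R\sim R^\perp$, let $\{Q_n\}_{1\le n\le N}$ with $N\le\infty$ be a collection of infinite projections in $B(H_o)$, and let $I=\sum_{n=1}^NF_n$ be a decomposition of the identity into mutually orthogonal central projections $F_n\in\mathscr R(G)\cap\mathscr L(G)$. Then there is a path of partial isometries $\{W(t)\mid t\in[0,1]\}$ in $\mathscr R(G)\otimes B(H_o)$ such that (i) $L_e^*W(t)$ is norm continuous; (ii) $W(t)^*W(t)=\sum_{n=1}^NF_n\otimes Q_n$ for all $t\in[0,1]$; (iii) $W(t)W(t)^*\le\sum_{n=1}^NF_n\otimes Q_n$ for all $t\in[0,1]$; (iv) $W(0)=\sum_{n=1}^NF_n\otimes Q_n$; and (v) $W(1)W(1)^*=\sum_{n=1}^NRF_n\otimes Q_n$.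
   Context: $\mathscr L(G)$ and $\mathscr R(G)$, acting on $\ell^2(G)$, are the von Neumann algebras generated by the left and right regular representations of $G$; they are each other's commutants, so $\mathscr L(G)\cap\mathscr R(G)$ is the center of $\mathscr R(G)$. $\mathscr R(G)\otimes B(H_o)$ is the von Neumann tensor product acting on $\ell^2(G)\otimes H_o$. $\sim$ denotes Murray-von Neumann equivalence of projections in $\mathscr R(G)$, and $R^\perp=I-R$. $L_e:H_o\to\ell^2(G)\otimes H_o$ is $L_eh=\chi_e\otimes h$, where $\{\chi_g\}_{g\in G}$ is the standard basis of $\ell^2(G)$ and $e$ is the identity of $G$. The case $N=\infty$ means the index $n$ runs over $\mathbb N$, sums then converging in the strong operator topology. No continuity of the path $W(t)$ other than (i) is required. *)

theory Defs
  imports "HOL-Analysis.Analysis" "HOL-Library.Extended_Nat"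
begin

section \<open>Complex Hilbert spaces\<close>

text \<open>The inner product is linear in the first argument.\<close>

class complex_hilbert = banach +
  fixes scaleC :: "complex \<Rightarrow> 'a \<Rightarrow> 'a" (infixr "*\<^sub>C" 75)
    and cinner :: "'a \<Rightarrow> 'a \<Rightarrow> complex"
  assumes scaleR_scaleC: "scaleR r x = complex_of_real r *\<^sub>C x"
    and scaleC_add_right: "c *\<^sub>C (x + y) = c *\<^sub>C x + c *\<^sub>C y"
    and scaleC_add_left: "(c + d) *\<^sub>C x = c *\<^sub>C x + d *\<^sub>C x"
    and scaleC_scaleC: "c *\<^sub>C d *\<^sub>C x = (c * d) *\<^sub>C x"
    and cinner_commute: "cinner x y = cnj (cinner y x)"
    and cinner_add_left: "cinner (x + y) z = cinner x z + cinner y z"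
    and cinner_scaleC_left: "cinner (c *\<^sub>C x) y = c * cinner x y"
    and cinner_self: "cinner x x = complex_of_real ((norm x)\<^sup>2)"

instantiation complex :: complex_hilbert
begin

definition "scaleC_complex = ((*) :: complex \<Rightarrow> complex \<Rightarrow> complex)"
definition "cinner_complex x y = x * cnj (y :: complex)"

instance
  by standard
    (auto simp: scaleC_complex_def cinner_complex_def scaleR_conv_of_real algebra_simps
      complex_norm_square simp flip: of_real_power)

end

lemma scaleC_one [simp]: "1 *\<^sub>C x = (x :: 'a::complex_hilbert)"
  using scaleR_scaleC[of 1 x] by simp

lemma cinner_add_right: "cinner x (y + z) = cinner x y + cinner x (z :: 'a::complex_hilbert)"
  by (metis cinner_add_left cinner_commute complex_cnj_add)

lemma cinner_scaleC_right: "cinner x (c *\<^sub>C y) = cnj c * cinner x (y :: 'a::complex_hilbert)"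
  by (metis cinner_scaleC_left cinner_commute complex_cnj_mult)

lemma cinner_zero_left [simp]: "cinner 0 (x :: 'a::complex_hilbert) = 0"
  using cinner_add_left[of 0 0 x] by simp

lemma cinner_zero_right [simp]: "cinner (x :: 'a::complex_hilbert) 0 = 0"
  using cinner_commute[of x 0] by simp

lemma cinner_minus_left: "cinner (- x) y = - cinner x (y :: 'a::complex_hilbert)"
  using cinner_add_left[of x "- x" y] by (simp add: eq_neg_iff_add_eq_0 add.commute)

lemma cinner_diff_left: "cinner (x - z) y = cinner x y - cinner z (y :: 'a::complex_hilbert)"
  using cinner_add_left[of x "- z" y] by (simp add: cinner_minus_left)

lemma norm_scaleC: "norm (c *\<^sub>C x) = norm c * norm (x :: 'a::complex_hilbert)"
proof -
  have "complex_of_real ((norm (c *\<^sub>C x))\<^sup>2) = cinner (c *\<^sub>C x) (c *\<^sub>C x)"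
    by (simp add: cinner_self)
  also have "\<dots> = (c * cnj c) * cinner x x"
    by (simp add: cinner_scaleC_left cinner_scaleC_right)
  also have "\<dots> = complex_of_real ((norm c * norm x)\<^sup>2)"
    by (simp only: cinner_self complex_norm_square [symmetric] power_mult_distrib of_real_mult
        of_real_power)
  finally have "(norm (c *\<^sub>C x))\<^sup>2 = (norm c * norm x)\<^sup>2"
    using of_real_eq_iff by blast
  then show ?thesis
    by (simp add: power2_eq_iff_nonneg)
qed

lemma cinner_Cauchy_Schwarz: "norm (cinner x y) \<le> norm x * norm (y :: 'a::complex_hilbert)"
proof (cases "y = 0")
  case False
  define n where "n = (norm y)\<^sup>2"
  define c where "c = cinner x y"
  have n: "n > 0" using False by (simp add: n_def)
  have yx: "cinner y x = cnj c"
    using cinner_commute[of y x] by (simp add: c_def)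
  define z where "z = x - (c / of_real n) *\<^sub>C y"
  have zy: "cinner z y = 0"
    using n by (simp add: z_def cinner_diff_left cinner_scaleC_left cinner_self flip: n_def c_def of_real_power)
  then have yz: "cinner y z = 0"
    using cinner_commute[of y z] by simp
  have "x = z + (c / of_real n) *\<^sub>C y" by (simp add: z_def)
  then have "cinner x x = cinner z z + (c / of_real n) * cnj (c / of_real n) * cinner y y"
    using zy yz by (metis (no_types, lifting) add.right_neutral add_0 cinner_add_left
        cinner_add_right cinner_scaleC_left cinner_scaleC_right mult.assoc mult_zero_right)
  then have "complex_of_real ((norm x)\<^sup>2)
      = complex_of_real ((norm z)\<^sup>2 + (norm (c / of_real n))\<^sup>2 * n)"
    by (simp only: cinner_self n_def of_real_add of_real_mult
        complex_norm_square [symmetric] of_real_power [symmetric])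
  then have "(norm x)\<^sup>2 = (norm z)\<^sup>2 + (norm (c / of_real n))\<^sup>2 * n"
    using of_real_eq_iff by blast
  then have "(norm x)\<^sup>2 \<ge> (norm c)\<^sup>2 / n\<^sup>2 * n"
    using n by (simp add: norm_divide power_divide)
  then have "(norm c)\<^sup>2 \<le> (norm x)\<^sup>2 * n"
    using n by (simp add: power2_eq_square field_simps)
  then have "(norm c)\<^sup>2 \<le> (norm x * norm y)\<^sup>2"
    by (simp add: n_def power_mult_distrib)
  then show ?thesis
    unfolding c_def by (meson norm_ge_zero mult_nonneg_nonneg power2_le_imp_le)
qed simp


section \<open>The spaces of square summable families\<close>

text \<open>
  \<open>('g, 'h) l2\<close> is $\ell^2(G; H)$.  It serves both as $\ell^2(G)$ (with \<open>'h = complex\<close>) and as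
  the Hilbert space tensor product $\ell^2(G) \otimes H$, with elementary tensors
  $(f \otimes h)(g) = f(g) h$; see \<open>cinner_tensor\<close> and \<open>closure_span_tensor\<close> below.
\<close>

definition square_summable :: "('g \<Rightarrow> 'h::real_normed_vector) \<Rightarrow> bool" where
  "square_summable f \<longleftrightarrow> (\<lambda>g. (norm (f g))\<^sup>2) summable_on UNIV"

lemma square_summable_bound:
  assumes "\<And>F. finite F \<Longrightarrow> L2_set (\<lambda>g. norm (f g)) F \<le> c"
  shows "square_summable f" and "sqrt (\<Sum>\<^sub>\<infinity>g. (norm (f g))\<^sup>2) \<le> c"
proof -
  have *: "(\<Sum>g\<in>F. (norm (f g))\<^sup>2) \<le> c\<^sup>2" if "finite F" for F
  proof -
    have "(\<Sum>g\<in>F. (norm (f g))\<^sup>2) = (L2_set (\<lambda>g. norm (f g)) F)\<^sup>2"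
      by (simp add: L2_set_def sum_nonneg)
    also have "\<dots> \<le> c\<^sup>2"
      using assms[OF that] by (intro power_mono) auto
    finally show ?thesis .
  qed
  show s: "square_summable f"
    unfolding square_summable_def
    by (rule nonneg_bdd_above_summable_on) (auto intro!: bdd_aboveI2 * )
  have "(\<Sum>\<^sub>\<infinity>g. (norm (f g))\<^sup>2) \<le> c\<^sup>2"
    using s unfolding square_summable_def by (rule infsum_le_finite_sums) (use * in auto)
  moreover have "0 \<le> c"
    using assms[of "{}"] by simp
  ultimately show "sqrt (\<Sum>\<^sub>\<infinity>g. (norm (f g))\<^sup>2) \<le> c"
    by (simp add: real_le_lsqrt)
qed

lemma L2_set_le_l2:
  assumes "square_summable f" "finite F"
  shows "L2_set (\<lambda>g. norm (f g)) F \<le> sqrt (\<Sum>\<^sub>\<infinity>g. (norm (f g))\<^sup>2)"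
  unfolding L2_set_def
  using assms by (auto simp: square_summable_def intro!: finite_sum_le_infsum)

lemma L2_set_norm_add:
  "L2_set (\<lambda>g. norm (f g + h g)) F \<le> L2_set (\<lambda>g. norm (f g)) F + L2_set (\<lambda>g. norm (h g)) F"
  by (rule order_trans[OF L2_set_mono L2_set_triangle_ineq]) (auto simp: norm_triangle_ineq)

lemma square_summable_add:
  assumes "square_summable f" "square_summable h"
  shows "square_summable (\<lambda>g. f g + h g)"
    and "sqrt (\<Sum>\<^sub>\<infinity>g. (norm (f g + h g))\<^sup>2)
          \<le> sqrt (\<Sum>\<^sub>\<infinity>g. (norm (f g))\<^sup>2) + sqrt (\<Sum>\<^sub>\<infinity>g. (norm (h g))\<^sup>2)"
proof -
  have *: "L2_set (\<lambda>g. norm (f g + h g)) F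
      \<le> sqrt (\<Sum>\<^sub>\<infinity>g. (norm (f g))\<^sup>2) + sqrt (\<Sum>\<^sub>\<infinity>g. (norm (h g))\<^sup>2)" if "finite F" for F
    using L2_set_norm_add[of f h F] L2_set_le_l2[OF assms(1) that] L2_set_le_l2[OF assms(2) that]
    by linarith
  show "square_summable (\<lambda>g. f g + h g)"
    and "sqrt (\<Sum>\<^sub>\<infinity>g. (norm (f g + h g))\<^sup>2)
          \<le> sqrt (\<Sum>\<^sub>\<infinity>g. (norm (f g))\<^sup>2) + sqrt (\<Sum>\<^sub>\<infinity>g. (norm (h g))\<^sup>2)"
    using square_summable_bound[OF * ] by simp_all
qed

lemma square_summable_minus: "square_summable f \<Longrightarrow> square_summable (\<lambda>g. - f g)"
  by (simp add: square_summable_def)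

lemma square_summable_diff:
  "square_summable f \<Longrightarrow> square_summable h \<Longrightarrow> square_summable (\<lambda>g. f g - h g)"
  using square_summable_add(1)[of f "\<lambda>g. - h g"] by (simp add: square_summable_minus)

lemma square_summable_scaleR: "square_summable f \<Longrightarrow> square_summable (\<lambda>g. r *\<^sub>R f g)"
  by (simp add: square_summable_def power_mult_distrib summable_on_cmult_right)

lemma square_summable_scaleC:
  "square_summable f \<Longrightarrow> square_summable (\<lambda>g. c *\<^sub>C (f g :: 'h::complex_hilbert))"
  by (simp add: square_summable_def norm_scaleC power_mult_distrib summable_on_cmult_right)

lemma square_summable_cinner:
  fixes f h :: "'g \<Rightarrow> 'h::complex_hilbert"
  assumes "square_summable f" "square_summable h"
  shows "(\<lambda>g. cinner (f g) (h g)) summable_on UNIV"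
proof (rule summable_on_iff_abs_summable_on_complex[THEN iffD2],
       rule Infinite_Sum.abs_summable_on_comparison_test)
  show "(\<lambda>g. norm ((norm (f g))\<^sup>2 + (norm (h g))\<^sup>2)) summable_on UNIV"
    using assms by (simp add: square_summable_def summable_on_add)
  fix g
  have "norm (cinner (f g) (h g)) \<le> norm (f g) * norm (h g)"
    by (rule cinner_Cauchy_Schwarz)
  also have "\<dots> \<le> (norm (f g))\<^sup>2 + (norm (h g))\<^sup>2"
    using sum_squares_bound[of "norm (f g)" "norm (h g)"]
      mult_nonneg_nonneg[OF norm_ge_zero[of "f g"] norm_ge_zero[of "h g"]] by linarith
  finally show "norm (cinner (f g) (h g)) \<le> norm ((norm (f g))\<^sup>2 + (norm (h g))\<^sup>2)"
    by simp
qed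

typedef (overloaded) ('g, 'h) l2 = "{f :: 'g \<Rightarrow> 'h::complex_hilbert. square_summable f}"
  morphisms l2_apply Abs_l2
  by (rule exI[of _ "\<lambda>_. 0"]) (simp add: square_summable_def)

setup_lifting type_definition_l2

instantiation l2 :: (type, complex_hilbert) real_normed_vector
begin

lift_definition zero_l2 :: "('a, 'b) l2" is "\<lambda>_. 0"
  by (simp add: square_summable_def)
lift_definition plus_l2 :: "('a, 'b) l2 \<Rightarrow> ('a, 'b) l2 \<Rightarrow> ('a, 'b) l2" is "\<lambda>f h g. f g + h g"
  by (rule square_summable_add)
lift_definition minus_l2 :: "('a, 'b) l2 \<Rightarrow> ('a, 'b) l2 \<Rightarrow> ('a, 'b) l2" is "\<lambda>f h g. f g - h g"
  by (rule square_summable_diff)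
lift_definition uminus_l2 :: "('a, 'b) l2 \<Rightarrow> ('a, 'b) l2" is "\<lambda>f g. - f g"
  by (rule square_summable_minus)
lift_definition scaleR_l2 :: "real \<Rightarrow> ('a, 'b) l2 \<Rightarrow> ('a, 'b) l2" is "\<lambda>r f g. r *\<^sub>R f g"
  by (rule square_summable_scaleR)
lift_definition norm_l2 :: "('a, 'b) l2 \<Rightarrow> real" is "\<lambda>f. sqrt (\<Sum>\<^sub>\<infinity>g. (norm (f g))\<^sup>2)" .
definition sgn_l2 :: "('a, 'b) l2 \<Rightarrow> ('a, 'b) l2" where "sgn_l2 f = scaleR (inverse (norm f)) f"
definition dist_l2 :: "('a, 'b) l2 \<Rightarrow> ('a, 'b) l2 \<Rightarrow> real" where "dist_l2 f h = norm (f - h)"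
definition uniformity_l2 :: "(('a, 'b) l2 \<times> ('a, 'b) l2) filter" where
  "uniformity_l2 = (INF e\<in>{0<..}. principal {(f, h). dist f h < e})"
definition open_l2 :: "('a, 'b) l2 set \<Rightarrow> bool" where
  "open_l2 U \<longleftrightarrow> (\<forall>f\<in>U. eventually (\<lambda>(f', h). f' = f \<longrightarrow> h \<in> U) uniformity)"

instance
proof
  fix x y z :: "('a, 'b) l2" and r s :: real and U :: "('a, 'b) l2 set"
  show "x + y + z = x + (y + z)" by transfer (simp add: add.assoc)
  show "x + y = y + x" by transfer (simp add: add.commute)
  show "0 + x = x" by transfer simp
  show "- x + x = 0" by transfer simp
  show "x - y = x + - y" by transfer simp
  show "r *\<^sub>R (x + y) = r *\<^sub>R x + r *\<^sub>R y" by transfer (simp add: scaleR_add_right)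
  show "(r + s) *\<^sub>R x = r *\<^sub>R x + s *\<^sub>R x" by transfer (simp add: scaleR_add_left)
  show "r *\<^sub>R s *\<^sub>R x = (r * s) *\<^sub>R x" by transfer simp
  show "1 *\<^sub>R x = x" by transfer simp
  show "sgn x = inverse (norm x) *\<^sub>R x" by (rule sgn_l2_def)
  show "dist x y = norm (x - y)" by (rule dist_l2_def)
  show "uniformity = (INF e\<in>{0<..}. principal {(f :: ('a, 'b) l2, h). dist f h < e})"
    by (rule uniformity_l2_def)
  show "open U \<longleftrightarrow> (\<forall>f\<in>U. eventually (\<lambda>(f', h). f' = f \<longrightarrow> h \<in> U) uniformity)"
    by (rule open_l2_def)
  show "norm x = 0 \<longleftrightarrow> x = 0"
  proof transfer
    fix f :: "'a \<Rightarrow> 'b" assume f: "square_summable f"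
    have "f = (\<lambda>_. 0)" if "(\<Sum>\<^sub>\<infinity>g. (norm (f g))\<^sup>2) = 0"
    proof
      fix g
      have "(norm (f g))\<^sup>2 = 0"
        using f that by (intro nonneg_infsum_le_0D[of "\<lambda>g. (norm (f g))\<^sup>2" UNIV])
          (auto simp: square_summable_def)
      then show "f g = 0" by simp
    qed
    then show "sqrt (\<Sum>\<^sub>\<infinity>g. (norm (f g))\<^sup>2) = 0 \<longleftrightarrow> f = (\<lambda>_. 0)" by auto
  qed
  show "norm (x + y) \<le> norm x + norm y" by transfer (rule square_summable_add)
  show "norm (r *\<^sub>R x) = \<bar>r\<bar> * norm x"
    by transfer (simp add: power_mult_distrib infsum_cmult_right' real_sqrt_mult)
qed

end

instance l2 :: (type, complex_hilbert) banach
proof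
  fix X :: "nat \<Rightarrow> ('a, 'b) l2" assume X: "Cauchy X"
  define f where "f n = l2_apply (X n)" for n
  have sf: "square_summable (f n)" for n
    unfolding f_def using l2_apply by blast
  have fin: "L2_set (\<lambda>g. norm (f m g - f n g)) F \<le> norm (X m - X n)" if "finite F" for F m n
    unfolding norm_l2.rep_eq minus_l2.rep_eq f_def[symmetric]
    by (rule L2_set_le_l2[OF square_summable_diff[OF sf sf] that])
  have "Cauchy (\<lambda>n. f n g)" for g
  proof (rule metric_CauchyI)
    fix e :: real assume "0 < e"
    then obtain M where "\<forall>m\<ge>M. \<forall>n\<ge>M. norm (X m - X n) < e"
      using X by (auto simp: Cauchy_iff)
    moreover have "norm (f m g - f n g) \<le> norm (X m - X n)" for m n
      using fin[of "{g}" m n] by simp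
    ultimately show "\<exists>M. \<forall>m\<ge>M. \<forall>n\<ge>M. dist (f m g) (f n g) < e"
      by (metis dist_norm order_le_less_trans)
  qed
  then have "\<exists>l. (\<lambda>n. f n g) \<longlonglongrightarrow> l" for g
    by (simp add: Cauchy_convergent_iff convergent_def)
  then obtain l where l: "\<And>g. (\<lambda>n. f n g) \<longlonglongrightarrow> l g" by metis
  have lim: "L2_set (\<lambda>g. norm (f m g - l g)) F \<le> e"
    if "finite F" "\<And>n. n \<ge> M \<Longrightarrow> norm (X m - X n) \<le> e" for F m M e
  proof (rule tendsto_upperbound)
    show "(\<lambda>n. L2_set (\<lambda>g. norm (f m g - f n g)) F) \<longlonglongrightarrow> L2_set (\<lambda>g. norm (f m g - l g)) F"
      unfolding L2_set_def by (intro tendsto_intros l)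
    show "\<forall>\<^sub>F n in sequentially. L2_set (\<lambda>g. norm (f m g - f n g)) F \<le> e"
      unfolding eventually_sequentially
      using fin[OF that(1)] that(2) by (meson order_trans)
  qed simp
  have sl: "square_summable l"
  proof -
    obtain M where M: "\<And>n. n \<ge> M \<Longrightarrow> norm (X M - X n) \<le> 1"
      using X unfolding Cauchy_iff by (metis less_eq_real_def order_refl zero_less_one)
    have "square_summable (\<lambda>g. f M g - l g)"
      by (rule square_summable_bound[OF lim[of _ M M 1]]) (use M in auto)
    from square_summable_diff[OF sf[of M] this] show ?thesis by simp
  qed
  have Al: "l2_apply (Abs_l2 l) = l"
    using sl by (simp add: Abs_l2_inverse)
  have "X \<longlonglongrightarrow> Abs_l2 l"
  proof (rule LIMSEQ_I)
    fix e :: real assume "0 < e"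
    then obtain M where M: "\<And>m n. m \<ge> M \<Longrightarrow> n \<ge> M \<Longrightarrow> norm (X m - X n) < e / 2"
      using X unfolding Cauchy_iff by (metis half_gt_zero)
    have "norm (X m - Abs_l2 l) \<le> e / 2" if "m \<ge> M" for m
      unfolding norm_l2.rep_eq minus_l2.rep_eq f_def[symmetric] Al
      by (rule square_summable_bound[OF lim[of _ M m "e / 2"]]) (use M[OF that] in \<open>auto simp: less_imp_le\<close>)
    then show "\<exists>M. \<forall>m\<ge>M. norm (X m - Abs_l2 l) < e"
      using \<open>0 < e\<close> by (intro exI[of _ M]) (fastforce)
  qed
  then show "convergent X" by (auto simp: convergent_def)
qed

instantiation l2 :: (type, complex_hilbert) complex_hilbert
begin

lift_definition scaleC_l2 :: "complex \<Rightarrow> ('a, 'b) l2 \<Rightarrow> ('a, 'b) l2" is "\<lambda>c f g. c *\<^sub>C f g"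
  by (rule square_summable_scaleC)
lift_definition cinner_l2 :: "('a, 'b) l2 \<Rightarrow> ('a, 'b) l2 \<Rightarrow> complex"
  is "\<lambda>f h. \<Sum>\<^sub>\<infinity>g. cinner (f g) (h g)" .

instance
proof
  fix x y z :: "('a, 'b) l2" and r :: real and c d :: complex
  show "r *\<^sub>R x = complex_of_real r *\<^sub>C x" by transfer (simp add: scaleR_scaleC)
  show "c *\<^sub>C (x + y) = c *\<^sub>C x + c *\<^sub>C y" by transfer (simp add: scaleC_add_right)
  show "(c + d) *\<^sub>C x = c *\<^sub>C x + d *\<^sub>C x" by transfer (simp add: scaleC_add_left)
  show "c *\<^sub>C d *\<^sub>C x = (c * d) *\<^sub>C x" by transfer (simp add: scaleC_scaleC)
  show "cinner x y = cnj (cinner y x)"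
    by transfer (simp add: cinner_commute[symmetric] flip: infsum_cnj)
  show "cinner (x + y) z = cinner x z + cinner y z"
    by transfer (simp add: cinner_add_left infsum_add square_summable_cinner)
  show "cinner (c *\<^sub>C x) y = c * cinner x y"
    by transfer (simp add: cinner_scaleC_left infsum_cmult_right')
  show "cinner x x = complex_of_real ((norm x)\<^sup>2)"
  proof transfer
    fix f :: "'a \<Rightarrow> 'b" assume "square_summable f"
    have "(\<Sum>\<^sub>\<infinity>g. cinner (f g) (f g)) = (\<Sum>\<^sub>\<infinity>g. complex_of_real ((norm (f g))\<^sup>2))"
      by (simp add: cinner_self)
    also have "\<dots> = complex_of_real (\<Sum>\<^sub>\<infinity>g. (norm (f g))\<^sup>2)"
      using \<open>square_summable f\<close>
      by (intro infsumI has_sum_of_real has_sum_infsum) (simp add: square_summable_def)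
    also have "\<dots> = complex_of_real ((sqrt (\<Sum>\<^sub>\<infinity>g. (norm (f g))\<^sup>2))\<^sup>2)"
      by (simp add: infsum_nonneg)
    finally show "(\<Sum>\<^sub>\<infinity>g. cinner (f g) (f g)) = complex_of_real ((sqrt (\<Sum>\<^sub>\<infinity>g. (norm (f g))\<^sup>2))\<^sup>2)" .
  qed
qed

end


lemma square_summable_l2_apply [simp]: "square_summable (l2_apply u)"
  using l2_apply by blast

lift_definition chi :: "'g \<Rightarrow> ('g, complex) l2" is "\<lambda>g x. if x = g then 1 else 0"
proof -
  fix g :: 'g
  let ?f = "\<lambda>x. (norm (if x = g then 1 else 0 :: complex))\<^sup>2"
  have "?f summable_on UNIV \<longleftrightarrow> ?f summable_on {g}"
    by (rule summable_on_cong_neutral) auto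
  then show "square_summable (\<lambda>x. if x = g then 1 else 0 :: complex)"
    by (simp add: square_summable_def)
qed

lift_definition tensor :: "('g, complex) l2 \<Rightarrow> 'h::complex_hilbert \<Rightarrow> ('g, 'h) l2"
    (infixr "\<otimes>\<^sub>v" 70)
  is "\<lambda>f h g. f g *\<^sub>C h"
  by (simp add: square_summable_def norm_scaleC power_mult_distrib summable_on_cmult_left)

lemma cinner_tensor: "cinner (f \<otimes>\<^sub>v h) (f' \<otimes>\<^sub>v h') = cinner f f' * cinner h h'"
proof -
  have "cinner (f \<otimes>\<^sub>v h) (f' \<otimes>\<^sub>v h')
      = (\<Sum>\<^sub>\<infinity>g. cinner (l2_apply f g) (l2_apply f' g) * cinner h h')"
    by (simp add: cinner_l2.rep_eq tensor.rep_eq cinner_scaleC_left cinner_scaleC_right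
        cinner_complex_def mult_ac)
  also have "\<dots> = cinner f f' * cinner h h'"
    by (simp add: cinner_l2.rep_eq infsum_cmult_left')
  finally show ?thesis .
qed

lemma norm_tensor: "norm (f \<otimes>\<^sub>v h) = norm f * norm h"
proof -
  have "complex_of_real ((norm (f \<otimes>\<^sub>v h))\<^sup>2) = complex_of_real ((norm f * norm h)\<^sup>2)"
    using cinner_tensor[of f h f h] by (simp add: cinner_self power_mult_distrib)
  then have "(norm (f \<otimes>\<^sub>v h))\<^sup>2 = (norm f * norm h)\<^sup>2"
    using of_real_eq_iff by blast
  then show ?thesis
    by (simp add: power2_eq_iff_nonneg)
qed

lemma closure_span_tensor: "closure (span {f \<otimes>\<^sub>v h | f h. True}) = (UNIV :: ('g, 'h::complex_hilbert) l2 set)"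
proof (intro equalityI subset_UNIV subsetI)
  fix u :: "('g, 'h) l2"
  show "u \<in> closure (span {f \<otimes>\<^sub>v h | f h. True})"
    unfolding closure_approachable
  proof (intro allI impI)
    fix e :: real assume "0 < e"
    define n where "n g = (norm (l2_apply u g))\<^sup>2" for g
    have n: "n summable_on UNIV"
      using square_summable_l2_apply[of u] by (simp add: square_summable_def n_def [abs_def])
    obtain F where F: "finite F" "dist (sum n F) (infsum n UNIV) \<le> (e / 2)\<^sup>2"
      using infsum_finite_approximation[OF n, of "(e / 2)\<^sup>2"] \<open>0 < e\<close> by auto
    define v where "v = (\<Sum>g\<in>F. chi g \<otimes>\<^sub>v l2_apply u g)"
    have "l2_apply (\<Sum>g\<in>G. chi g \<otimes>\<^sub>v l2_apply u g) x = (if x \<in> G then l2_apply u x else 0)"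
      if "finite G" for G x
      using that
    proof (induction G rule: finite_induct)
      case (insert g G)
      have "0 *\<^sub>C (y :: 'h) = 0" for y
        using scaleR_scaleC[of 0 y] by simp
      with insert show ?case
        by (auto simp: plus_l2.rep_eq tensor.rep_eq chi.rep_eq)
    qed (simp add: zero_l2.rep_eq)
    then have v: "l2_apply v x = (if x \<in> F then l2_apply u x else 0)" for x
      using F(1) by (simp add: v_def)
    have "norm (u - v) \<le> e / 2"
      unfolding norm_l2.rep_eq
    proof (rule square_summable_bound)
      fix K :: "'g set" assume K: "finite K"
      have "(\<Sum>g\<in>K. (norm (l2_apply (u - v) g))\<^sup>2) = (\<Sum>g\<in>K - F. n g)"
        using K by (intro sum.mono_neutral_cong_right) (auto simp: minus_l2.rep_eq v n_def)
      also have "\<dots> = sum n (K \<union> F) - sum n F"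
        using K F(1) sum_diff[of "K \<union> F" F n] by (simp add: Un_Diff)
      also have "\<dots> \<le> infsum n UNIV - sum n F"
        using K F(1) finite_sum_le_infsum[OF n, of "K \<union> F"] by (simp add: n_def)
      also have "\<dots> \<le> (e / 2)\<^sup>2"
        using F(2) by (auto simp: dist_real_def)
      finally show "L2_set (\<lambda>g. norm (l2_apply (u - v) g)) K \<le> e / 2"
        unfolding L2_set_def using \<open>0 < e\<close> by (intro real_le_lsqrt) (auto intro: sum_nonneg)
    qed
    moreover have "v \<in> span {f \<otimes>\<^sub>v h | f h. True}"
      unfolding v_def by (intro span_sum span_base) auto
    ultimately show "\<exists>y\<in>span {f \<otimes>\<^sub>v h | f h. True}. dist y u < e"
      using \<open>0 < e\<close> by (intro bexI[of _ v]) (auto simp: dist_norm norm_minus_commute)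
  qed
qed


section \<open>Bounded operators\<close>

text \<open>
  \<open>'a \<Rightarrow>\<^sub>L 'b\<close> consists of the bounded real-linear maps, with the operator norm; \<open>bounded_ops\<close>
  singles out those that are complex-linear, i.e. it is $B(H)$.
\<close>

interpretation complex_vector: vector_space "scaleC :: complex \<Rightarrow> 'a \<Rightarrow> 'a::complex_hilbert"
  by standard (simp_all add: scaleC_add_right scaleC_add_left scaleC_scaleC)

definition bounded_ops :: "('a::complex_hilbert \<Rightarrow>\<^sub>L 'a) set" where
  "bounded_ops = {A. \<forall>c x. blinfun_apply A (c *\<^sub>C x) = c *\<^sub>C A x}"

text \<open>Well defined on complex-linear operators; see \<open>cinner_adj\<close> below.\<close>

definition adj :: "('a::complex_hilbert \<Rightarrow>\<^sub>L 'b::complex_hilbert) \<Rightarrow> ('b \<Rightarrow>\<^sub>L 'a)" where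
  "adj A = (THE B. \<forall>x y. cinner (blinfun_apply A x) y = cinner x (blinfun_apply B y))"

lemma cinner_right_eqI:
  assumes "\<And>x. cinner x y = cinner x (z :: 'a::complex_hilbert)"
  shows "y = z"
proof -
  have "cinner (y - z) (y - z) = 0"
    using assms[of "y - z"] cinner_add_right[of "y - z" "y - z" z] by simp
  then show ?thesis by (simp add: cinner_self)
qed

lemma adj_eqI:
  fixes A :: "'a::complex_hilbert \<Rightarrow>\<^sub>L 'b::complex_hilbert" and B :: "'b \<Rightarrow>\<^sub>L 'a"
  assumes "\<And>x y. cinner (A x) y = cinner x (B y)"
  shows "adj A = B"
  unfolding adj_def
proof (rule the_equality)
  fix C :: "'b \<Rightarrow>\<^sub>L 'a" assume C: "\<forall>x y. cinner (A x) y = cinner x (C y)"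
  show "C = B"
    by (rule blinfun_eqI, rule cinner_right_eqI) (use C assms in metis)
qed (use assms in auto)

lemma Riesz_Re:
  fixes \<phi> :: "'a::complex_hilbert \<Rightarrow> real"
  assumes "bounded_linear \<phi>"
  shows "\<exists>z. \<forall>x. \<phi> x = Re (cinner x z)"
proof -
  interpret \<phi>: bounded_linear \<phi> by fact
  obtain K where K: "\<And>x. norm (\<phi> x) \<le> norm x * K" using \<phi>.bounded by auto
  define J where "J x = (norm x)\<^sup>2 - 2 * \<phi> x" for x
  define m where "m = Inf (range J)"
  have nn: "(norm x)\<^sup>2 = Re (cinner x x)" for x :: 'a
    by (simp add: cinner_self)
  have sym: "Re (cinner x y) = Re (cinner y x)" for x y :: 'a
    using cinner_commute[of x y] by simp
  have "(norm (x + t *\<^sub>R y))\<^sup>2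
      = (norm x)\<^sup>2 + t\<^sup>2 * (norm y)\<^sup>2 + 2 * t * Re (cinner y x)" for x y :: 'a and t
    unfolding nn
    by (simp add: scaleR_scaleC cinner_add_left cinner_add_right cinner_scaleC_left
        cinner_scaleC_right sym[of x y] power2_eq_square algebra_simps)
  then have J_expand: "J (x + t *\<^sub>R y)
      = J x + t\<^sup>2 * (norm y)\<^sup>2 + 2 * t * (Re (cinner y x) - \<phi> y)" for x y t
    by (simp add: J_def \<phi>.add \<phi>.scaleR algebra_simps)
  have "J x \<ge> - K\<^sup>2" for x
  proof -
    have "J x \<ge> (norm x)\<^sup>2 - 2 * norm x * K" using K[of x] by (simp add: J_def)
    also have "(norm x)\<^sup>2 - 2 * norm x * K = (norm x - K)\<^sup>2 - K\<^sup>2"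
      by (simp add: power2_diff)
    finally show ?thesis using zero_le_power2[of "norm x - K"] by linarith
  qed
  then have bdd: "bdd_below (range J)" by (rule bdd_belowI2)
  have m_le: "m \<le> J x" for x
    unfolding m_def by (rule cInf_lower[OF _ bdd]) simp
  have "\<exists>x. J x < m + 1 / real (Suc n)" for n
    using cInf_lessD[of "range J" "m + 1 / real (Suc n)"] by (auto simp: m_def)
  then obtain X where X: "\<And>n. J (X n) < m + 1 / real (Suc n)" by metis
  have mid: "(norm (y - x))\<^sup>2 \<le> 2 * (J x - m) + 2 * (J y - m)" for x y
  proof -
    have "J y = J (x + 1 *\<^sub>R (y - x))" by simp
    then have "J y = J x + (norm (y - x))\<^sup>2 + 2 * (Re (cinner (y - x) x) - \<phi> (y - x))"
      by (simp only: J_expand) simp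
    moreover have "J (x + (1/2) *\<^sub>R (y - x))
        = J x + (norm (y - x))\<^sup>2 / 4 + (Re (cinner (y - x) x) - \<phi> (y - x))"
      by (simp only: J_expand) (simp add: power2_eq_square)
    ultimately show ?thesis using m_le[of "x + (1/2) *\<^sub>R (y - x)"] by argo
  qed
  have "Cauchy X"
  proof (rule metric_CauchyI)
    fix e :: real assume "0 < e"
    then obtain M where M: "inverse (real (Suc M)) < e\<^sup>2 / 4"
      using reals_Archimedean[of "e\<^sup>2 / 4"] by auto
    have small: "J (X n) - m < e\<^sup>2 / 4" if "n \<ge> M" for n
    proof -
      have "1 / real (Suc n) \<le> inverse (real (Suc M))"
        using that by (simp add: inverse_eq_divide frac_le)
      then show ?thesis using X[of n] M by linarith
    qed
    have "dist (X p) (X q) < e" if "p \<ge> M" "q \<ge> M" for p q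
    proof -
      have "(norm (X p - X q))\<^sup>2 < e\<^sup>2"
        using mid[of "X p" "X q"] small[OF that(1)] small[OF that(2)] by argo
      then show ?thesis using \<open>0 < e\<close> by (simp add: dist_norm power2_less_imp_less)
    qed
    then show "\<exists>M. \<forall>p\<ge>M. \<forall>q\<ge>M. dist (X p) (X q) < e" by blast
  qed
  then obtain z where z: "X \<longlonglongrightarrow> z" by (auto simp: Cauchy_convergent_iff convergent_def)
  have "(\<lambda>n. J (X n)) \<longlonglongrightarrow> J z"
    unfolding J_def by (intro tendsto_intros z \<phi>.tendsto)
  moreover have "(\<lambda>n. m + 1 / real (Suc n)) \<longlonglongrightarrow> m + 0"
    by (intro tendsto_intros) (use LIMSEQ_inverse_real_of_nat in \<open>simp add: inverse_eq_divide\<close>)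
  ultimately have Jz: "J z \<le> m"
    using LIMSEQ_le[of "\<lambda>n. J (X n)" "J z" "\<lambda>n. m + 1 / real (Suc n)" m] X
    by (auto intro: less_imp_le)
  show ?thesis
  proof (intro exI allI)
    fix x
    define d where "d = Re (cinner x z) - \<phi> x"
    have *: "t\<^sup>2 * (norm x)\<^sup>2 + 2 * t * d \<ge> 0" for t
      using m_le[of "z + t *\<^sub>R x"] Jz by (simp add: J_expand d_def)
    define k where "k = (norm x)\<^sup>2 + 1"
    have k: "k > 0" "(norm x)\<^sup>2 \<le> k"
      using zero_le_power2[of "norm x"] unfolding k_def by linarith+
    have "0 \<le> (- d / k)\<^sup>2 * (norm x)\<^sup>2 + 2 * (- d / k) * d" by (rule *)
    also have "\<dots> \<le> (- d / k)\<^sup>2 * k + 2 * (- d / k) * d"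
      using k by (intro add_right_mono mult_left_mono) auto
    also have "\<dots> = - (d\<^sup>2 / k)"
      using k by (simp add: power2_eq_square field_simps)
    finally have "d\<^sup>2 / k \<le> 0" by simp
    then have "d = 0"
      using k by (simp add: divide_le_0_iff)
    then show "\<phi> x = Re (cinner x z)" by (simp add: d_def)
  qed
qed

lemma cinner_adj:
  fixes A :: "'a::complex_hilbert \<Rightarrow>\<^sub>L 'b::complex_hilbert"
  assumes A: "\<And>c x. A (c *\<^sub>C x) = c *\<^sub>C A x"
  shows "cinner (A x) y = cinner x (adj A y)"
proof -
  have bl: "bounded_linear (\<lambda>x. Re (cinner (A x) y))" for y
  proof (rule bounded_linear_intro[where K = "norm A * norm y"])
    fix x x' r
    show "Re (cinner (A (x + x')) y) = Re (cinner (A x) y) + Re (cinner (A x') y)"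
      by (simp add: blinfun.add_right cinner_add_left)
    show "Re (cinner (A (r *\<^sub>R x)) y) = r *\<^sub>R Re (cinner (A x) y)"
      by (simp add: scaleR_scaleC A cinner_scaleC_left)
    have "\<bar>Re (cinner (A x) y)\<bar> \<le> norm (A x) * norm y"
      by (rule order_trans[OF abs_Re_le_cmod cinner_Cauchy_Schwarz])
    also have "\<dots> \<le> norm A * norm x * norm y"
      by (intro mult_right_mono norm_blinfun) auto
    finally show "norm (Re (cinner (A x) y)) \<le> norm x * (norm A * norm y)"
      by (simp add: mult_ac)
  qed
  have "\<exists>z. \<forall>x. cinner (A x) y = cinner x z" for y
  proof -
    obtain z where z: "\<And>x. Re (cinner (A x) y) = Re (cinner x z)"
      using Riesz_Re[OF bl[of y]] by auto
    have "Im (cinner (A x) y) = Im (cinner x z)" for x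
      using z[of "\<i> *\<^sub>C x"] by (simp add: A cinner_scaleC_left)
    with z show ?thesis by (auto simp: complex_eq_iff)
  qed
  then obtain B where B: "\<And>x y. cinner (A x) y = cinner x (B y)" by metis
  have "bounded_linear B"
  proof (rule bounded_linear_intro[where K = "norm A"])
    fix x y r
    show "B (x + y) = B x + B y"
      by (rule cinner_right_eqI) (simp add: cinner_add_right flip: B)
    show "B (r *\<^sub>R x) = r *\<^sub>R B x"
      by (rule cinner_right_eqI) (simp add: scaleR_scaleC cinner_scaleC_right flip: B)
    have "complex_of_real ((norm (B x))\<^sup>2) = cinner (A (B x)) x"
      by (simp only: B cinner_self)
    then have "(norm (B x))\<^sup>2 = norm (cinner (A (B x)) x)"
      by (metis norm_of_real abs_power2 power2_abs)
    also have "\<dots> \<le> norm (A (B x)) * norm x"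
      by (rule cinner_Cauchy_Schwarz)
    also have "\<dots> \<le> norm A * norm (B x) * norm x"
      by (intro mult_right_mono norm_blinfun) auto
    finally show "norm (B x) \<le> norm x * norm A"
      by (cases "norm (B x) = 0") (auto simp: power2_eq_square mult_ac)
  qed
  then have "cinner (A x) y = cinner x (Blinfun B y)" for x y
    by (simp add: bounded_linear_Blinfun_apply B)
  then show ?thesis using adj_eqI[of A "Blinfun B"] by metis
qed

definition is_projection :: "('a::complex_hilbert \<Rightarrow>\<^sub>L 'a) \<Rightarrow> bool" where
  "is_projection P \<longleftrightarrow> P \<in> bounded_ops \<and> P o\<^sub>L P = P \<and> adj P = P"

text \<open>\<open>B - A\<close> is positive.\<close>

definition op_le :: "('a::complex_hilbert \<Rightarrow>\<^sub>L 'a) \<Rightarrow> ('a \<Rightarrow>\<^sub>L 'a) \<Rightarrow> bool" where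
  "op_le A B \<longleftrightarrow> (\<forall>x. cinner ((B - A) x) x \<in> \<real>\<^sub>\<ge>\<^sub>0)"

text \<open>\<open>V\<close> is isometric on the orthogonal complement of its kernel.\<close>

definition partial_isometry :: "('a::complex_hilbert \<Rightarrow>\<^sub>L 'a) \<Rightarrow> bool" where
  "partial_isometry V \<longleftrightarrow> V \<in> bounded_ops \<and>
    (\<forall>x. (\<forall>y. V y = 0 \<longrightarrow> cinner x y = 0) \<longrightarrow> norm (V x) = norm x)"

text \<open>
  The bounded operator $A \otimes B$ on $\ell^2(G) \otimes H$, for complex-linear $A$ and $B$; it is
  determined by its values on elementary tensors (\<open>op_tensor_eqI\<close>).
\<close>

definition op_tensor ::
    "(('g, complex) l2 \<Rightarrow>\<^sub>L ('g, complex) l2) \<Rightarrow> ('h::complex_hilbert \<Rightarrow>\<^sub>L 'h) \<Rightarrow>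
      (('g, 'h) l2 \<Rightarrow>\<^sub>L ('g, 'h) l2)"  (infixr "\<otimes>\<^sub>o" 70) where
  "A \<otimes>\<^sub>o B = (THE T. \<forall>f h. blinfun_apply T (f \<otimes>\<^sub>v h) = A f \<otimes>\<^sub>v B h)"

lemma op_tensor_eqI:
  fixes A :: "('g, complex) l2 \<Rightarrow>\<^sub>L ('g, complex) l2" and B :: "'h::complex_hilbert \<Rightarrow>\<^sub>L 'h"
    and T :: "('g, 'h) l2 \<Rightarrow>\<^sub>L ('g, 'h) l2"
  assumes "\<And>f h. T (f \<otimes>\<^sub>v h) = A f \<otimes>\<^sub>v B h"
  shows "A \<otimes>\<^sub>o B = T"
  unfolding op_tensor_def
proof (rule the_equality)
  fix S :: "('g, 'h) l2 \<Rightarrow>\<^sub>L ('g, 'h) l2" assume S: "\<forall>f h. S (f \<otimes>\<^sub>v h) = A f \<otimes>\<^sub>v B h"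
  have lin: "linear (blinfun_apply U)" for U :: "('g, 'h) l2 \<Rightarrow>\<^sub>L ('g, 'h) l2"
    by (rule bounded_linear.linear[OF blinfun.bounded_linear_right])
  have "S x = T x" if "x \<in> span {f \<otimes>\<^sub>v h | f h. True}" for x
    by (rule linear_eq_on[OF lin lin that]) (use S assms in auto)
  moreover have "closed {x. S x = T x}"
    by (intro closed_Collect_eq continuous_intros)
  ultimately have "closure (span {f \<otimes>\<^sub>v h | f h. True}) \<subseteq> {x. S x = T x}"
    by (intro closure_minimal) auto
  then show "S = T"
    unfolding closure_span_tensor by (intro blinfun_eqI) auto
qed (use assms in auto)

text \<open>$\sum_{n=1}^N A_n = S$ in the strong operator topology, \<open>N = \<infinity>\<close> included.\<close>

definition has_sot_sum :: "enat \<Rightarrow> (nat \<Rightarrow> 'a::complex_hilbert \<Rightarrow>\<^sub>L 'a) \<Rightarrow> ('a \<Rightarrow>\<^sub>L 'a) \<Rightarrow> bool" where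
  "has_sot_sum N A S \<longleftrightarrow>
    limitin strong_operator_topology (\<lambda>k. \<Sum>n | 1 \<le> n \<and> n \<le> k \<and> enat n \<le> N. A n) S sequentially"

lemma has_sot_sum_iff:
  "has_sot_sum N A S \<longleftrightarrow>
    (\<forall>x. (\<lambda>k. \<Sum>n | 1 \<le> n \<and> n \<le> k \<and> enat n \<le> N. A n x) \<longlonglongrightarrow> S x)"
proof -
  define X where "X k = (\<Sum>n | 1 \<le> n \<and> n \<le> k \<and> enat n \<le> N. A n)" for k
  have "limitin strong_operator_topology X S sequentially
      \<longleftrightarrow> limitin euclidean (\<lambda>k. blinfun_apply (X k)) (blinfun_apply S) sequentially"
    unfolding limitin_def strong_operator_topology_def
    by (auto simp: openin_pullback_topology topspace_pullback_topology)
  also have "\<dots> \<longleftrightarrow> (\<forall>x. (\<lambda>k. X k x) \<longlonglongrightarrow> S x)"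
    by (subst euclidean_product_topology [symmetric], subst limitin_componentwise) simp
  finally show ?thesis
    by (simp add: has_sot_sum_def X_def [abs_def] blinfun.sum_left)
qed


section \<open>Von Neumann algebras\<close>

definition commutant :: "('a::complex_hilbert \<Rightarrow>\<^sub>L 'a) set \<Rightarrow> ('a \<Rightarrow>\<^sub>L 'a) set" where
  "commutant S = {T \<in> bounded_ops. \<forall>A\<in>S. T o\<^sub>L A = A o\<^sub>L T}"

text \<open>
  A *-subalgebra of $B(H)$ that equals its bicommutant; closure under the algebra operations is
  implied, since every commutant is a subalgebra.
\<close>

definition von_neumann_algebra :: "('a::complex_hilbert \<Rightarrow>\<^sub>L 'a) set \<Rightarrow> bool" where
  "von_neumann_algebra M \<longleftrightarrow>
    M \<subseteq> bounded_ops \<and> (\<forall>A\<in>M. adj A \<in> M) \<and> commutant (commutant M) = M"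

definition vN_generated :: "('a::complex_hilbert \<Rightarrow>\<^sub>L 'a) set \<Rightarrow> ('a \<Rightarrow>\<^sub>L 'a) set" where
  "vN_generated S = \<Inter>{M. von_neumann_algebra M \<and> S \<subseteq> M}"

definition vN_tensor ::
    "(('g, complex) l2 \<Rightarrow>\<^sub>L ('g, complex) l2) set \<Rightarrow> ('h::complex_hilbert \<Rightarrow>\<^sub>L 'h) set \<Rightarrow>
      (('g, 'h) l2 \<Rightarrow>\<^sub>L ('g, 'h) l2) set" where
  "vN_tensor M N = vN_generated {A \<otimes>\<^sub>o B | A B. A \<in> M \<and> B \<in> N}"

text \<open>Used for projections \<open>P\<close>, \<open>Q\<close> in \<open>M\<close>.\<close>

definition mvn_equiv ::
    "('a::complex_hilbert \<Rightarrow>\<^sub>L 'a) set \<Rightarrow> ('a \<Rightarrow>\<^sub>L 'a) \<Rightarrow> ('a \<Rightarrow>\<^sub>L 'a) \<Rightarrow> bool" where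
  "mvn_equiv M P Q \<longleftrightarrow> (\<exists>V\<in>M. adj V o\<^sub>L V = P \<and> V o\<^sub>L adj V = Q)"

text \<open>Equivalent in \<open>M\<close> to a proper subprojection.\<close>

definition infinite_projection ::
    "('a::complex_hilbert \<Rightarrow>\<^sub>L 'a) set \<Rightarrow> ('a \<Rightarrow>\<^sub>L 'a) \<Rightarrow> bool" where
  "infinite_projection M Q \<longleftrightarrow> Q \<in> M \<and> is_projection Q \<and>
    (\<exists>P\<in>M. is_projection P \<and> op_le P Q \<and> P \<noteq> Q \<and> mvn_equiv M P Q)"

definition minimal_projection ::
    "('a::complex_hilbert \<Rightarrow>\<^sub>L 'a) set \<Rightarrow> ('a \<Rightarrow>\<^sub>L 'a) \<Rightarrow> bool" where
  "minimal_projection M P \<longleftrightarrow> P \<in> M \<and> is_projection P \<and> P \<noteq> 0 \<and>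
    (\<forall>E\<in>M. is_projection E \<and> op_le E P \<longrightarrow> E = 0 \<or> E = P)"


section \<open>The regular representations\<close>

text \<open>The (not necessarily commutative) group \<open>'g\<close> is written additively, with identity \<open>0\<close>.\<close>

lemma norm_reindex:
  assumes "bij p"
  shows "square_summable f \<Longrightarrow> square_summable (\<lambda>x. f (p x))"
    and "(\<Sum>\<^sub>\<infinity>x. (norm (f (p x)))\<^sup>2) = (\<Sum>\<^sub>\<infinity>x. (norm (f x))\<^sup>2)"
  using summable_on_reindex_bij_betw[OF assms, of "\<lambda>x. (norm (f x))\<^sup>2"]
    infsum_reindex_bij_betw[OF assms, of "\<lambda>x. (norm (f x))\<^sup>2"]
  by (simp_all add: square_summable_def)

lemma bij_translate: "bij (\<lambda>x. g + x)" "bij (\<lambda>x. x + g)" for g :: "'g::group_add"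
  by (rule bij_betw_byWitness[of _ "\<lambda>x. - g + x"]; simp add: add.assoc [symmetric])
    (rule bij_betw_byWitness[of _ "\<lambda>x. x - g"]; simp add: add.assoc)

lift_definition left_translate :: "'g::group_add \<Rightarrow> ('g, complex) l2 \<Rightarrow> ('g, complex) l2"
  is "\<lambda>g f x. f (- g + x)"
  by (rule norm_reindex(1)[OF bij_translate(1)])

lift_definition right_translate :: "'g::group_add \<Rightarrow> ('g, complex) l2 \<Rightarrow> ('g, complex) l2"
  is "\<lambda>g f x. f (x + g)"
  by (rule norm_reindex(1)[OF bij_translate(2)])

definition left_regular :: "'g::group_add \<Rightarrow> ('g, complex) l2 \<Rightarrow>\<^sub>L ('g, complex) l2" where
  "left_regular g = Blinfun (left_translate g)"

definition right_regular :: "'g::group_add \<Rightarrow> ('g, complex) l2 \<Rightarrow>\<^sub>L ('g, complex) l2" where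
  "right_regular g = Blinfun (right_translate g)"

lemma left_regular_apply: "left_regular g f = left_translate g f"
proof -
  have "bounded_linear (left_translate g)"
  proof (rule bounded_linear_intro[where K = 1])
    fix f h :: "('a, complex) l2" and r :: real
    show "left_translate g (f + h) = left_translate g f + left_translate g h"
      and "left_translate g (r *\<^sub>R f) = r *\<^sub>R left_translate g f"
      by (transfer; simp)+
    show "norm (left_translate g f) \<le> norm f * 1"
      by transfer (simp add: norm_reindex(2)[OF bij_translate(1)])
  qed
  then show ?thesis
    by (simp add: left_regular_def bounded_linear_Blinfun_apply)
qed

lemma right_regular_apply: "right_regular g f = right_translate g f"
proof -
  have "bounded_linear (right_translate g)"
  proof (rule bounded_linear_intro[where K = 1])
    fix f h :: "('a, complex) l2" and r :: real
    show "right_translate g (f + h) = right_translate g f + right_translate g h"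
      and "right_translate g (r *\<^sub>R f) = r *\<^sub>R right_translate g f"
      by (transfer; simp)+
    show "norm (right_translate g f) \<le> norm f * 1"
      by transfer (simp add: norm_reindex(2)[OF bij_translate(2)])
  qed
  then show ?thesis
    by (simp add: right_regular_def bounded_linear_Blinfun_apply)
qed

lemma left_regular_chi: "left_regular g (chi x) = chi (g + x)"
proof -
  have "- g + y = x \<longleftrightarrow> y = g + x" for y
    by (metis minus_add_cancel add_minus_cancel)
  then show ?thesis
    unfolding left_regular_apply by transfer auto
qed

lemma right_regular_chi: "right_regular g (chi x) = chi (x - g)"
  unfolding right_regular_apply by transfer (auto simp: eq_diff_eq)

definition left_vN :: "(('g::group_add, complex) l2 \<Rightarrow>\<^sub>L ('g, complex) l2) set" where
  "left_vN = vN_generated (range left_regular)"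

definition right_vN :: "(('g::group_add, complex) l2 \<Rightarrow>\<^sub>L ('g, complex) l2) set" where
  "right_vN = vN_generated (range right_regular)"

text \<open>The operator $L_g$ from $H$ to $\ell^2(G) \otimes H$; the identity of the group gives \<open>L_op 0\<close>.\<close>

definition L_op :: "'g \<Rightarrow> 'h::complex_hilbert \<Rightarrow>\<^sub>L ('g, 'h) l2" where
  "L_op g = Blinfun (\<lambda>h. chi g \<otimes>\<^sub>v h)"

lemma L_op_apply: "L_op g h = chi g \<otimes>\<^sub>v h"
proof -
  have "bounded_linear (\<lambda>h :: 'b. chi g \<otimes>\<^sub>v h)"
  proof (rule bounded_linear_intro[where K = "norm (chi g)"])
    fix h k :: 'b and r :: real
    show "chi g \<otimes>\<^sub>v (h + k) = chi g \<otimes>\<^sub>v h + chi g \<otimes>\<^sub>v k"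
      by transfer (simp add: scaleC_add_right)
    show "chi g \<otimes>\<^sub>v (r *\<^sub>R h) = r *\<^sub>R (chi g \<otimes>\<^sub>v h)"
      by transfer (simp add: scaleR_scaleC scaleC_scaleC mult.commute)
    show "norm (chi g \<otimes>\<^sub>v h) \<le> norm h * norm (chi g)"
      by (simp add: norm_tensor)
  qed
  then show ?thesis
    by (simp add: L_op_def bounded_linear_Blinfun_apply)
qed

end

theory Submission
  imports Defs
begin

text \<open>
  The group von Neumann algebra $\mathscr R(G)$ carries the faithful trace
  $\tau(A) = \langle A \chi_e, \chi_e \rangle$, and $\| L_e^* (A \otimes 1) \| \le \| A \chi_e \|$
  (\<open>norm_L_op_op_tensor_le\<close>).  Hence (i) asks only for continuity in the 2-norm of the trace, in
  the $\mathscr R(G)$ leg.  In that norm two isometries of $B(H_o)$ with different ranges can be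
  joined, by letting a projection of the first leg grow continuously from 0 to 1.

  Such projections exist because $\mathscr R(G)$ is diffuse (\<open>ex_projection_path\<close>): in a maximal
  chain of projections containing $R$, the trace is injective by faithfulness, and takes every
  value in $[0,1]$, since at a gap the difference of the two end points would have a proper nonzero
  subprojection that could be inserted into the chain.  Let $E_t$ be the member of trace $t$.

  An infinite projection $Q_n$ of $B(H_o)$ has an infinite orthonormal basis, which can be split
  into two halves of full cardinality.  This gives isometries $S_{1,n}, S_{2,n}$ on the range of
  $Q_n$ with orthogonal ranges that add up to $Q_n$ (\<open>infinite_projection_halving\<close>).  Put
  $\hat Q = \sum_n F_n \otimes Q_n$ and $\hat S_i = \sum_n F_n \otimes S_{i,n}$; as the $F_n$
  are central, these operators commute with $\mathscr R(G) \otimes 1$, and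
  $\hat S_i^* \hat S_j = \delta_{ij} \hat Q$, $\hat S_1 \hat S_1^* + \hat S_2 \hat S_2^* = \hat Q$.
  Choose $V \in \mathscr R(G)$ with $V^* V = R$ and $V V^* = R^\perp$.  The path is
  \[ W(t) = (E_t^\perp \otimes 1) \hat Q + (R E_t \otimes 1) \hat S_1 + (V^* E_t \otimes 1) \hat S_2 . \]
  Since $E_t \le R$ or $R \le E_t$, the projection $E_t$ commutes with $R$ and
  $E_t^\perp V^* E_t = 0$; this kills the cross terms of $W(t)^* W(t)$, and the diagonal terms add
  up to $\hat Q$ because $E_t^\perp + R E_t + E_t V V^* E_t = 1$.  At $t = 0$ the path is
  $\hat Q$; at $t = 1$ it is $(R \otimes 1) \hat S_1 + (V^* \otimes 1) \hat S_2$, whose range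
  projection is $(R \otimes 1) \hat Q$.

  The tensor product $A \otimes B$ of bounded operators is constructed in \<open>op_tensor_exists\<close> by
  transporting the coordinatewise action of $A$ on $\ell^2(B_0; \ell^2(G))$, for an orthonormal
  basis $B_0$ of $H_o$, to $\ell^2(G; H_o)$.
\<close>


section \<open>Complex-linear operators and their adjoints\<close>

text \<open>Complex linearity for operators between two spaces; \<open>bounded_ops\<close> is the case of equal spaces.\<close>

definition clinear_op :: "('a::complex_hilbert \<Rightarrow>\<^sub>L 'b::complex_hilbert) \<Rightarrow> bool" where
  "clinear_op A \<longleftrightarrow> (\<forall>c x. blinfun_apply A (c *\<^sub>C x) = c *\<^sub>C A x)"

lemma bounded_ops_iff: "A \<in> bounded_ops \<longleftrightarrow> clinear_op A"
  by (simp add: bounded_ops_def clinear_op_def)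

lemma clinear_opD: "clinear_op A \<Longrightarrow> A (c *\<^sub>C x) = c *\<^sub>C A x"
  by (simp add: clinear_op_def)

lemma cinner_diff_right: "cinner x (y - z) = cinner x y - cinner x (z :: 'a::complex_hilbert)"
  using cinner_add_right[of x "y - z" z] by (simp add: algebra_simps)

lemma cinner_sum_left: "cinner (sum f F) y = (\<Sum>i\<in>F. cinner (f i) (y :: 'a::complex_hilbert))"
  by (induction F rule: infinite_finite_induct) (simp_all add: cinner_add_left)

lemma cinner_sum_right: "cinner y (sum f F) = (\<Sum>i\<in>F. cinner y (f i :: 'a::complex_hilbert))"
  by (induction F rule: infinite_finite_induct) (simp_all add: cinner_add_right)

lemma scaleC_zero_left [simp]: "0 *\<^sub>C (x :: 'a::complex_hilbert) = 0"
  using scaleR_scaleC[of 0 x] by simp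

lemma norm_eq_cinner: "(norm (x :: 'a::complex_hilbert))\<^sup>2 = Re (cinner x x)"
  by (simp add: cinner_self)

lemma bounded_linear_cinner_left: "bounded_linear (\<lambda>x. cinner x (y :: 'a::complex_hilbert))"
  by (rule bounded_linear_intro[where K = "norm y"])
    (simp_all add: cinner_add_left scaleR_scaleC cinner_scaleC_left cinner_Cauchy_Schwarz scaleC_complex_def)

lemma bounded_linear_cinner_right: "bounded_linear (\<lambda>y. cinner (x :: 'a::complex_hilbert) y)"
proof (rule bounded_linear_intro[where K = "norm x"])
  show "norm (cinner x y) \<le> norm y * norm x" for y :: 'a
    using cinner_Cauchy_Schwarz[of x y] by (simp add: mult.commute)
qed (simp_all add: cinner_add_right scaleR_scaleC cinner_scaleC_right scaleC_complex_def)

lemma cinner_left_eqI: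
  assumes "\<And>z. cinner x z = cinner y (z :: 'a::complex_hilbert)"
  shows "x = y"
  by (rule cinner_right_eqI) (metis assms cinner_commute)

lemma cinner_adj_right: "clinear_op A \<Longrightarrow> cinner (A x) y = cinner x (adj A y)"
  by (rule cinner_adj) (simp add: clinear_op_def)

lemma cinner_adj_left: "clinear_op A \<Longrightarrow> cinner (adj A x) y = cinner x (A y)"
  by (metis cinner_adj_right cinner_commute)

lemma clinear_op_adj:
  assumes "clinear_op A"
  shows "clinear_op (adj A)"
proof -
  have "adj A (c *\<^sub>C x) = c *\<^sub>C adj A x" for c x
    by (rule cinner_left_eqI) (simp add: cinner_adj_left[OF assms] cinner_scaleC_left)
  then show ?thesis by (simp add: clinear_op_def)
qed

lemma adj_adj: "clinear_op A \<Longrightarrow> adj (adj A) = A"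
  by (rule adj_eqI) (rule cinner_adj_left)

lemma clinear_op_compose: "clinear_op A \<Longrightarrow> clinear_op B \<Longrightarrow> clinear_op (A o\<^sub>L B)"
  by (simp add: clinear_op_def)

lemma clinear_op_add: "clinear_op A \<Longrightarrow> clinear_op B \<Longrightarrow> clinear_op (A + B)"
  by (simp add: clinear_op_def blinfun.add_left scaleC_add_right)

lemma scaleC_diff_right: "c *\<^sub>C (x - y) = c *\<^sub>C x - c *\<^sub>C (y :: 'a::complex_hilbert)"
  by (rule complex_vector.scale_right_diff_distrib)

lemma clinear_op_diff: "clinear_op A \<Longrightarrow> clinear_op B \<Longrightarrow> clinear_op (A - B)"
  by (simp add: clinear_op_def blinfun.diff_left scaleC_diff_right)

lemma clinear_op_id [simp]: "clinear_op id_blinfun"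
  by (simp add: clinear_op_def)

lemma clinear_op_zero [simp]: "clinear_op 0"
  by (simp add: clinear_op_def complex_vector.scale_zero_right)

lemma adj_compose:
  "clinear_op A \<Longrightarrow> clinear_op B \<Longrightarrow> adj (A o\<^sub>L B) = adj B o\<^sub>L adj A"
  by (rule adj_eqI) (simp add: cinner_adj_right)

lemma adj_add: "clinear_op A \<Longrightarrow> clinear_op B \<Longrightarrow> adj (A + B) = adj A + adj B"
  by (rule adj_eqI)
    (simp add: cinner_adj_right blinfun.add_left cinner_add_left cinner_add_right)

lemma adj_diff: "clinear_op A \<Longrightarrow> clinear_op B \<Longrightarrow> adj (A - B) = adj A - adj B"
  by (rule adj_eqI)
    (simp add: cinner_adj_right blinfun.diff_left cinner_diff_left cinner_diff_right)

lemma adj_id [simp]: "adj id_blinfun = id_blinfun"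
  by (rule adj_eqI) simp

lemma adj_zero [simp]: "adj 0 = 0"
  by (rule adj_eqI) simp

lemma norm_adj_le:
  assumes "clinear_op A"
  shows "norm (adj A) \<le> norm A"
proof (rule norm_blinfun_bound)
  fix y
  have "complex_of_real ((norm (adj A y))\<^sup>2) = cinner (A (adj A y)) y"
    by (simp only: cinner_adj_right[OF assms] cinner_self)
  then have "(norm (adj A y))\<^sup>2 = norm (cinner (A (adj A y)) y)"
    by (metis norm_of_real abs_power2)
  also have "\<dots> \<le> norm (A (adj A y)) * norm y"
    by (rule cinner_Cauchy_Schwarz)
  also have "\<dots> \<le> norm A * norm (adj A y) * norm y"
    by (intro mult_right_mono norm_blinfun) auto
  finally show "norm (adj A y) \<le> norm A * norm y"
    by (cases "norm (adj A y) = 0") (auto simp: power2_eq_square mult_ac)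
qed auto

text \<open>A bounded sequence of operators that converges pointwise has a bounded limit.\<close>

lemma clinear_op_pointwise_limit:
  fixes T :: "nat \<Rightarrow> 'a::complex_hilbert \<Rightarrow>\<^sub>L 'b::complex_hilbert"
  assumes T: "\<And>k. clinear_op (T k)" and bound: "\<And>k x. norm (T k x) \<le> c * norm x"
    and conv: "\<And>x. convergent (\<lambda>k. T k x)"
  shows "\<exists>S. clinear_op S \<and> (\<forall>x. (\<lambda>k. T k x) \<longlonglongrightarrow> S x) \<and> (\<forall>x. norm (S x) \<le> c * norm x)"
proof -
  define L where "L x = lim (\<lambda>k. T k x)" for x
  have L: "(\<lambda>k. T k x) \<longlonglongrightarrow> L x" for x
    unfolding L_def using conv convergent_LIMSEQ_iff by blast
  have nL: "norm (L x) \<le> c * norm x" for x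
    by (rule tendsto_upperbound[OF tendsto_norm[OF L]]) (auto simp: bound)
  have bl: "bounded_linear L"
  proof (rule bounded_linear_intro[where K = c])
    fix x y r
    show "L (x + y) = L x + L y"
      by (rule LIMSEQ_unique[OF L]) (auto simp: blinfun.add_right intro!: tendsto_add L)
    show "L (r *\<^sub>R x) = r *\<^sub>R L x"
      by (rule LIMSEQ_unique[OF L]) (auto simp: blinfun.scaleR_right intro!: tendsto_scaleR L)
    show "norm (L x) \<le> norm x * c" using nL[of x] by (simp add: mult.commute)
  qed
  have lin: "L (d *\<^sub>C x) = d *\<^sub>C L x" for d x
  proof (rule LIMSEQ_unique[OF L])
    have "bounded_linear (\<lambda>y :: 'b. d *\<^sub>C y)"
      by (rule bounded_linear_intro[where K = "norm d"])
        (simp_all add: scaleC_add_right norm_scaleC scaleR_scaleC scaleC_scaleC mult.commute)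
    from bounded_linear.tendsto[OF this L, of x]
    show "(\<lambda>k. T k (d *\<^sub>C x)) \<longlonglongrightarrow> d *\<^sub>C L x"
      using T by (simp add: clinear_opD)
  qed
  show ?thesis
    by (rule exI[of _ "Blinfun L"])
      (simp add: clinear_op_def bounded_linear_Blinfun_apply[OF bl] L nL lin)
qed


section \<open>Projections\<close>

lemma is_projectionD:
  assumes "is_projection P"
  shows "clinear_op P" and "P (P x) = P x" and "adj P = P"
    and "cinner (P x) y = cinner x (P y)"
proof -
  show c: "clinear_op P" and a: "adj P = P"
    using assms by (auto simp: is_projection_def bounded_ops_iff)
  show "P (P x) = P x"
    using assms by (metis is_projection_def blinfun_apply_blinfun_compose)
  show "cinner (P x) y = cinner x (P y)"
    using cinner_adj_right[OF c, of x y] a by simp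
qed

lemma is_projectionI:
  assumes "clinear_op P" "\<And>x. P (P x) = P x" "\<And>x y. cinner (P x) y = cinner x (P y)"
  shows "is_projection P"
  using assms by (auto simp: is_projection_def bounded_ops_iff intro!: blinfun_eqI adj_eqI)

lemma is_projection_zero [simp]: "is_projection 0"
  by (rule is_projectionI) auto

lemma is_projection_id [simp]: "is_projection id_blinfun"
  by (rule is_projectionI) auto

lemma norm_projection_sq:
  assumes "is_projection P"
  shows "cinner (P x) x = complex_of_real ((norm (P x))\<^sup>2)"
  by (metis assms cinner_self is_projectionD(2,4))

lemma norm_projection_le:
  assumes "is_projection P"
  shows "norm (P x) \<le> norm x"
proof -
  have "(norm (P x))\<^sup>2 = norm (cinner (P x) x)"
    by (simp only: norm_projection_sq[OF assms] norm_of_real abs_power2)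
  also have "\<dots> \<le> norm (P x) * norm x" by (rule cinner_Cauchy_Schwarz)
  finally show ?thesis
    by (cases "norm (P x) = 0") (auto simp: power2_eq_square)
qed

lemma norm_projection_diff_sq:
  assumes "is_projection P" "is_projection E" "E o\<^sub>L P = P"
  shows "(norm ((E - P) x))\<^sup>2 = (norm (E x))\<^sup>2 - (norm (P x))\<^sup>2"
proof -
  have EP: "E (P x) = P x" using assms(3) by (metis blinfun_apply_blinfun_compose)
  have "cinner (E x) (P x) = cinner (P x) (P x)"
    using EP is_projectionD[OF assms(1)] is_projectionD[OF assms(2)] by metis
  moreover have "cinner (P x) (E x) = cinner (P x) (P x)"
    using EP is_projectionD[OF assms(1)] is_projectionD[OF assms(2)] by metis
  ultimately show ?thesis
    by (simp add: norm_eq_cinner blinfun.diff_left cinner_diff_left cinner_diff_right)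
qed

lemma projection_absorb_commute:
  assumes "is_projection P" "is_projection E" "E o\<^sub>L P = P"
  shows "P o\<^sub>L E = P"
  using adj_compose[of E P] assms is_projectionD(1,3) by metis

lemma is_projection_diff:
  assumes "is_projection P" "is_projection E" "E o\<^sub>L P = P"
  shows "is_projection (E - P)"
proof (rule is_projectionI)
  note D = is_projectionD[OF assms(1)] is_projectionD[OF assms(2)]
  show "clinear_op (E - P)" by (intro clinear_op_diff D)
  have "E (P x) = P x" "P (E x) = P x" for x
    using assms(3) projection_absorb_commute[OF assms] by (metis blinfun_apply_blinfun_compose)+
  then show "(E - P) ((E - P) x) = (E - P) x" for x
    by (simp add: blinfun.diff_left blinfun.diff_right D)
  show "cinner ((E - P) x) y = cinner x ((E - P) y)" for x y
    by (simp add: blinfun.diff_left cinner_diff_left cinner_diff_right D)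
qed

lemma is_projection_add:
  assumes "is_projection P" "is_projection E" "E o\<^sub>L P = 0"
  shows "is_projection (E + P)"
proof (rule is_projectionI)
  note D = is_projectionD[OF assms(1)] is_projectionD[OF assms(2)]
  show "clinear_op (E + P)" by (intro clinear_op_add D)
  have 0: "E (P x) = 0" for x
    using assms(3) by (metis blinfun_apply_blinfun_compose blinfun.zero_left)
  have "P (E x) = 0" for x
    by (rule cinner_right_eqI) (metis 0 D(4,8) cinner_zero_left cinner_zero_right)
  with 0 show "(E + P) ((E + P) x) = (E + P) x" for x
    by (simp add: blinfun.add_left blinfun.add_right D)
  show "cinner ((E + P) x) y = cinner x ((E + P) y)" for x y
    by (simp add: blinfun.add_left cinner_add_left cinner_add_right D)
qed

text \<open>
  The order of projections is expressed below by \<open>E o\<^sub>L P = P\<close>, i.e. \<open>E\<close> fixes the range of \<open>P\<close>.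
\<close>

lemma op_le_projection_iff:
  assumes P: "is_projection P" and E: "is_projection E"
  shows "op_le P E \<longleftrightarrow> E o\<^sub>L P = P"
proof
  assume le: "op_le P E"
  show "E o\<^sub>L P = P"
  proof (rule blinfun_eqI)
    fix x
    define y where "y = P x"
    have Py: "P y = y" by (simp add: y_def is_projectionD[OF P])
    have "cinner ((E - P) y) y = complex_of_real ((norm (E y))\<^sup>2 - (norm y)\<^sup>2)"
      using norm_projection_sq[OF E, of y]
      by (simp add: blinfun.diff_left cinner_diff_left Py cinner_self)
    then have ge: "(norm (E y))\<^sup>2 \<ge> (norm y)\<^sup>2"
      using le by (auto simp: op_le_def complex_nonneg_Reals_iff dest!: spec[of _ y])
    have "(norm ((id_blinfun - E) y))\<^sup>2 = (norm y)\<^sup>2 - (norm (E y))\<^sup>2"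
      using norm_projection_diff_sq[OF E is_projection_id, of y]
      by (simp add: blinfun_eqI)
    with ge have "(norm ((id_blinfun - E) y))\<^sup>2 \<le> 0" by linarith
    then have "(id_blinfun - E) y = 0" by simp
    then show "(E o\<^sub>L P) x = P x" by (simp add: blinfun.diff_left y_def)
  qed
next
  assume EP: "E o\<^sub>L P = P"
  have "cinner ((E - P) x) x \<in> \<real>\<^sub>\<ge>\<^sub>0" for x
    unfolding norm_projection_sq[OF is_projection_diff[OF P E EP]] by simp
  then show "op_le P E" by (simp add: op_le_def)
qed

lemma projection_antisym:
  assumes "is_projection P" "is_projection E" "E o\<^sub>L P = P" "P o\<^sub>L E = E"
  shows "P = E"
  using projection_absorb_commute[OF assms(1-3)] assms(4) by simp

text \<open>If \<open>W\<^sup>*W\<close> is the projection \<open>E\<close>, then \<open>W\<close> vanishes on the complement of \<open>E\<close>.\<close>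

lemma initial_projection_absorb:
  fixes W :: "'a::complex_hilbert \<Rightarrow>\<^sub>L 'a"
  assumes W: "clinear_op W" and E: "is_projection E" and WE: "\<And>x. adj W (W x) = E x"
  shows "W (E x) = W x"
proof -
  have "cinner (W (x - E x)) (W (x - E x)) = cinner (E (x - E x)) (x - E x)"
    by (simp only: WE cinner_adj_left[OF W, symmetric])
  also have "\<dots> = 0" by (simp add: blinfun.diff_right is_projectionD(2)[OF E])
  finally have "W (x - E x) = 0" by (simp add: cinner_self)
  then show ?thesis by (simp add: blinfun.diff_right)
qed

lemma partial_isometry_of_initial_projection:
  fixes W :: "'a::complex_hilbert \<Rightarrow>\<^sub>L 'a"
  assumes W: "clinear_op W" and E: "is_projection E" and WE: "adj W o\<^sub>L W = E"
  shows "partial_isometry W" and "is_projection (W o\<^sub>L adj W)"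
proof -
  have WEx: "adj W (W x) = E x" for x using WE by (metis blinfun_apply_blinfun_compose)
  have nW: "(norm (W x))\<^sup>2 = (norm (E x))\<^sup>2" for x
  proof -
    have "complex_of_real ((norm (W x))\<^sup>2) = cinner x (adj W (W x))"
      by (simp only: cinner_self flip: cinner_adj_right[OF W])
    also have "\<dots> = complex_of_real ((norm (E x))\<^sup>2)"
      unfolding WEx by (metis norm_projection_sq[OF E] is_projectionD(4)[OF E])
    finally show ?thesis using of_real_eq_iff by blast
  qed
  have WEW: "W (E x) = W x" for x by (rule initial_projection_absorb[OF W E WEx])
  have "norm (W x) = norm x" if "\<forall>y. W y = 0 \<longrightarrow> cinner x y = 0" for x
  proof -
    have "cinner x (x - E x) = 0"
      using that by (simp add: blinfun.diff_right WEW)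
    then have "complex_of_real ((norm x)\<^sup>2) = complex_of_real ((norm (E x))\<^sup>2)"
      by (metis cinner_diff_right cinner_self eq_iff_diff_eq_0 is_projectionD(4)[OF E]
          norm_projection_sq[OF E])
    then have "(norm x)\<^sup>2 = (norm (E x))\<^sup>2" using of_real_eq_iff by blast
    then show ?thesis using nW[of x] by (simp add: power2_eq_iff_nonneg)
  qed
  then show "partial_isometry W"
    using W by (auto simp: partial_isometry_def bounded_ops_iff)
  show "is_projection (W o\<^sub>L adj W)"
    by (rule is_projectionI)
      (auto simp: clinear_op_compose clinear_op_adj W WEx WEW cinner_adj_right cinner_adj_left adj_adj)
qed


section \<open>Closure properties of von Neumann algebras\<close>

lemma commutant_subset: "commutant S \<subseteq> bounded_ops"
  by (auto simp: commutant_def)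

lemma commutantI:
  fixes T :: "'a::complex_hilbert \<Rightarrow>\<^sub>L 'a" and S :: "('a \<Rightarrow>\<^sub>L 'a) set"
  shows "clinear_op T \<Longrightarrow> (\<And>A x. A \<in> S \<Longrightarrow> T (A x) = A (T x)) \<Longrightarrow> T \<in> commutant S"
  by (auto simp: commutant_def bounded_ops_iff intro!: blinfun_eqI)

lemma commutantD:
  fixes T :: "'a::complex_hilbert \<Rightarrow>\<^sub>L 'a" and S :: "('a \<Rightarrow>\<^sub>L 'a) set"
  assumes "T \<in> commutant S"
  shows "clinear_op T" and "A \<in> S \<Longrightarrow> T (A x) = A (T x)"
proof -
  show "clinear_op T" using assms by (simp add: commutant_def bounded_ops_iff)
  assume "A \<in> S"
  then have "T o\<^sub>L A = A o\<^sub>L T" using assms by (simp add: commutant_def)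
  then show "T (A x) = A (T x)" by (metis blinfun_apply_blinfun_compose)
qed

lemma commutant_antimono: "S \<subseteq> T \<Longrightarrow> commutant T \<subseteq> commutant S"
  by (auto simp: commutant_def)

lemma subset_bicommutant: "S \<subseteq> bounded_ops \<Longrightarrow> S \<subseteq> commutant (commutant S)"
  by (intro subsetI commutantI) (auto simp: bounded_ops_iff commutantD(2)[of _ S])

lemma von_neumann_algebra_commutant:
  assumes S: "S \<subseteq> bounded_ops" and adj: "\<And>A. A \<in> S \<Longrightarrow> adj A \<in> S"
  shows "von_neumann_algebra (commutant S)"
  unfolding von_neumann_algebra_def
proof (intro conjI ballI)
  fix T assume T: "T \<in> commutant S"
  show "adj T \<in> commutant S"
  proof (rule commutantI)
    fix A x assume A: "A \<in> S"
    then have cA: "clinear_op A" using S by (auto simp: bounded_ops_iff)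
    have "T o\<^sub>L adj A = adj A o\<^sub>L T"
      using T adj[OF A] by (auto simp: commutant_def)
    then have "adj (T o\<^sub>L adj A) = adj (adj A o\<^sub>L T)" by simp
    then have "A o\<^sub>L adj T = adj T o\<^sub>L A"
      using cA commutantD(1)[OF T] by (simp add: adj_compose clinear_op_adj adj_adj)
    then show "adj T (A x) = A (adj T x)" by (metis blinfun_apply_blinfun_compose)
  qed (use T commutantD(1) clinear_op_adj in blast)
next
  show "commutant (commutant (commutant S)) = commutant S"
    using commutant_antimono[OF subset_bicommutant[OF S]]
      subset_bicommutant[OF commutant_subset] by blast
qed (rule commutant_subset)

lemma vN_generated_superset: "S \<subseteq> vN_generated S"
  by (auto simp: vN_generated_def)

lemma vN_generated_least: "von_neumann_algebra M \<Longrightarrow> S \<subseteq> M \<Longrightarrow> vN_generated S \<subseteq> M"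
  by (auto simp: vN_generated_def)

lemma von_neumann_algebra_bounded_ops: "von_neumann_algebra bounded_ops"
proof -
  have "bounded_ops = commutant ({} :: ('a \<Rightarrow>\<^sub>L 'a) set)" by (auto simp: commutant_def)
  then show ?thesis using von_neumann_algebra_commutant[of "{} :: ('a \<Rightarrow>\<^sub>L 'a) set"] by simp
qed

lemma von_neumann_algebra_vN_generated:
  assumes "S \<subseteq> bounded_ops"
  shows "von_neumann_algebra (vN_generated S)"
  unfolding von_neumann_algebra_def
proof (intro conjI ballI)
  show sub: "vN_generated S \<subseteq> bounded_ops"
    by (rule vN_generated_least[OF von_neumann_algebra_bounded_ops assms])
  show "adj A \<in> vN_generated S" if "A \<in> vN_generated S" for A
    using that by (auto simp: vN_generated_def von_neumann_algebra_def)
  have "commutant (commutant (vN_generated S)) \<subseteq> M" if "von_neumann_algebra M" "S \<subseteq> M" for M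
    using commutant_antimono[OF commutant_antimono[OF vN_generated_least[OF that]]] that
    by (simp add: von_neumann_algebra_def)
  then have "commutant (commutant (vN_generated S)) \<subseteq> vN_generated S"
    by (subst (2) vN_generated_def) blast
  then show "commutant (commutant (vN_generated S)) = vN_generated S"
    using subset_bicommutant[OF sub] by blast
qed

context
  fixes M :: "('a::complex_hilbert \<Rightarrow>\<^sub>L 'a) set"
  assumes M: "von_neumann_algebra M"
begin

lemma vN_clinear_op: "A \<in> M \<Longrightarrow> clinear_op A"
  using M by (auto simp: von_neumann_algebra_def bounded_ops_iff)

lemma vN_adj: "A \<in> M \<Longrightarrow> adj A \<in> M"
  using M by (auto simp: von_neumann_algebra_def)

lemma vN_memI:
  fixes T :: "'a \<Rightarrow>\<^sub>L 'a"
  shows "clinear_op T \<Longrightarrow> (\<And>B x. B \<in> commutant M \<Longrightarrow> T (B x) = B (T x)) \<Longrightarrow> T \<in> M"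
  using M commutantI[of T "commutant M"] by (auto simp: von_neumann_algebra_def)

lemma vN_commute: "A \<in> M \<Longrightarrow> B \<in> commutant M \<Longrightarrow> A (B x) = B (A x)"
  by (rule commutantD(2)[symmetric])

lemma vN_compose: "A \<in> M \<Longrightarrow> B \<in> M \<Longrightarrow> A o\<^sub>L B \<in> M"
  by (rule vN_memI) (simp_all add: clinear_op_compose vN_clinear_op vN_commute)

lemma vN_add: "A \<in> M \<Longrightarrow> B \<in> M \<Longrightarrow> A + B \<in> M"
  by (rule vN_memI)
    (simp_all add: clinear_op_add vN_clinear_op blinfun.add_left blinfun.add_right vN_commute)

lemma vN_diff: "A \<in> M \<Longrightarrow> B \<in> M \<Longrightarrow> A - B \<in> M"
  by (rule vN_memI)
    (simp_all add: clinear_op_diff vN_clinear_op blinfun.diff_left blinfun.diff_right vN_commute)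

lemma vN_id: "id_blinfun \<in> M"
  by (rule vN_memI) auto

lemma vN_zero: "0 \<in> M"
  by (rule vN_memI) auto

lemma vN_sum: "(\<And>i. i \<in> I \<Longrightarrow> A i \<in> M) \<Longrightarrow> sum A I \<in> M"
  by (induction I rule: infinite_finite_induct) (auto simp: vN_zero vN_add)

lemma vN_sot_limit:
  assumes A: "\<And>k. A k \<in> M" and T: "clinear_op T" and lim: "\<And>x. (\<lambda>k::nat. A k x) \<longlonglongrightarrow> T x"
  shows "T \<in> M"
proof (rule vN_memI[OF T])
  fix B x assume "B \<in> commutant M"
  then have "A k (B x) = B (A k x)" for k using A vN_commute by simp
  moreover have "(\<lambda>k. B (A k x)) \<longlonglongrightarrow> B (T x)"
    by (intro blinfun.tendsto tendsto_const lim)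
  ultimately show "T (B x) = B (T x)"
    using LIMSEQ_unique[OF lim[of "B x"]] by simp
qed

end


section \<open>Orthonormal families\<close>

text \<open>
  Families indexed by a set; for an orthonormal set of vectors the family is the identity function.
\<close>

definition orthonormal_family :: "'i set \<Rightarrow> ('i \<Rightarrow> 'a::complex_hilbert) \<Rightarrow> bool" where
  "orthonormal_family I e \<longleftrightarrow> (\<forall>i\<in>I. \<forall>j\<in>I. cinner (e i) (e j) = (if i = j then 1 else 0))"

lemma orthonormal_familyD:
  "orthonormal_family I e \<Longrightarrow> i \<in> I \<Longrightarrow> j \<in> I \<Longrightarrow> cinner (e i) (e j) = (if i = j then 1 else 0)"
  by (auto simp: orthonormal_family_def)

lemma Bessel_finite:
  assumes "orthonormal_family I e" "finite F" "F \<subseteq> I"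
  shows "(\<Sum>i\<in>F. (norm (cinner x (e i)))\<^sup>2) \<le> (norm x)\<^sup>2"
proof -
  define s where "s = (\<Sum>i\<in>F. (norm (cinner x (e i)))\<^sup>2)"
  define y where "y = (\<Sum>i\<in>F. cinner x (e i) *\<^sub>C e i)"
  have ye: "cinner y (e j) = cinner x (e j)" if "j \<in> F" for j
  proof -
    have "cinner y (e j) = (\<Sum>i\<in>F. cinner x (e i) * (if i = j then 1 else 0))"
      unfolding y_def cinner_sum_left cinner_scaleC_left
      using assms(1,3) that by (intro sum.cong refl) (simp add: orthonormal_familyD subset_iff)
    then show ?thesis using assms(2) that by (simp add: sum.delta' if_distrib cong: if_cong)
  qed
  have zy: "cinner z y = (\<Sum>i\<in>F. cnj (cinner x (e i)) * cinner z (e i))" for z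
    by (simp add: y_def cinner_sum_right cinner_scaleC_right)
  have sq: "cnj (cinner x (e i)) * cinner x (e i) = complex_of_real ((norm (cinner x (e i)))\<^sup>2)" for i
    by (simp only: complex_norm_square mult.commute)
  have yy: "cinner y y = of_real s"
    unfolding zy by (simp only: ye sq s_def of_real_sum cong: sum.cong)
  have xy: "cinner x y = of_real s"
    unfolding zy by (simp only: sq s_def of_real_sum)
  then have yx: "cinner y x = of_real s" by (metis cinner_commute complex_cnj_complex_of_real)
  have "0 \<le> (norm (x - y))\<^sup>2" by simp
  also have "\<dots> = (norm x)\<^sup>2 - s"
    unfolding norm_eq_cinner[of "x - y"]
    by (simp add: cinner_diff_left cinner_diff_right xy yx yy norm_eq_cinner)
  finally show ?thesis by (simp add: s_def)
qed

lemma cinner_chi: "cinner u (chi g) = l2_apply u g"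
proof -
  have "cinner u (chi g) = (\<Sum>\<^sub>\<infinity>x. cinner (l2_apply u x) (l2_apply (chi g) x))"
    by (simp add: cinner_l2.rep_eq)
  also have "\<dots> = (\<Sum>\<^sub>\<infinity>x\<in>{g}. cinner (l2_apply u x) (l2_apply (chi g) x))"
    by (rule infsum_cong_neutral) (auto simp: chi.rep_eq cinner_complex_def)
  finally show ?thesis by (simp add: chi.rep_eq cinner_complex_def)
qed

lemma l2_eqI: "(\<And>g. l2_apply u g = l2_apply v g) \<Longrightarrow> u = v"
  by (metis l2_apply_inject ext)

lemma L2_set_le_iff: "0 \<le> c \<Longrightarrow> L2_set f F \<le> c \<longleftrightarrow> (\<Sum>i\<in>F. (f i)\<^sup>2) \<le> c\<^sup>2"
  by (metis L2_set_def real_sqrt_le_iff real_sqrt_unique)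

text \<open>
  The coefficients of a vector with respect to the family \<open>e\<close>, extended by \<open>0\<close> outside the index
  set.
\<close>

definition basis_coeffs :: "'i set \<Rightarrow> ('i \<Rightarrow> 'a::complex_hilbert) \<Rightarrow> 'a \<Rightarrow>\<^sub>L ('i, complex) l2" where
  "basis_coeffs I e = Blinfun (\<lambda>x. Abs_l2 (\<lambda>i. if i \<in> I then cinner x (e i) else 0))"

context
  fixes I :: "'i set" and e :: "'i \<Rightarrow> 'a::complex_hilbert"
  assumes on: "orthonormal_family I e"
begin

lemma basis_coeffs_apply: "l2_apply (basis_coeffs I e x) i = (if i \<in> I then cinner x (e i) else 0)"
  and clinear_op_basis_coeffs: "clinear_op (basis_coeffs I e)"
proof -
  define u where "u x i = (if i \<in> I then cinner x (e i) else 0)" for x i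
  have bd: "L2_set (\<lambda>i. norm (u x i)) F \<le> norm x" if "finite F" for x F
  proof -
    have "(\<Sum>i\<in>F. (norm (u x i))\<^sup>2) = (\<Sum>i\<in>F \<inter> I. (norm (cinner x (e i)))\<^sup>2)"
      using that by (intro sum.mono_neutral_cong_right) (auto simp: u_def)
    also have "\<dots> \<le> (norm x)\<^sup>2" using that by (intro Bessel_finite[OF on]) auto
    finally show ?thesis by (simp add: L2_set_le_iff)
  qed
  have ss: "square_summable (u x)" and nu: "sqrt (\<Sum>\<^sub>\<infinity>i. (norm (u x i))\<^sup>2) \<le> norm x" for x
    using square_summable_bound[OF bd] by blast+
  have A: "l2_apply (Abs_l2 (u x)) = u x" for x
    using ss by (simp add: Abs_l2_inverse)
  have bl: "bounded_linear (\<lambda>x. Abs_l2 (u x))"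
  proof (rule bounded_linear_intro[where K = 1])
    fix x y r
    show "Abs_l2 (u (x + y)) = Abs_l2 (u x) + Abs_l2 (u y)"
      by (rule l2_eqI) (simp add: A plus_l2.rep_eq u_def cinner_add_left)
    show "Abs_l2 (u (r *\<^sub>R x)) = r *\<^sub>R Abs_l2 (u x)"
      by (rule l2_eqI)
        (simp add: A scaleR_l2.rep_eq u_def scaleR_scaleC[of r x] cinner_scaleC_left
          scaleR_conv_of_real)
    show "norm (Abs_l2 (u x)) \<le> norm x * 1" using nu by (simp add: norm_l2.rep_eq A)
  qed
  have "basis_coeffs I e = Blinfun (\<lambda>x. Abs_l2 (u x))"
    by (simp add: basis_coeffs_def u_def[abs_def])
  then have *: "basis_coeffs I e x = Abs_l2 (u x)" for x
    by (simp add: bounded_linear_Blinfun_apply[OF bl])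
  show "l2_apply (basis_coeffs I e x) i = (if i \<in> I then cinner x (e i) else 0)"
    by (simp add: * A) (simp add: u_def)
  show "clinear_op (basis_coeffs I e)"
    unfolding clinear_op_def
    by (intro allI l2_eqI) (simp add: * A scaleC_l2.rep_eq u_def cinner_scaleC_left scaleC_complex_def)
qed

lemma basis_coeffs_member: "i \<in> I \<Longrightarrow> basis_coeffs I e (e i) = chi i"
  by (rule l2_eqI) (auto simp: basis_coeffs_apply chi.rep_eq orthonormal_familyD[OF on])

lemma basis_coeffs_adj_coeffs:
  "l2_apply (basis_coeffs I e (adj (basis_coeffs I e) v)) i = (if i \<in> I then l2_apply v i else 0)"
  by (simp add: basis_coeffs_apply cinner_adj_left clinear_op_basis_coeffs basis_coeffs_member cinner_chi)

lemma basis_coeffs_adj_coeffs_coeffs: "basis_coeffs I e (adj (basis_coeffs I e) (basis_coeffs I e x)) = basis_coeffs I e x"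
  by (rule l2_eqI) (simp only: basis_coeffs_adj_coeffs, simp add: basis_coeffs_apply)

end

lemma basis_coeffs_adj_coeffs_orthogonal:
  assumes "orthonormal_family I e" "orthonormal_family J f"
    and "\<And>i j. i \<in> I \<Longrightarrow> j \<in> J \<Longrightarrow> cinner (e i) (f j) = 0"
  shows "basis_coeffs I e (adj (basis_coeffs J f) v) = 0"
proof (rule l2_eqI)
  fix i
  have "basis_coeffs J f (e i) = 0" if "i \<in> I"
    using assms(3) that by (intro l2_eqI) (simp add: basis_coeffs_apply[OF assms(2)] zero_l2.rep_eq)
  then show "l2_apply (basis_coeffs I e (adj (basis_coeffs J f) v)) i = l2_apply 0 i"
    by (simp add: basis_coeffs_apply[OF assms(1)] cinner_adj_left[OF clinear_op_basis_coeffs[OF assms(2)]]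
        zero_l2.rep_eq)
qed


section \<open>Orthonormal bases of the range of a projection\<close>

text \<open>
  \<open>B\<close> is an orthonormal basis of the range of the projection \<open>Q\<close>; totality is expressed by the
  absence of nonzero vectors in the range that are orthogonal to \<open>B\<close>.
\<close>

definition basis_of_range :: "('a::complex_hilbert \<Rightarrow>\<^sub>L 'a) \<Rightarrow> 'a set \<Rightarrow> bool" where
  "basis_of_range Q B \<longleftrightarrow> orthonormal_family B (\<lambda>b. b) \<and> (\<forall>b\<in>B. Q b = b) \<and>
    (\<forall>x. Q x = x \<longrightarrow> (\<forall>b\<in>B. cinner x b = 0) \<longrightarrow> x = 0)"

lemma ex_basis_of_range: "\<exists>B. basis_of_range Q B" if "clinear_op Q"
proof -
  define \<A> where "\<A> = {B. orthonormal_family B (\<lambda>b. b) \<and> (\<forall>b\<in>B. Q b = b)}"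
  have "\<exists>M\<in>\<A>. \<forall>X\<in>\<A>. M \<subseteq> X \<longrightarrow> X = M"
  proof (rule subset_Zorn_nonempty)
    show "\<A> \<noteq> {}" by (auto simp: \<A>_def orthonormal_family_def intro!: exI[of _ "{}"])
    fix \<C> assume C: "\<C> \<noteq> {}" "subset.chain \<A> \<C>"
    show "\<Union>\<C> \<in> \<A>"
      unfolding \<A>_def orthonormal_family_def
    proof (intro CollectI conjI ballI)
      fix b c assume "b \<in> \<Union>\<C>" "c \<in> \<Union>\<C>"
      then obtain X Y where "X \<in> \<C>" "Y \<in> \<C>" "b \<in> X" "c \<in> Y" by blast
      moreover from this C(2) have "X \<subseteq> Y \<or> Y \<subseteq> X" by (auto simp: subset_chain_def)
      ultimately obtain Z where "Z \<in> \<C>" "b \<in> Z" "c \<in> Z" by blast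
      moreover from this C(2) have "Z \<in> \<A>" by (auto simp: subset_chain_def)
      ultimately show "cinner b c = (if b = c then 1 else 0)"
        by (auto simp: \<A>_def orthonormal_family_def)
    qed (use C in \<open>auto simp: subset_chain_def \<A>_def\<close>)
  qed
  then obtain B where B: "B \<in> \<A>" and max: "\<And>X. X \<in> \<A> \<Longrightarrow> B \<subseteq> X \<Longrightarrow> X = B" by blast
  have "x = 0" if x: "Q x = x" "\<forall>b\<in>B. cinner x b = 0" for x
  proof (rule ccontr)
    assume "x \<noteq> 0"
    define y where "y = complex_of_real (inverse (norm x)) *\<^sub>C x"
    have y1: "cinner y y = 1"
      using \<open>x \<noteq> 0\<close> by (simp add: cinner_self y_def norm_scaleC norm_inverse)
    have yb: "cinner y b = 0" "cinner b y = 0" if "b \<in> B" for b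
      using x that cinner_commute[of b x]
      by (simp_all add: y_def cinner_scaleC_left cinner_scaleC_right)
    have "insert y B \<in> \<A>"
      using B y1 yb x(1) \<open>clinear_op Q\<close>
      by (auto simp: \<A>_def orthonormal_family_def clinear_opD y_def)
    then have "y \<in> B" using max by blast
    then show False using yb y1 by simp
  qed
  then show ?thesis using B by (auto simp: \<A>_def basis_of_range_def)
qed

text \<open>Expansion in a basis: the coefficient map and its adjoint compose to the projection.\<close>

lemma basis_coeffs_Parseval:
  assumes Q: "is_projection Q" and B: "basis_of_range Q B"
  shows "adj (basis_coeffs B (\<lambda>b. b)) (basis_coeffs B (\<lambda>b. b) x) = Q x"
proof -
  let ?U = "basis_coeffs B (\<lambda>b. b)"
  have on: "orthonormal_family B (\<lambda>b. b)" and Qb: "\<And>b. b \<in> B \<Longrightarrow> Q b = b"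
    and tot: "\<And>x. Q x = x \<Longrightarrow> (\<And>b. b \<in> B \<Longrightarrow> cinner x b = 0) \<Longrightarrow> x = 0"
    using B by (auto simp: basis_of_range_def)
  note U = basis_coeffs_apply[OF on] clinear_op_basis_coeffs[OF on]
  have UQ: "?U (Q z) = ?U z" for z
    by (rule l2_eqI) (simp add: U is_projectionD(4)[OF Q] Qb)
  have QU: "Q (adj ?U v) = adj ?U v" for v
    by (rule cinner_right_eqI)
      (simp add: is_projectionD(4)[OF Q, symmetric] cinner_adj_right[OF U(2), symmetric] UQ)
  have "Q x - adj ?U (?U x) = 0"
  proof (rule tot)
    show "Q (Q x - adj ?U (?U x)) = Q x - adj ?U (?U x)"
      by (simp add: blinfun.diff_right QU is_projectionD[OF Q])
    fix b assume b: "b \<in> B"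
    have "?U (Q x - adj ?U (?U x)) = 0"
      by (simp add: blinfun.diff_right UQ basis_coeffs_adj_coeffs_coeffs[OF on])
    then show "cinner (Q x - adj ?U (?U x)) b = 0"
      using U(1)[of "Q x - adj ?U (?U x)" b] b by (simp add: zero_l2.rep_eq)
  qed
  then show ?thesis by simp
qed

lemma basis_norm_finite:
  assumes Q: "is_projection Q" and B: "basis_of_range Q B" "finite B" and y: "Q y = y"
  shows "(\<Sum>b\<in>B. (norm (cinner y b))\<^sup>2) = (norm y)\<^sup>2"
proof -
  let ?U = "basis_coeffs B (\<lambda>b. b)"
  have on: "orthonormal_family B (\<lambda>b. b)" using B by (auto simp: basis_of_range_def)
  have "complex_of_real ((norm y)\<^sup>2) = cinner y (adj ?U (?U y))"
    by (simp only: basis_coeffs_Parseval[OF Q B(1)] y cinner_self)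
  also have "\<dots> = complex_of_real ((norm (?U y))\<^sup>2)"
    by (simp only: cinner_self flip: cinner_adj_right[OF clinear_op_basis_coeffs[OF on]])
  finally have "(norm y)\<^sup>2 = (norm (?U y))\<^sup>2" using of_real_eq_iff by blast
  also have "\<dots> = (\<Sum>\<^sub>\<infinity>b. (norm (l2_apply (?U y) b))\<^sup>2)"
    by (simp add: norm_l2.rep_eq infsum_nonneg)
  also have "\<dots> = (\<Sum>\<^sub>\<infinity>b\<in>B. (norm (cinner y b))\<^sup>2)"
    by (rule infsum_cong_neutral) (auto simp: basis_coeffs_apply[OF on])
  finally show ?thesis using B(2) by simp
qed

text \<open>
  If \<open>Q\<close> had a finite basis \<open>B\<close>, a partial isometry from \<open>P \<le> Q\<close> onto \<open>Q\<close> would give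
  $\sum_{b \in B} \|Pb\|^2 = \sum_{b \in B} \|Qb\|^2$ (equality of traces), whence \<open>P = Q\<close>.
\<close>

lemma infinite_projection_infinite_basis:
  assumes inf: "infinite_projection bounded_ops Q" and B: "basis_of_range Q B"
  shows "infinite B"
proof
  assume fin: "finite B"
  from inf obtain P V where Q: "is_projection Q" and P: "is_projection P" and "op_le P Q" "P \<noteq> Q"
    and V: "clinear_op V" "adj V o\<^sub>L V = P" "V o\<^sub>L adj V = Q"
    by (auto simp: infinite_projection_def mvn_equiv_def bounded_ops_iff)
  then have QP: "Q o\<^sub>L P = P" by (simp add: op_le_projection_iff)
  have QPx: "Q (P x) = P x" for x using QP by (metis blinfun_apply_blinfun_compose)
  have VP: "adj V (V x) = P x" and VQ: "V (adj V x) = Q x" for x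
    using V by (metis blinfun_apply_blinfun_compose)+
  have nV: "(norm (V x))\<^sup>2 = (norm (P x))\<^sup>2" for x
  proof -
    have "cinner (V x) (V x) = cinner (P x) (P x)"
      by (simp add: cinner_adj_right[OF V(1)] VP is_projectionD[OF P])
    then show ?thesis by (simp add: norm_eq_cinner)
  qed
  have nV': "(norm (adj V x))\<^sup>2 = (norm (Q x))\<^sup>2" for x
  proof -
    have "cinner (adj V x) (adj V x) = cinner (Q x) (Q x)"
      by (simp add: cinner_adj_left[OF V(1)] VQ is_projectionD[OF Q])
    then show ?thesis by (simp add: norm_eq_cinner)
  qed
  have VPx: "V (P x) = V x" for x by (rule initial_projection_absorb[OF V(1) P VP])
  have QV: "Q (V x) = V x" for x
    by (metis VP VQ VPx)
  have "P (adj V x) = adj V x" for x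
    by (rule cinner_right_eqI)
      (simp add: is_projectionD(4)[OF P, symmetric] cinner_adj_right[OF V(1), symmetric] VPx)
  then have QV': "Q (adj V x) = adj V x" for x by (metis QPx)
  have on: "orthonormal_family B (\<lambda>b. b)" and Qb: "\<And>b. b \<in> B \<Longrightarrow> Q b = b"
    and tot: "\<And>x. Q x = x \<Longrightarrow> (\<And>b. b \<in> B \<Longrightarrow> cinner x b = 0) \<Longrightarrow> x = 0"
    using B by (auto simp: basis_of_range_def)
  note pars = basis_norm_finite[OF Q B fin]
  have "(\<Sum>b\<in>B. (norm (P b))\<^sup>2) = (\<Sum>b\<in>B. \<Sum>c\<in>B. (norm (cinner (V b) c))\<^sup>2)"
    by (intro sum.cong refl) (simp add: pars QV nV)
  also have "\<dots> = (\<Sum>c\<in>B. \<Sum>b\<in>B. (norm (cinner (adj V c) b))\<^sup>2)"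
  proof (subst sum.swap, intro sum.cong refl)
    fix b c
    show "(norm (cinner (V b) c))\<^sup>2 = (norm (cinner (adj V c) b))\<^sup>2"
      by (metis cinner_adj_right[OF V(1)] cinner_commute complex_mod_cnj)
  qed
  also have "\<dots> = (\<Sum>b\<in>B. (norm (Q b))\<^sup>2)"
    by (intro sum.cong refl) (simp add: pars QV' nV')
  finally have "(\<Sum>b\<in>B. (norm ((Q - P) b))\<^sup>2) = 0"
    by (simp add: norm_projection_diff_sq[OF P Q QP] sum_subtractf)
  then have 0: "(Q - P) b = 0" if "b \<in> B" for b
    using that fin by (simp add: sum_nonneg_eq_0_iff)
  have "(Q - P) x = 0" for x
  proof (rule tot)
    show "Q ((Q - P) x) = (Q - P) x"
      by (simp add: blinfun.diff_left blinfun.diff_right is_projectionD[OF Q] QPx)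
    show "cinner ((Q - P) x) b = 0" if "b \<in> B" for b
      using 0[OF that] is_projectionD(4)[OF is_projection_diff[OF P Q QP]] by simp
  qed
  then have "Q = P" by (intro blinfun_eqI) (simp add: blinfun.diff_left)
  then show False using \<open>P \<noteq> Q\<close> by simp
qed

text \<open>
  An infinite basis \<open>B\<close> is the disjoint union of two copies \<open>f ` B\<close> and \<open>g ` B\<close> of itself.  The
  isometries \<open>S\<close>, \<open>T\<close> induced by \<open>f\<close>, \<open>g\<close> satisfy the relations of the Cuntz algebra
  $\mathcal O_2$ with unit \<open>Q\<close>.  No separability is needed.
\<close>

lemma infinite_projection_halving:
  assumes "infinite_projection bounded_ops (Q :: 'a::complex_hilbert \<Rightarrow>\<^sub>L 'a)"
  shows "\<exists>S T. clinear_op S \<and> clinear_op T \<and> adj S o\<^sub>L S = Q \<and> adj T o\<^sub>L T = Q \<and>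
    adj S o\<^sub>L T = 0 \<and> (S o\<^sub>L adj S) + (T o\<^sub>L adj T) = Q"
proof -
  have Q: "is_projection Q" using assms by (simp add: infinite_projection_def)
  obtain B where B: "basis_of_range Q B" using ex_basis_of_range is_projectionD(1)[OF Q] by blast
  have on: "orthonormal_family B (\<lambda>b. b)" and Qb: "\<And>b. b \<in> B \<Longrightarrow> Q b = b"
    and tot: "\<And>x. Q x = x \<Longrightarrow> (\<And>b. b \<in> B \<Longrightarrow> cinner x b = 0) \<Longrightarrow> x = 0"
    using B by (auto simp: basis_of_range_def)
  have "infinite B" by (rule infinite_projection_infinite_basis[OF assms B])
  then obtain h where h: "bij_betw h (B <+> B) B"
    using card_of_Plus_infinite1[OF _ card_of_mono1[OF order_refl]] card_of_ordIso by blast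
  define f g where "f = (\<lambda>b. h (Inl b))" and "g = (\<lambda>b. h (Inr b))"
  have fg: "f b \<in> B" "g b \<in> B" if "b \<in> B" for b
    using h that by (auto simp: f_def g_def bij_betw_def)
  have ne: "f b \<noteq> g c" and fi: "f b = f c \<longleftrightarrow> b = c" and gi: "g b = g c \<longleftrightarrow> b = c"
    if "b \<in> B" "c \<in> B" for b c
    using h that unfolding f_def g_def bij_betw_def
    by (auto dest!: inj_onD[of h "B <+> B"])
  have un: "b \<in> f ` B \<union> g ` B" if "b \<in> B" for b
  proof -
    from that h have "b \<in> h ` (B <+> B)" by (simp add: bij_betw_def)
    then show ?thesis by (auto simp: f_def g_def)
  qed
  have onf: "orthonormal_family B f" and ong: "orthonormal_family B g"
    using fg fi gi by (auto simp: orthonormal_family_def orthonormal_familyD[OF on])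
  have fg0: "cinner (f b) (g c) = 0" and gf0: "cinner (g c) (f b) = 0" if "b \<in> B" "c \<in> B" for b c
    using orthonormal_familyD[OF on fg(1)[OF that(1)] fg(2)[OF that(2)]]
      orthonormal_familyD[OF on fg(2)[OF that(2)] fg(1)[OF that(1)]] ne[OF that] by auto
  define U Uf Ug where "U = basis_coeffs B (\<lambda>b. b)" and "Uf = basis_coeffs B f" and "Ug = basis_coeffs B g"
  have lin: "clinear_op U" "clinear_op Uf" "clinear_op Ug"
    by (simp_all add: U_def Uf_def Ug_def clinear_op_basis_coeffs on onf ong)
  have UU: "adj U (U x) = Q x" for x
    unfolding U_def by (rule basis_coeffs_Parseval[OF Q B])
  have Uff: "Uf (adj Uf v) = U (adj U v)" "Ug (adj Ug v) = U (adj U v)" for v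
    unfolding U_def Uf_def Ug_def
    by (rule l2_eqI, simp add: basis_coeffs_adj_coeffs on onf ong)+
  have Ufg: "Uf (adj Ug v) = 0" "Ug (adj Uf v) = 0" for v
    unfolding Uf_def Ug_def
    by (rule basis_coeffs_adj_coeffs_orthogonal; use onf ong fg0 gf0 in blast)+
  have UUU: "U (adj U (U x)) = U x" "Uf (adj Uf (Uf x)) = Uf x" "Ug (adj Ug (Ug x)) = Ug x" for x
    by (simp_all add: U_def Uf_def Ug_def basis_coeffs_adj_coeffs_coeffs on onf ong)
  have fQ: "Uf (Q x) = Uf x" "Ug (Q x) = Ug x" for x
    unfolding Uf_def Ug_def
    by (rule l2_eqI, simp add: basis_coeffs_apply onf ong is_projectionD(4)[OF Q] Qb fg)+
  have Qf: "Q (adj Uf v) = adj Uf v" "Q (adj Ug v) = adj Ug v" for v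
    by (rule cinner_right_eqI, simp add: is_projectionD(4)[OF Q, symmetric] fQ
        cinner_adj_right[OF lin(2), symmetric] cinner_adj_right[OF lin(3), symmetric])+
  have fU: "adj Uf (U (adj U v)) = adj Uf v" "adj Ug (U (adj U v)) = adj Ug v" for v
    by (rule cinner_right_eqI, simp add: cinner_adj_right[OF lin(2), symmetric]
        cinner_adj_right[OF lin(3), symmetric] cinner_adj_left[OF lin(1), symmetric]
        cinner_adj_right[OF lin(1), symmetric],
        metis UUU Uff)+
  have sum: "adj Uf (Uf x) + adj Ug (Ug x) = Q x" for x
  proof -
    define z where "z = Q x - (adj Uf (Uf x) + adj Ug (Ug x))"
    have "Uf z = 0" "Ug z = 0"
      by (simp_all add: z_def blinfun.diff_right blinfun.add_right fQ Ufg UUU)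
    then have "cinner z (f b) = 0" "cinner z (g b) = 0" if "b \<in> B" for b
      using that basis_coeffs_apply[OF onf, of z b] basis_coeffs_apply[OF ong, of z b]
      by (simp_all add: Uf_def Ug_def zero_l2.rep_eq)
    then have zb: "cinner z b = 0" if "b \<in> B" for b using un[OF that] by blast
    have "Q z = z"
      by (simp add: z_def blinfun.diff_right blinfun.add_right Qf is_projectionD[OF Q])
    then have "z = 0" using zb by (rule tot)
    then show ?thesis by (simp add: z_def)
  qed
  define S T where "S = adj Uf o\<^sub>L U" and "T = adj Ug o\<^sub>L U"
  have adjs: "adj S = adj U o\<^sub>L Uf" "adj T = adj U o\<^sub>L Ug"
    by (simp_all add: S_def T_def adj_compose adj_adj clinear_op_adj lin)
  have app: "S x = adj Uf (U x)" "T x = adj Ug (U x)" for x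
    by (simp_all add: S_def T_def)
  show ?thesis
  proof (intro exI conjI)
    show "clinear_op S" "clinear_op T"
      by (simp_all add: S_def T_def clinear_op_compose clinear_op_adj lin)
    show "adj S o\<^sub>L S = Q" "adj T o\<^sub>L T = Q" "adj S o\<^sub>L T = 0"
      by (rule blinfun_eqI, simp add: adjs app Uff UUU UU Ufg is_projectionD[OF Q])+
    show "(S o\<^sub>L adj S) + (T o\<^sub>L adj T) = Q"
      by (rule blinfun_eqI) (simp add: adjs blinfun.add_left app fU sum)
  qed
qed


section \<open>Tensor products of operators\<close>

lemma tensor_ext:
  fixes S T :: "('g, 'h::complex_hilbert) l2 \<Rightarrow>\<^sub>L 'b::real_normed_vector"
  assumes "\<And>f h. S (f \<otimes>\<^sub>v h) = T (f \<otimes>\<^sub>v h)"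
  shows "S = T"
proof -
  have lin: "linear (blinfun_apply U)" for U :: "('g, 'h) l2 \<Rightarrow>\<^sub>L 'b"
    by (rule bounded_linear.linear[OF blinfun.bounded_linear_right])
  have "S x = T x" if "x \<in> span {f \<otimes>\<^sub>v h | f h. True}" for x
    by (rule linear_eq_on[OF lin lin that]) (use assms in auto)
  moreover have "closed {x. S x = T x}"
    by (intro closed_Collect_eq continuous_intros)
  ultimately have "closure (span {f \<otimes>\<^sub>v h | f h. True}) \<subseteq> {x. S x = T x}"
    by (intro closure_minimal) auto
  then show ?thesis
    unfolding closure_span_tensor by (intro blinfun_eqI) auto
qed

lemma cinner_chi_tensor: "cinner u (chi g \<otimes>\<^sub>v h) = cinner (l2_apply u g) h"
proof -
  have "cinner u (chi g \<otimes>\<^sub>v h) = (\<Sum>\<^sub>\<infinity>x. cinner (l2_apply u x) (l2_apply (chi g \<otimes>\<^sub>v h) x))"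
    by (simp add: cinner_l2.rep_eq)
  also have "\<dots> = (\<Sum>\<^sub>\<infinity>x\<in>{g}. cinner (l2_apply u x) (l2_apply (chi g \<otimes>\<^sub>v h) x))"
    by (rule infsum_cong_neutral) (auto simp: tensor.rep_eq chi.rep_eq)
  finally show ?thesis by (simp add: tensor.rep_eq chi.rep_eq)
qed

lemma cinner_tensor_eqI:
  assumes "\<And>g h. cinner u (chi g \<otimes>\<^sub>v h) = cinner v (chi g \<otimes>\<^sub>v h)"
  shows "u = v"
  by (rule l2_eqI, rule cinner_left_eqI) (use assms in \<open>simp add: cinner_chi_tensor\<close>)

lemma tensor_diff_left: "(f - f') \<otimes>\<^sub>v h = f \<otimes>\<^sub>v h - f' \<otimes>\<^sub>v h"
  by (rule l2_eqI) (simp add: tensor.rep_eq minus_l2.rep_eq complex_vector.scale_left_diff_distrib)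

text \<open>The operator on $\ell^2(I; K)$ that applies \<open>A\<close> in every coordinate.\<close>

definition coordinatewise :: "('k::complex_hilbert \<Rightarrow>\<^sub>L 'k) \<Rightarrow> ('i, 'k) l2 \<Rightarrow>\<^sub>L ('i, 'k) l2" where
  "coordinatewise A = Blinfun (\<lambda>u. Abs_l2 (\<lambda>i. A (l2_apply u i)))"

lemma coordinatewise_apply:
  fixes A :: "'k::complex_hilbert \<Rightarrow>\<^sub>L 'k" and u :: "('i, 'k) l2"
  shows "l2_apply (coordinatewise A u) i = A (l2_apply u i)"
proof -
  define v where "v = (\<lambda>(u :: ('i, 'k) l2) i. A (l2_apply u i))"
  have bd: "L2_set (\<lambda>i. norm (v u i)) F \<le> norm A * norm u" if "finite F" for u :: "('i, 'k) l2" and F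
  proof -
    have "L2_set (\<lambda>i. norm (v u i)) F \<le> L2_set (\<lambda>i. norm A * norm (l2_apply u i)) F"
      unfolding v_def by (intro L2_set_mono norm_blinfun) auto
    also have "\<dots> = norm A * L2_set (\<lambda>i. norm (l2_apply u i)) F"
      by (simp add: L2_set_right_distrib)
    also have "\<dots> \<le> norm A * norm u"
      unfolding norm_l2.rep_eq using that by (intro mult_left_mono L2_set_le_l2) auto
    finally show ?thesis .
  qed
  have ap: "l2_apply (Abs_l2 (v u)) = v u" for u
    using square_summable_bound(1)[of "v u", OF bd] by (simp add: Abs_l2_inverse)
  have nm: "norm (Abs_l2 (v u)) \<le> norm A * norm u" for u
    unfolding norm_l2.rep_eq[of "Abs_l2 _"] ap using square_summable_bound(2)[of "v u", OF bd] by simp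
  have bl: "bounded_linear (\<lambda>u. Abs_l2 (v u))"
  proof (rule bounded_linear_intro[where K = "norm A"])
    fix u w and r :: real
    show "Abs_l2 (v (u + w)) = Abs_l2 (v u) + Abs_l2 (v w)"
      by (rule l2_eqI) (simp add: ap plus_l2.rep_eq, simp add: v_def plus_l2.rep_eq blinfun.add_right)
    show "Abs_l2 (v (r *\<^sub>R u)) = r *\<^sub>R Abs_l2 (v u)"
      by (rule l2_eqI)
        (simp add: ap scaleR_l2.rep_eq, simp add: v_def scaleR_l2.rep_eq blinfun.scaleR_right)
    show "norm (Abs_l2 (v u)) \<le> norm u * norm A"
      using nm[of u] by (simp add: mult.commute)
  qed
  have "coordinatewise A = Blinfun (\<lambda>u. Abs_l2 (v u))"
    by (simp add: coordinatewise_def v_def)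
  then have app: "coordinatewise A u = Abs_l2 (v u)"
    by (simp add: bounded_linear_Blinfun_apply[OF bl])
  show "l2_apply (coordinatewise A u) i = A (l2_apply u i)"
    unfolding app ap by (simp add: v_def)
qed

lemma clinear_op_coordinatewise: "clinear_op A \<Longrightarrow> clinear_op (coordinatewise A)"
  unfolding clinear_op_def[of "coordinatewise A"]
  by (intro allI l2_eqI) (simp add: coordinatewise_apply scaleC_l2.rep_eq clinear_opD)

lemma coordinatewise_tensor: "clinear_op B \<Longrightarrow> coordinatewise B (f \<otimes>\<^sub>v h) = f \<otimes>\<^sub>v B h"
  by (rule l2_eqI) (simp add: coordinatewise_apply tensor.rep_eq clinear_opD)

lemma has_sum_sum:
  fixes f :: "'i \<Rightarrow> 'a \<Rightarrow> real"
  assumes "\<And>i. i \<in> F \<Longrightarrow> (f i has_sum s i) A"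
  shows "((\<lambda>x. \<Sum>i\<in>F. f i x) has_sum (\<Sum>i\<in>F. s i)) A"
  using assms by (induction F rule: infinite_finite_induct) (auto intro!: has_sum_add)

text \<open>
  With respect to an orthonormal basis \<open>B\<close> of \<open>H\<close>, the space $\ell^2(G; H)$ is identified with
  $\ell^2(B; \ell^2(G))$, on which $A \otimes 1$ acts coordinatewise.
\<close>

lemma ex_tensor_flip:
  "\<exists>(J :: ('g, 'h::complex_hilbert) l2 \<Rightarrow>\<^sub>L ('h, ('g, complex) l2) l2) B.
    clinear_op J \<and> basis_of_range (id_blinfun :: 'h \<Rightarrow>\<^sub>L 'h) B \<and>
    (\<forall>f h b. l2_apply (J (f \<otimes>\<^sub>v h)) b = (if b \<in> B then cinner h b else 0) *\<^sub>C f)"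
proof -
  obtain B where B: "basis_of_range (id_blinfun :: 'h \<Rightarrow>\<^sub>L 'h) B"
    using ex_basis_of_range clinear_op_id by blast
  then have on: "orthonormal_family B (\<lambda>b. b)" by (simp add: basis_of_range_def)
  define comp :: "('g, 'h) l2 \<Rightarrow> 'h \<Rightarrow> ('g, complex) l2"
    where "comp u b = Abs_l2 (\<lambda>g. cinner (l2_apply u g) b)" for u b
  define v where "v u b = (if b \<in> B then comp u b else 0)" for u b
  have sq: "square_summable (\<lambda>g. cinner (l2_apply u g) b)" for u :: "('g, 'h) l2" and b
  proof (rule square_summable_bound(1))
    fix F :: "'g set" assume F: "finite F"
    have "L2_set (\<lambda>g. norm (cinner (l2_apply u g) b)) F \<le> L2_set (\<lambda>g. norm (l2_apply u g) * norm b) F"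
      by (intro L2_set_mono cinner_Cauchy_Schwarz) auto
    also have "\<dots> = L2_set (\<lambda>g. norm (l2_apply u g)) F * norm b"
      by (simp add: L2_set_left_distrib)
    also have "\<dots> \<le> norm u * norm b"
      unfolding norm_l2.rep_eq using F by (intro mult_right_mono L2_set_le_l2) auto
    finally show "L2_set (\<lambda>g. norm (cinner (l2_apply u g) b)) F \<le> norm u * norm b" .
  qed
  then have comp: "l2_apply (comp u b) = (\<lambda>g. cinner (l2_apply u g) b)" for u b
    by (simp add: comp_def Abs_l2_inverse)
  have bd: "L2_set (\<lambda>b. norm (v u b)) F \<le> norm u" if F: "finite F" for u F
  proof -
    have "(\<Sum>b\<in>F. (norm (v u b))\<^sup>2) = (\<Sum>b\<in>F \<inter> B. (norm (comp u b))\<^sup>2)"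
      using F by (intro sum.mono_neutral_cong_right) (auto simp: v_def)
    also have "\<dots> = (\<Sum>b\<in>F \<inter> B. \<Sum>\<^sub>\<infinity>g. (norm (cinner (l2_apply u g) b))\<^sup>2)"
      by (simp add: norm_l2.rep_eq comp infsum_nonneg)
    also have "\<dots> \<le> (\<Sum>\<^sub>\<infinity>g. (norm (l2_apply u g))\<^sup>2)"
    proof (rule has_sum_mono)
      show "((\<lambda>g. \<Sum>b\<in>F \<inter> B. (norm (cinner (l2_apply u g) b))\<^sup>2) has_sum
          (\<Sum>b\<in>F \<inter> B. \<Sum>\<^sub>\<infinity>g. (norm (cinner (l2_apply u g) b))\<^sup>2)) UNIV"
        using sq[of u] by (intro has_sum_sum has_sum_infsum) (simp add: square_summable_def)
      show "((\<lambda>g. (norm (l2_apply u g))\<^sup>2) has_sum (\<Sum>\<^sub>\<infinity>g. (norm (l2_apply u g))\<^sup>2)) UNIV"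
        using square_summable_l2_apply[of u]
        by (intro has_sum_infsum) (simp add: square_summable_def)
    qed (use F in \<open>auto intro!: Bessel_finite[OF on]\<close>)
    also have "\<dots> = (norm u)\<^sup>2" by (simp add: norm_l2.rep_eq infsum_nonneg)
    finally show ?thesis by (simp add: L2_set_le_iff)
  qed
  have ap: "l2_apply (Abs_l2 (v u)) = v u" for u
    using square_summable_bound(1)[OF bd] by (simp add: Abs_l2_inverse)
  have bl: "bounded_linear (\<lambda>u. Abs_l2 (v u))"
  proof (rule bounded_linear_intro[where K = 1])
    fix u w r
    show "Abs_l2 (v (u + w)) = Abs_l2 (v u) + Abs_l2 (v w)"
      by (intro l2_eqI) (simp add: ap plus_l2.rep_eq v_def comp cinner_add_left zero_l2.rep_eq)
    show "Abs_l2 (v (r *\<^sub>R u)) = r *\<^sub>R Abs_l2 (v u)"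
      by (intro l2_eqI)
        (simp add: ap scaleR_l2.rep_eq v_def comp zero_l2.rep_eq scaleR_scaleC[of r "l2_apply u _"]
          cinner_scaleC_left scaleR_conv_of_real)
    show "norm (Abs_l2 (v u)) \<le> norm u * 1"
      using square_summable_bound(2)[OF bd] by (simp add: norm_l2.rep_eq[of "Abs_l2 _"] ap)
  qed
  show ?thesis
  proof (intro exI[of _ "Blinfun (\<lambda>u. Abs_l2 (v u))"] exI[of _ B] conjI B allI)
    show "clinear_op (Blinfun (\<lambda>u. Abs_l2 (v u)))"
      unfolding clinear_op_def bounded_linear_Blinfun_apply[OF bl]
      by (intro allI l2_eqI)
        (simp add: ap scaleC_l2.rep_eq v_def comp zero_l2.rep_eq cinner_scaleC_left scaleC_complex_def)
    show "l2_apply (Blinfun (\<lambda>u. Abs_l2 (v u)) (f \<otimes>\<^sub>v h)) b = (if b \<in> B then cinner h b else 0) *\<^sub>C f"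
      for f h b
      unfolding bounded_linear_Blinfun_apply[OF bl]
      by (intro l2_eqI)
        (simp add: ap v_def comp zero_l2.rep_eq tensor.rep_eq cinner_scaleC_left scaleC_l2.rep_eq
          scaleC_complex_def mult.commute)
  qed
qed

lemma op_tensor_exists:
  fixes A :: "('g, complex) l2 \<Rightarrow>\<^sub>L ('g, complex) l2" and B :: "'h::complex_hilbert \<Rightarrow>\<^sub>L 'h"
  assumes A: "clinear_op A" and B: "clinear_op B"
  shows "\<exists>T. clinear_op T \<and> (\<forall>f h. blinfun_apply T (f \<otimes>\<^sub>v h) = A f \<otimes>\<^sub>v B h)"
proof -
  obtain J :: "('g, 'h) l2 \<Rightarrow>\<^sub>L ('h, ('g, complex) l2) l2" and K
    where cJ: "clinear_op J" and K: "basis_of_range (id_blinfun :: 'h \<Rightarrow>\<^sub>L 'h) K"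
      and J: "\<And>f h b. l2_apply (J (f \<otimes>\<^sub>v h)) b = (if b \<in> K then cinner h b else 0) *\<^sub>C f"
    using ex_tensor_flip by blast
  have on: "orthonormal_family K (\<lambda>b. b)" using K by (simp add: basis_of_range_def)
  let ?U = "basis_coeffs K (\<lambda>b. b)"
  have U: "cinner (?U h) (?U h') = cinner h h'" for h h'
    by (simp add: cinner_adj_right[OF clinear_op_basis_coeffs[OF on]]
        basis_coeffs_Parseval[OF is_projection_id K])
  have JJ: "cinner (J (f \<otimes>\<^sub>v h)) (J (f' \<otimes>\<^sub>v h')) = cinner (f \<otimes>\<^sub>v h) (f' \<otimes>\<^sub>v h')" for f f' h h'
  proof -
    have "cinner (J (f \<otimes>\<^sub>v h)) (J (f' \<otimes>\<^sub>v h'))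
        = (\<Sum>\<^sub>\<infinity>b. cinner (l2_apply (?U h) b) (l2_apply (?U h') b) * cinner f f')"
      unfolding cinner_l2.rep_eq[of "J _"] J basis_coeffs_apply[OF on]
      by (simp add: cinner_scaleC_left cinner_scaleC_right cinner_complex_def mult_ac)
    also have "\<dots> = cinner (?U h) (?U h') * cinner f f'"
      by (simp only: infsum_cmult_left' cinner_l2.rep_eq[of "?U _"])
    finally show ?thesis by (simp add: U cinner_tensor mult.commute)
  qed
  have J1: "adj J (J (f \<otimes>\<^sub>v h)) = f \<otimes>\<^sub>v h" for f h
    by (rule cinner_tensor_eqI) (simp add: cinner_adj_left[OF cJ] JJ)
  have AJ: "coordinatewise A (J (f \<otimes>\<^sub>v h)) = J (A f \<otimes>\<^sub>v h)" for f h
    by (rule l2_eqI) (simp add: coordinatewise_apply J clinear_opD[OF A])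
  show ?thesis
    by (rule exI[of _ "(adj J o\<^sub>L coordinatewise A o\<^sub>L J) o\<^sub>L coordinatewise B"])
      (simp add: clinear_op_compose clinear_op_adj cJ clinear_op_coordinatewise A B
        coordinatewise_tensor AJ J1)
qed

context
  fixes A :: "('g, complex) l2 \<Rightarrow>\<^sub>L ('g, complex) l2" and B :: "'h::complex_hilbert \<Rightarrow>\<^sub>L 'h"
  assumes A: "clinear_op A" and B: "clinear_op B"
begin

lemma op_tensor_apply: "(A \<otimes>\<^sub>o B) (f \<otimes>\<^sub>v h) = A f \<otimes>\<^sub>v B h"
  and clinear_op_tensor: "clinear_op (A \<otimes>\<^sub>o B)"
proof -
  obtain T where T: "clinear_op T" "\<And>f h. blinfun_apply T (f \<otimes>\<^sub>v h) = A f \<otimes>\<^sub>v B h"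
    using op_tensor_exists[OF A B] by blast
  then have "A \<otimes>\<^sub>o B = T" by (intro op_tensor_eqI)
  with T show "(A \<otimes>\<^sub>o B) (f \<otimes>\<^sub>v h) = A f \<otimes>\<^sub>v B h" and "clinear_op (A \<otimes>\<^sub>o B)" by simp_all
qed

lemma adj_op_tensor: "adj (A \<otimes>\<^sub>o B) = adj A \<otimes>\<^sub>o adj B"
proof (rule op_tensor_eqI[symmetric])
  show "adj (A \<otimes>\<^sub>o B) (f \<otimes>\<^sub>v h) = adj A f \<otimes>\<^sub>v adj B h" for f h
    by (rule cinner_tensor_eqI)
      (simp add: cinner_adj_left clinear_op_tensor op_tensor_apply cinner_tensor A B)
qed

end

lemma op_tensor_compose:
  assumes "clinear_op A" "clinear_op B" "clinear_op A'" "clinear_op B'"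
  shows "(A \<otimes>\<^sub>o B) o\<^sub>L (A' \<otimes>\<^sub>o B') = (A o\<^sub>L A') \<otimes>\<^sub>o (B o\<^sub>L B')"
  by (rule op_tensor_eqI[symmetric]) (simp add: op_tensor_apply assms)

lemma op_tensor_diff_left:
  assumes "clinear_op A" "clinear_op A'" "clinear_op B"
  shows "(A - A') \<otimes>\<^sub>o B = (A \<otimes>\<^sub>o B) - (A' \<otimes>\<^sub>o B)"
  by (rule op_tensor_eqI) (simp add: blinfun.diff_left op_tensor_apply assms tensor_diff_left)

lemma op_tensor_id [simp]: "id_blinfun \<otimes>\<^sub>o id_blinfun = id_blinfun"
  by (rule op_tensor_eqI) simp

lemma op_tensor_zero_left [simp]: "0 \<otimes>\<^sub>o B = 0"
  by (rule op_tensor_eqI) (simp, rule l2_eqI, simp add: tensor.rep_eq zero_l2.rep_eq)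

lemma op_tensor_zero_right [simp]: "A \<otimes>\<^sub>o 0 = 0"
  by (rule op_tensor_eqI) (simp, rule l2_eqI,
      simp add: tensor.rep_eq zero_l2.rep_eq complex_vector.scale_zero_right)

lemma is_projection_op_tensor:
  assumes "is_projection P" "is_projection Q"
  shows "is_projection (P \<otimes>\<^sub>o Q)"
  using assms
  by (auto simp: is_projection_def bounded_ops_iff clinear_op_tensor op_tensor_compose adj_op_tensor)


section \<open>The right group von Neumann algebra and its trace\<close>

lemma clinear_op_left_regular: "clinear_op (left_regular g)"
  unfolding clinear_op_def left_regular_apply
  by (intro allI l2_eqI) (simp add: left_translate.rep_eq scaleC_l2.rep_eq)

lemma clinear_op_right_regular: "clinear_op (right_regular g)"
  unfolding clinear_op_def right_regular_apply
  by (intro allI l2_eqI) (simp add: right_translate.rep_eq scaleC_l2.rep_eq)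

lemma adj_left_regular: "adj (left_regular g) = left_regular (- g)"
proof (rule adj_eqI)
  fix u v
  show "cinner (left_regular g u) v = cinner u (left_regular (- g) v)"
    using infsum_reindex_bij_betw[OF bij_translate(1)[of g],
        of "\<lambda>x. cinner (l2_apply u (- g + x)) (l2_apply v x)"]
    by (simp add: cinner_l2.rep_eq left_regular_apply left_translate.rep_eq)
qed

lemma left_right_regular_commute:
  "left_regular g (right_regular h f) = right_regular h (left_regular g f)"
  unfolding left_regular_apply right_regular_apply
  by (rule l2_eqI) (simp add: left_translate.rep_eq right_translate.rep_eq add.assoc)

lemma von_neumann_algebra_right_vN: "von_neumann_algebra right_vN"
  unfolding right_vN_def
  by (rule von_neumann_algebra_vN_generated) (auto simp: bounded_ops_iff clinear_op_right_regular)

lemma von_neumann_algebra_left_vN: "von_neumann_algebra left_vN"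
  unfolding left_vN_def
  by (rule von_neumann_algebra_vN_generated) (auto simp: bounded_ops_iff clinear_op_left_regular)

lemma right_vN_commutes_left_regular:
  fixes A :: "('g::group_add, complex) l2 \<Rightarrow>\<^sub>L ('g, complex) l2"
  assumes "A \<in> right_vN"
  shows "A (left_regular g x) = left_regular g (A x)"
proof -
  let ?L = "range left_regular :: (('g, complex) l2 \<Rightarrow>\<^sub>L ('g, complex) l2) set"
  have "von_neumann_algebra (commutant ?L)"
    by (rule von_neumann_algebra_commutant)
      (auto simp: bounded_ops_iff clinear_op_left_regular adj_left_regular)
  moreover have "range right_regular \<subseteq> commutant ?L"
  proof (intro image_subsetI commutantI)
    fix h and A :: "('g, complex) l2 \<Rightarrow>\<^sub>L ('g, complex) l2" and x
    assume "A \<in> ?L"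
    then show "right_regular h (A x) = A (right_regular h x)"
      by (elim imageE) (simp only: left_right_regular_commute)
  qed (rule clinear_op_right_regular)
  ultimately have "right_vN \<subseteq> commutant ?L"
    unfolding right_vN_def by (rule vN_generated_least)
  then have "A \<in> commutant ?L" using assms by blast
  then show ?thesis by (rule commutantD(2)) simp
qed

lemma right_vN_commutes_left_vN:
  fixes A B :: "('g::group_add, complex) l2 \<Rightarrow>\<^sub>L ('g, complex) l2"
  assumes "A \<in> right_vN" "B \<in> left_vN"
  shows "A (B x) = B (A x)"
proof -
  let ?R = "right_vN :: (('g, complex) l2 \<Rightarrow>\<^sub>L ('g, complex) l2) set"
  note M = von_neumann_algebra_right_vN
  have "von_neumann_algebra (commutant ?R)"
    by (rule von_neumann_algebra_commutant) (auto simp: bounded_ops_iff vN_clinear_op[OF M] vN_adj[OF M])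
  moreover have "range left_regular \<subseteq> commutant ?R"
  proof (intro image_subsetI commutantI)
    show "left_regular h (A x) = A (left_regular h x)" if "A \<in> ?R"
      for h and A :: "('g, complex) l2 \<Rightarrow>\<^sub>L ('g, complex) l2" and x
      by (rule right_vN_commutes_left_regular[OF that, symmetric])
  qed (rule clinear_op_left_regular)
  ultimately have "left_vN \<subseteq> commutant ?R"
    unfolding left_vN_def by (rule vN_generated_least)
  then have "B \<in> commutant right_vN" using assms by blast
  then show ?thesis using assms(1) by (rule commutantD(2)[symmetric])
qed

lemma right_vN_apply_chi: "A \<in> right_vN \<Longrightarrow> A (chi g) = left_regular g (A (chi 0))"
  using right_vN_commutes_left_regular[of A g "chi 0"] by (simp add: left_regular_chi)

text \<open>
  The vector state of \<open>chi 0\<close> is faithful, since the left translates of \<open>chi 0\<close> are total and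
  left translations commute with the algebra.
\<close>

lemma right_vN_projection_faithful:
  assumes P: "P \<in> right_vN" "is_projection P" and "P (chi 0) = 0"
  shows "P = 0"
proof (rule blinfun_eqI)
  fix x
  have "P (chi g) = 0" for g
    by (subst right_vN_apply_chi[OF P(1)]) (simp add: assms(3))
  then have "l2_apply (P x) g = 0" for g
    using is_projectionD(4)[OF P(2), of x "chi g"] by (simp add: cinner_chi)
  then show "P x = blinfun_apply 0 x" by (intro l2_eqI) (simp add: zero_l2.rep_eq)
qed

text \<open>
  The vector state of \<open>chi 0\<close> is a trace: $\langle A^* \chi_0, \chi_g \rangle$ is the conjugate of
  $\langle A \chi_0, \chi_{-g} \rangle$.
\<close>

lemma right_vN_norm_adj_chi:
  assumes A: "A \<in> right_vN"
  shows "norm (adj A (chi 0)) = norm (A (chi 0))"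
proof -
  have cA: "clinear_op A" by (rule vN_clinear_op[OF von_neumann_algebra_right_vN A])
  have "l2_apply (adj A (chi 0)) g = cnj (l2_apply (A (chi 0)) (- g))" for g
  proof -
    have "l2_apply (adj A (chi 0)) g = cinner (chi 0) (A (chi g))"
      by (simp add: cinner_adj_left[OF cA] flip: cinner_chi)
    also have "\<dots> = cinner (chi 0) (left_regular g (A (chi 0)))"
      by (subst right_vN_apply_chi[OF A]) (rule refl)
    also have "\<dots> = cinner (chi (- g)) (A (chi 0))"
      by (simp add: cinner_adj_left[OF clinear_op_left_regular, symmetric] adj_left_regular
          left_regular_chi)
    finally show ?thesis by (metis cinner_chi cinner_commute)
  qed
  moreover have "bij (uminus :: 'a \<Rightarrow> 'a)"
    by (rule bij_betw_byWitness[of _ uminus]) auto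
  ultimately show ?thesis
    by (simp add: norm_l2.rep_eq norm_reindex(2))
qed

lemma norm_chi: "norm (chi g) = 1"
proof -
  have "complex_of_real ((norm (chi g))\<^sup>2) = 1"
    by (simp only: flip: cinner_self) (simp add: cinner_chi chi.rep_eq)
  then have "(norm (chi g))\<^sup>2 = 1" by (metis of_real_eq_1_iff)
  then show ?thesis using power2_eq_iff_nonneg[of "norm (chi g)" 1] by simp
qed

text \<open>
  After compression by $L_e^*$ the operator norm is controlled by the 2-norm $\|A \chi_0\|$ of
  the trace.  This is why a path that is merely continuous in the 2-norm suffices.
\<close>

lemma norm_L_op_op_tensor_le:
  assumes A: "A \<in> right_vN"
  shows "norm (adj (L_op 0) o\<^sub>L (A \<otimes>\<^sub>o (id_blinfun :: 'h::complex_hilbert \<Rightarrow>\<^sub>L 'h))) \<le> norm (A (chi 0))"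
proof -
  let ?L = "L_op 0 :: 'h \<Rightarrow>\<^sub>L ('a, 'h) l2" and ?T = "A \<otimes>\<^sub>o (id_blinfun :: 'h \<Rightarrow>\<^sub>L 'h)"
  have cA: "clinear_op A" by (rule vN_clinear_op[OF von_neumann_algebra_right_vN A])
  have cT: "clinear_op ?T" by (simp add: clinear_op_tensor cA)
  have cL: "clinear_op ?L"
    unfolding clinear_op_def L_op_apply
    by (intro allI l2_eqI) (simp add: tensor.rep_eq scaleC_l2.rep_eq scaleC_scaleC mult.commute)
  have "adj ?L o\<^sub>L ?T = adj (adj ?T o\<^sub>L ?L)"
    by (simp add: adj_compose clinear_op_adj cT cL adj_adj)
  then have "norm (adj ?L o\<^sub>L ?T) \<le> norm (adj ?T o\<^sub>L ?L)"
    using norm_adj_le clinear_op_compose clinear_op_adj cT cL by metis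
  also have "\<dots> \<le> norm (A (chi 0))"
  proof (rule norm_blinfun_bound)
    show "norm ((adj ?T o\<^sub>L ?L) h) \<le> norm (A (chi 0)) * norm h" for h
      by (simp add: adj_op_tensor cA op_tensor_apply clinear_op_adj L_op_apply norm_tensor
          right_vN_norm_adj_chi[OF A])
  qed simp
  finally show ?thesis .
qed


section \<open>Monotone limits of projections\<close>

lemma projection_le_trans:
  assumes "E o\<^sub>L P = P" "F o\<^sub>L E = E"
  shows "F o\<^sub>L P = P"
proof (rule blinfun_eqI)
  fix x
  have "E (P x) = P x" "F (E (P x)) = E (P x)"
    using assms by (metis blinfun_apply_blinfun_compose)+
  then show "(F o\<^sub>L P) x = P x" by simp
qed

lemma projection_mono_limit:
  fixes E :: "nat \<Rightarrow> 'a::complex_hilbert \<Rightarrow>\<^sub>L 'a"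
  assumes E: "\<And>k. is_projection (E k)" and mono: "\<And>k. E (Suc k) o\<^sub>L E k = E k"
  shows "\<exists>S. is_projection S \<and> (\<forall>x. (\<lambda>k. E k x) \<longlonglongrightarrow> S x) \<and> (\<forall>k. S o\<^sub>L E k = E k) \<and>
    (\<forall>F. (\<forall>k. F o\<^sub>L E k = E k) \<longrightarrow> F o\<^sub>L S = S)"
proof -
  have le: "E k o\<^sub>L E j = E j" if "j \<le> k" for j k
    using that
  proof (induction rule: dec_induct)
    case base
    then show ?case using E by (simp add: is_projection_def)
  next
    case (step n)
    then show ?case using projection_le_trans mono by blast
  qed
  have diff: "(norm (E k x - E j x))\<^sup>2 = (norm (E k x))\<^sup>2 - (norm (E j x))\<^sup>2" if "j \<le> k" for j k x
    using norm_projection_diff_sq[OF E E le[OF that], of x] by (simp add: blinfun.diff_left)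
  have conv: "convergent (\<lambda>k. E k x)" for x
  proof -
    have "incseq (\<lambda>k. (norm (E k x))\<^sup>2)"
    proof (rule incseq_SucI)
      show "(norm (E k x))\<^sup>2 \<le> (norm (E (Suc k) x))\<^sup>2" for k
        using diff[of k "Suc k" x] zero_le_power2[of "norm (E (Suc k) x - E k x)"] by linarith
    qed
    moreover have "\<forall>k. (norm (E k x))\<^sup>2 \<le> (norm x)\<^sup>2"
      by (intro allI power_mono norm_projection_le E) auto
    ultimately have "convergent (\<lambda>k. (norm (E k x))\<^sup>2)"
      using incseq_convergent[of "\<lambda>k. (norm (E k x))\<^sup>2" "(norm x)\<^sup>2"]
      unfolding convergent_def by metis
    then have C: "Cauchy (\<lambda>k. (norm (E k x))\<^sup>2)" by (rule convergent_Cauchy)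
    have "Cauchy (\<lambda>k. E k x)"
    proof (rule metric_CauchyI)
      fix e :: real assume "0 < e"
      then obtain M where M: "\<And>m n. m \<ge> M \<Longrightarrow> n \<ge> M \<Longrightarrow>
          dist ((norm (E m x))\<^sup>2) ((norm (E n x))\<^sup>2) < e\<^sup>2"
        using metric_CauchyD[OF C, of "e\<^sup>2"] by (metis zero_less_power)
      have *: "dist (E m x) (E n x) < e" if "n \<ge> M" "n \<le> m" for m n
      proof -
        have "(norm (E m x - E n x))\<^sup>2 < e\<^sup>2"
          using M[of m n] that unfolding diff[OF that(2)] by (simp add: dist_real_def)
        then show ?thesis using \<open>0 < e\<close> by (simp add: dist_norm power2_less_imp_less)
      qed
      have "dist (E m x) (E n x) < e" if "m \<ge> M" "n \<ge> M" for m n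
        using *[of n m] *[of m n] that dist_commute[of "E m x"] nat_le_linear[of m n] by auto
      then show "\<exists>M. \<forall>m\<ge>M. \<forall>n\<ge>M. dist (E m x) (E n x) < e" by blast
    qed
    then show ?thesis by (rule Cauchy_convergent)
  qed
  obtain S where S: "clinear_op S" "\<And>x. (\<lambda>k. E k x) \<longlonglongrightarrow> S x"
    using clinear_op_pointwise_limit[of E 1] is_projectionD(1)[OF E] norm_projection_le[OF E] conv
    by auto
  have SE: "S (E k x) = E k x" for k x
  proof (rule LIMSEQ_unique[OF S(2)], rule tendsto_eventually)
    have "E n (E k x) = E k x" if "n \<ge> k" for n
      using le[OF that] by (metis blinfun_apply_blinfun_compose)
    then show "\<forall>\<^sub>F n in sequentially. E n (E k x) = E k x"
      using eventually_sequentially by blast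
  qed
  have lub: "F (S x) = S x" if "\<forall>k. F o\<^sub>L E k = E k" for F x
  proof -
    have "F (E k x) = E k x" for k using that by (metis blinfun_apply_blinfun_compose)
    then have "(\<lambda>k. E k x) \<longlonglongrightarrow> F (S x)"
      using blinfun.tendsto[OF tendsto_const S(2), of F x] by simp
    then show ?thesis using LIMSEQ_unique[OF _ S(2)] by blast
  qed
  have "S o\<^sub>L E k = E k" for k by (rule blinfun_eqI) (simp add: SE)
  moreover from this have "is_projection S"
  proof (intro is_projectionI S(1))
    show "S (S x) = S x" for x using lub calculation by blast
    fix x y
    have "(\<lambda>k. cinner (E k x) y) \<longlonglongrightarrow> cinner (S x) y"
      by (rule bounded_linear.tendsto[OF bounded_linear_cinner_left S(2)])
    moreover have "(\<lambda>k. cinner x (E k y)) \<longlonglongrightarrow> cinner x (S y)"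
      by (rule bounded_linear.tendsto[OF bounded_linear_cinner_right S(2)])
    ultimately show "cinner (S x) y = cinner x (S y)"
      using LIMSEQ_unique by (simp add: is_projectionD(4)[OF E]) blast
  qed
  moreover have "\<forall>F. (\<forall>k. F o\<^sub>L E k = E k) \<longrightarrow> F o\<^sub>L S = S"
    by (auto intro!: blinfun_eqI lub)
  ultimately show ?thesis using S(2) by blast
qed


section \<open>Continuous chains of projections\<close>

text \<open>
  The value on a projection of the trace given by the unit vector \<open>chi 0\<close>; for other operators
  it is the square of the 2-norm.
\<close>

definition canonical_trace :: "(('g::group_add, complex) l2 \<Rightarrow>\<^sub>L ('g, complex) l2) \<Rightarrow> real" where
  "canonical_trace P = (norm (P (chi 0)))\<^sup>2"

text \<open>The projections of the right group von Neumann algebra.\<close>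

definition right_projections :: "(('g::group_add, complex) l2 \<Rightarrow>\<^sub>L ('g, complex) l2) set" where
  "right_projections = {P \<in> right_vN. is_projection P}"

lemma right_projectionsD:
  "P \<in> right_projections \<Longrightarrow> P \<in> right_vN" "P \<in> right_projections \<Longrightarrow> is_projection P"
  by (auto simp: right_projections_def)

lemma right_projections_diff:
  "P \<in> right_projections \<Longrightarrow> E \<in> right_projections \<Longrightarrow> E o\<^sub>L P = P \<Longrightarrow> E - P \<in> right_projections"
  by (auto simp: right_projections_def is_projection_diff vN_diff[OF von_neumann_algebra_right_vN])

lemma right_projections_zero: "0 \<in> right_projections"
  and right_projections_id: "id_blinfun \<in> right_projections"
  by (auto simp: right_projections_def vN_zero vN_id von_neumann_algebra_right_vN)

lemma right_projections_complement:
  assumes "P \<in> right_projections"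
  shows "id_blinfun - P \<in> right_projections"
  by (rule right_projections_diff[OF assms right_projections_id]) (simp add: blinfun_eqI)

lemma canonical_trace_diff:
  assumes "P \<in> right_projections" "E \<in> right_projections" "E o\<^sub>L P = P"
  shows "(norm ((E - P) (chi 0)))\<^sup>2 = canonical_trace E - canonical_trace P"
  using norm_projection_diff_sq[OF right_projectionsD(2)[OF assms(1)] right_projectionsD(2)[OF assms(2)] assms(3)]
  by (simp add: canonical_trace_def)

lemma canonical_trace_mono:
  assumes "P \<in> right_projections" "E \<in> right_projections" "E o\<^sub>L P = P"
  shows "canonical_trace P \<le> canonical_trace E"
  using canonical_trace_diff[OF assms] zero_le_power2[of "norm ((E - P) (chi 0))"] by linarith

lemma canonical_trace_strict:
  assumes "P \<in> right_projections" "E \<in> right_projections" "E o\<^sub>L P = P"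
    and "canonical_trace E \<le> canonical_trace P"
  shows "P = E"
proof -
  have "(norm ((E - P) (chi 0)))\<^sup>2 \<le> 0" using canonical_trace_diff[OF assms(1-3)] assms(4) by simp
  then have "(E - P) (chi 0) = 0" by simp
  then have "E - P = 0"
    using right_projections_diff[OF assms(1-3)] right_projectionsD
    by (intro right_vN_projection_faithful) auto
  then show ?thesis by simp
qed

lemma canonical_trace_le_1: "P \<in> right_projections \<Longrightarrow> canonical_trace P \<le> 1"
  unfolding canonical_trace_def
  using norm_projection_le[OF right_projectionsD(2), of P "chi 0"]
  by (simp add: norm_chi power_le_one)

text \<open>
  The supremum of a chain of projections is the strong limit of an increasing sequence in the
  chain whose traces converge to the supremum of the traces; no transfinite limit is needed,
  since the trace is faithful.
\<close>

lemma chain_Sup: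
  fixes D :: "(('g::group_add, complex) l2 \<Rightarrow>\<^sub>L ('g, complex) l2) set"
  assumes D: "D \<subseteq> right_projections" "D \<noteq> {}"
    and chain: "\<And>E F. E \<in> D \<Longrightarrow> F \<in> D \<Longrightarrow> E o\<^sub>L F = F \<or> F o\<^sub>L E = E"
  shows "\<exists>S\<in>right_projections. (\<forall>E\<in>D. S o\<^sub>L E = E) \<and>
    (\<forall>F. (\<forall>E\<in>D. F o\<^sub>L E = E) \<longrightarrow> F o\<^sub>L S = S) \<and> canonical_trace S = Sup (canonical_trace ` D)"
proof -
  define s where "s = Sup (canonical_trace ` D)"
  have bdd: "bdd_above (canonical_trace ` D)"
    using D(1) canonical_trace_le_1 by (auto intro!: bdd_aboveI2)
  have upper: "canonical_trace E \<le> s" if "E \<in> D" for E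
    unfolding s_def using that bdd by (intro cSup_upper) auto
  have approx: "\<exists>E\<in>D. s - 1 / Suc n < canonical_trace E" for n
  proof -
    have "s - 1 / Suc n < Sup (canonical_trace ` D)" by (simp add: s_def)
    from less_cSupD[OF _ this] D(2) show ?thesis by blast
  qed
  have "\<exists>E. \<forall>n. (E n \<in> D \<and> s - 1 / Suc n < canonical_trace (E n)) \<and> E (Suc n) o\<^sub>L E n = E n"
  proof (rule dependent_nat_choice)
    show "\<exists>E. E \<in> D \<and> s - 1 / Suc 0 < canonical_trace E" using approx[of 0] by auto
    fix E n assume E: "E \<in> D \<and> s - 1 / Suc n < canonical_trace E"
    obtain F where F: "F \<in> D" "s - 1 / Suc (Suc n) < canonical_trace F" using approx by blast
    show "\<exists>F. (F \<in> D \<and> s - 1 / Suc (Suc n) < canonical_trace F) \<and> F o\<^sub>L E = E"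
    proof (cases "F o\<^sub>L E = E")
      case True
      then show ?thesis using F by blast
    next
      case False
      then have "E o\<^sub>L F = F" using chain E F by blast
      then have "canonical_trace F \<le> canonical_trace E" using E F D(1) by (intro canonical_trace_mono) auto
      moreover have "E o\<^sub>L E = E" using E D(1) by (auto simp: right_projections_def is_projection_def)
      ultimately show ?thesis using E F by (intro exI[of _ E]) auto
    qed
  qed
  then obtain E where E: "\<And>n. E n \<in> D" "\<And>n. s - 1 / Suc n < canonical_trace (E n)"
    "\<And>n. E (Suc n) o\<^sub>L E n = E n" by blast
  have Ep: "E n \<in> right_projections" for n using E D by blast
  obtain S where S: "is_projection S" "\<And>x. (\<lambda>k. E k x) \<longlonglongrightarrow> S x" "\<And>k. S o\<^sub>L E k = E k"
    and lub: "\<And>F. (\<forall>k. F o\<^sub>L E k = E k) \<Longrightarrow> F o\<^sub>L S = S"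
    using projection_mono_limit[of E, OF right_projectionsD(2)[OF Ep] E(3)] by blast
  have "S \<in> right_vN"
    by (rule vN_sot_limit[OF von_neumann_algebra_right_vN right_projectionsD(1)[OF Ep]
          is_projectionD(1)[OF S(1)] S(2)])
  then have Sp: "S \<in> right_projections" using S(1) by (simp add: right_projections_def)
  have "(\<lambda>k. canonical_trace (E k)) \<longlonglongrightarrow> canonical_trace S"
    unfolding canonical_trace_def by (intro tendsto_power tendsto_norm S(2))
  moreover have "(\<lambda>k. canonical_trace (E k)) \<longlonglongrightarrow> s"
  proof (rule real_tendsto_sandwich)
    show "(\<lambda>k. s - 1 / Suc k) \<longlonglongrightarrow> s"
      using tendsto_diff[OF tendsto_const[of s] LIMSEQ_inverse_real_of_nat]
      by (simp add: inverse_eq_divide)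
    show "\<forall>\<^sub>F k in sequentially. canonical_trace (E k) \<le> s"
      using upper E(1) by (intro always_eventually) blast
    show "\<forall>\<^sub>F k in sequentially. s - 1 / Suc k \<le> canonical_trace (E k)"
      using E(2) by (intro always_eventually allI less_imp_le)
  qed simp
  ultimately have s: "canonical_trace S = s" by (rule LIMSEQ_unique)
  have "S o\<^sub>L F = F" if F: "F \<in> D" for F
  proof (cases "\<exists>k. E k o\<^sub>L F = F")
    case True
    then obtain k where "E k o\<^sub>L F = F" by blast
    then show ?thesis using S(3)[of k] by (rule projection_le_trans)
  next
    case False
    then have "\<forall>k. F o\<^sub>L E k = E k" using chain[OF E(1) F] by blast
    then have "F o\<^sub>L S = S" by (rule lub)
    moreover have "F \<in> right_projections" using F D(1) by blast
    moreover have "canonical_trace F \<le> canonical_trace S" using upper[OF F] s by simp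
    ultimately have "S = F" using canonical_trace_strict[OF Sp, of F] by blast
    then show ?thesis using S(1) by (simp add: is_projection_def)
  qed
  moreover have "F o\<^sub>L S = S" if "\<forall>E\<in>D. F o\<^sub>L E = E" for F
    by (rule lub) (simp add: that E(1))
  ultimately show ?thesis
    by (intro bexI[OF _ Sp] conjI ballI allI impI) (simp_all only: s s_def)
qed

lemma complement_le_iff:
  assumes "P \<in> right_projections" "E \<in> right_projections"
  shows "(id_blinfun - P) o\<^sub>L (id_blinfun - E) = id_blinfun - E \<longleftrightarrow> E o\<^sub>L P = P"
proof -
  note D = right_projectionsD(2)[OF assms(1)] right_projectionsD(2)[OF assms(2)]
  have "(id_blinfun - P) o\<^sub>L (id_blinfun - E) = id_blinfun - E \<longleftrightarrow> P o\<^sub>L E = P"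
  proof -
    have *: "A = B \<longleftrightarrow> (\<forall>x. A x = B x)" for A B :: "('a, complex) l2 \<Rightarrow>\<^sub>L ('a, complex) l2"
      using blinfun_eqI by blast
    show ?thesis
      unfolding * by (simp add: blinfun.diff_left blinfun.diff_right)
  qed
  also have "\<dots> \<longleftrightarrow> E o\<^sub>L P = P"
    using adj_compose[of P E] adj_compose[of E P] is_projectionD(1,3)[OF D(1)]
      is_projectionD(1,3)[OF D(2)] by auto
  finally show ?thesis .
qed

lemma canonical_trace_complement:
  assumes "P \<in> right_projections"
  shows "canonical_trace (id_blinfun - P) = 1 - canonical_trace P"
proof -
  have "id_blinfun o\<^sub>L P = P" by (auto intro: blinfun_eqI)
  from canonical_trace_diff[OF assms right_projections_id this] show ?thesis
    by (simp add: canonical_trace_def norm_chi)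
qed

lemma chain_Inf:
  fixes D :: "(('g::group_add, complex) l2 \<Rightarrow>\<^sub>L ('g, complex) l2) set"
  assumes D: "D \<subseteq> right_projections" "D \<noteq> {}"
    and chain: "\<And>E F. E \<in> D \<Longrightarrow> F \<in> D \<Longrightarrow> E o\<^sub>L F = F \<or> F o\<^sub>L E = E"
    and bound: "\<And>E. E \<in> D \<Longrightarrow> t \<le> canonical_trace E"
  shows "\<exists>S\<in>right_projections. (\<forall>E\<in>D. E o\<^sub>L S = S) \<and>
    (\<forall>F\<in>right_projections. (\<forall>E\<in>D. E o\<^sub>L F = F) \<longrightarrow> S o\<^sub>L F = F) \<and> t \<le> canonical_trace S"
proof -
  define D' where "D' = (\<lambda>E. id_blinfun - E) ` D"
  have D': "D' \<subseteq> right_projections" "D' \<noteq> {}"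
    using D right_projections_complement by (auto simp: D'_def)
  have ch: "E o\<^sub>L F = F \<or> F o\<^sub>L E = E" if EF: "E \<in> D'" "F \<in> D'" for E F
  proof -
    obtain E' F' where "E' \<in> D" "E = id_blinfun - E'" "F' \<in> D" "F = id_blinfun - F'"
      using EF unfolding D'_def by blast
    then show ?thesis
      using chain[of E' F'] complement_le_iff[of E' F'] complement_le_iff[of F' E'] D(1) by auto
  qed
  obtain T where T: "T \<in> right_projections" "\<And>E. E \<in> D' \<Longrightarrow> T o\<^sub>L E = E"
    "\<And>F. (\<forall>E\<in>D'. F o\<^sub>L E = E) \<Longrightarrow> F o\<^sub>L T = T" "canonical_trace T = Sup (canonical_trace ` D')"
    using chain_Sup[OF D' ch] by blast
  define S where "S = id_blinfun - T"
  have S: "S \<in> right_projections" "T = id_blinfun - S"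
    using right_projections_complement[OF T(1)] by (simp_all add: S_def)
  have "canonical_trace T \<le> 1 - t"
    unfolding T(4)
  proof (rule cSup_least)
    show "canonical_trace ` D' \<noteq> {}" using D' by blast
    fix y assume "y \<in> canonical_trace ` D'"
    then obtain E where "E \<in> D" "y = canonical_trace (id_blinfun - E)" by (auto simp: D'_def)
    then show "y \<le> 1 - t" using bound[of E] D(1) canonical_trace_complement[of E] by auto
  qed
  then have "t \<le> canonical_trace S" using canonical_trace_complement[OF S(1)] S(2) by simp
  moreover have "E o\<^sub>L S = S" if "E \<in> D" for E
    using T(2)[of "id_blinfun - E"] complement_le_iff[of S E] that S D(1) by (auto simp: D'_def)
  moreover have "S o\<^sub>L F = F" if F: "F \<in> right_projections" "\<forall>E\<in>D. E o\<^sub>L F = F" for F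
  proof -
    have "(id_blinfun - F) o\<^sub>L T = T"
      using F complement_le_iff[OF F(1)] D(1) by (intro T(3)) (auto simp: D'_def)
    then show ?thesis using complement_le_iff[OF F(1) S(1)] S(2) by simp
  qed
  ultimately show ?thesis using S(1) by blast
qed

text \<open>
  A maximal chain of projections through \<open>R\<close> takes every value of the trace exactly once: a gap
  in the values would be filled by a proper subprojection of the difference of its end points.
\<close>

lemma ex_projection_path:
  fixes R :: "('g::group_add, complex) l2 \<Rightarrow>\<^sub>L ('g, complex) l2"
  assumes diffuse: "\<nexists>P. minimal_projection (right_vN :: (('g, complex) l2 \<Rightarrow>\<^sub>L ('g, complex) l2) set) P"
    and R: "R \<in> right_projections"
  shows "\<exists>E. \<forall>t\<in>{0..1::real}. E t \<in> right_projections \<and> canonical_trace (E t) = t \<and>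
    (E t o\<^sub>L R = R \<or> R o\<^sub>L E t = E t) \<and>
    (\<forall>s\<in>{0..1}. s \<le> t \<longrightarrow> E t o\<^sub>L E s = E s)"
proof -
  define \<A> where "\<A> = {C. C \<subseteq> right_projections \<and> R \<in> C \<and>
    (\<forall>E\<in>C. \<forall>F\<in>C. E o\<^sub>L F = F \<or> F o\<^sub>L E = E)}"
  have RR: "P o\<^sub>L P = P" if "P \<in> right_projections" for P :: "('g, complex) l2 \<Rightarrow>\<^sub>L ('g, complex) l2"
    using that by (auto simp: right_projections_def is_projection_def)
  have "\<exists>M\<in>\<A>. \<forall>X\<in>\<A>. M \<subseteq> X \<longrightarrow> X = M"
  proof (rule subset_Zorn_nonempty)
    show "\<A> \<noteq> {}" using R RR by (auto simp: \<A>_def intro!: exI[of _ "{R}"])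
    fix \<C> assume C: "\<C> \<noteq> {}" "subset.chain \<A> \<C>"
    show "\<Union>\<C> \<in> \<A>"
      unfolding \<A>_def
    proof (intro CollectI conjI ballI)
      fix E F assume "E \<in> \<Union>\<C>" "F \<in> \<Union>\<C>"
      then obtain X Y where "X \<in> \<C>" "Y \<in> \<C>" "E \<in> X" "F \<in> Y" by blast
      moreover from this C(2) have "X \<subseteq> Y \<or> Y \<subseteq> X" by (auto simp: subset_chain_def)
      ultimately obtain Z where "Z \<in> \<C>" "E \<in> Z" "F \<in> Z" by blast
      moreover from this C(2) have "Z \<in> \<A>" by (auto simp: subset_chain_def)
      ultimately show "E o\<^sub>L F = F \<or> F o\<^sub>L E = E" by (auto simp: \<A>_def)
    qed (use C in \<open>auto simp: subset_chain_def \<A>_def\<close>)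
  qed
  then obtain C where C: "C \<in> \<A>" and max: "\<And>X. X \<in> \<A> \<Longrightarrow> C \<subseteq> X \<Longrightarrow> X = C" by blast
  have Cp: "E \<in> right_projections" if "E \<in> C" for E using C that by (auto simp: \<A>_def)
  have chain: "E o\<^sub>L F = F \<or> F o\<^sub>L E = E" if "E \<in> C" "F \<in> C" for E F
    using C that by (auto simp: \<A>_def)
  have memI: "P \<in> C" if P: "P \<in> right_projections" "\<And>F. F \<in> C \<Longrightarrow> P o\<^sub>L F = F \<or> F o\<^sub>L P = P" for P
  proof -
    have "insert P C \<in> \<A>" using C P RR by (auto simp: \<A>_def)
    then show ?thesis using max by blast
  qed
  have mono: "F o\<^sub>L E = E" if "E \<in> C" "F \<in> C" "canonical_trace E \<le> canonical_trace F" for E F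
  proof (rule ccontr)
    assume not: "F o\<^sub>L E \<noteq> E"
    then have "E o\<^sub>L F = F" using chain[OF that(1,2)] by blast
    then have "F = E" by (rule canonical_trace_strict[OF Cp[OF that(2)] Cp[OF that(1)] _ that(3)])
    then show False using not RR[OF Cp[OF that(1)]] by simp
  qed
  have zero: "0 \<in> C"
  proof (rule memI[OF right_projections_zero], rule disjI2)
    show "F o\<^sub>L 0 = 0" for F :: "('g, complex) l2 \<Rightarrow>\<^sub>L ('g, complex) l2"
      by (rule blinfun_eqI) simp
  qed
  have one: "id_blinfun \<in> C"
  proof (rule memI[OF right_projections_id], rule disjI1)
    show "id_blinfun o\<^sub>L F = F" for F :: "('g, complex) l2 \<Rightarrow>\<^sub>L ('g, complex) l2"
      by (rule blinfun_eqI) simp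
  qed
  have ex: "\<exists>E\<in>C. canonical_trace E = t" if t: "t \<in> {0..1}" for t
  proof (rule ccontr)
    assume no: "\<not> (\<exists>E\<in>C. canonical_trace E = t)"
    define D where "D = {E \<in> C. canonical_trace E \<le> t}"
    define D' where "D' = {E \<in> C. t \<le> canonical_trace E}"
    have Dp: "D \<subseteq> right_projections" and D'p: "D' \<subseteq> right_projections"
      using Cp by (auto simp: D_def D'_def)
    have Dch: "E o\<^sub>L F = F \<or> F o\<^sub>L E = E" if "E \<in> D" "F \<in> D" for E F
      by (rule chain) (use that in \<open>simp_all add: D_def\<close>)
    have D'ch: "E o\<^sub>L F = F \<or> F o\<^sub>L E = E" if "E \<in> D'" "F \<in> D'" for E F
      by (rule chain) (use that in \<open>simp_all add: D'_def\<close>)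
    have D't: "t \<le> canonical_trace E" if "E \<in> D'" for E using that by (simp add: D'_def)
    have "0 \<in> D" using zero t by (simp add: D_def canonical_trace_def)
    obtain S where S: "S \<in> right_projections" "\<And>E. E \<in> D \<Longrightarrow> S o\<^sub>L E = E"
      "\<And>F. (\<forall>E\<in>D. F o\<^sub>L E = E) \<Longrightarrow> F o\<^sub>L S = S" "canonical_trace S = Sup (canonical_trace ` D)"
      using chain_Sup[OF Dp _ Dch] \<open>0 \<in> D\<close> by blast
    have "id_blinfun \<in> D'" using one t by (simp add: D'_def canonical_trace_def norm_chi)
    obtain T where T: "T \<in> right_projections" "\<And>E. E \<in> D' \<Longrightarrow> E o\<^sub>L T = T"
      "\<And>F. F \<in> right_projections \<Longrightarrow> (\<forall>E\<in>D'. E o\<^sub>L F = F) \<Longrightarrow> T o\<^sub>L F = F"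
      "t \<le> canonical_trace T"
      using chain_Inf[OF D'p _ D'ch D't] \<open>id_blinfun \<in> D'\<close> by blast
    have DD': "F o\<^sub>L E = E" if "E \<in> D" "F \<in> D'" for E F
      by (rule mono) (use that in \<open>simp_all add: D_def D'_def\<close>)
    have split: "F \<in> D \<or> F \<in> D'" if "F \<in> C" for F using that by (auto simp: D_def D'_def)
    have FS: "F o\<^sub>L S = S" if "F \<in> D'" for F
      by (rule S(3)) (use DD' that in blast)
    have TF: "T o\<^sub>L F = F" if "F \<in> D" for F
    proof (rule T(3))
      show "F \<in> right_projections" using Dp that by blast
    qed (use DD' that in blast)
    have SC: "S \<in> C"
      by (rule memI[OF S(1)]) (use split S(2) FS in blast)
    have TC: "T \<in> C"
      by (rule memI[OF T(1)]) (use split T(2) TF in blast)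
    have ST: "T o\<^sub>L S = S" by (rule T(3)[OF S(1)]) (use FS in blast)
    have "canonical_trace S \<le> t"
      unfolding S(4) using \<open>0 \<in> D\<close> by (intro cSup_least) (auto simp: D_def)
    then have "S \<in> D" "T \<in> D'" using SC TC T(4) by (auto simp: D_def D'_def)
    have "T \<noteq> S"
    proof
      assume "T = S"
      then have "canonical_trace S = t" using T(4) \<open>canonical_trace S \<le> t\<close> by simp
      then show False using no SC by blast
    qed
    have TS: "T - S \<in> right_projections" by (rule right_projections_diff[OF S(1) T(1) ST])
    then obtain P where P: "P \<in> right_projections" "op_le P (T - S)" "P \<noteq> 0" "P \<noteq> T - S"
    proof -
      have "T - S \<noteq> 0" using \<open>T \<noteq> S\<close> by simp
      moreover have "\<not> minimal_projection right_vN (T - S)" using diffuse by blast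
      ultimately show thesis
        using TS that unfolding minimal_projection_def right_projections_def by blast
    qed
    \<comment> \<open>\<open>S + P\<close> lies strictly between \<open>S\<close> and \<open>T\<close>, and no member of the chain does.\<close>
    have TSP: "(T - S) o\<^sub>L P = P"
      using P(1,2) TS by (simp add: op_le_projection_iff right_projectionsD(2))
    have x: "T (P x) - S (P x) = P x" for x
      using TSP by (metis blinfun_apply_blinfun_compose blinfun.diff_left)
    have TSx: "S (T y) = S y" "T (S y) = S y" "S (S y) = S y" "T (T y) = T y" for y
      using arg_cong[OF ST, of "\<lambda>A. blinfun_apply A y"]
        arg_cong[OF projection_absorb_commute[OF right_projectionsD(2)[OF S(1)]
            right_projectionsD(2)[OF T(1)] ST], of "\<lambda>A. blinfun_apply A y"]
      by (simp_all add: is_projectionD(2)[OF right_projectionsD(2)] S(1) T(1))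
    have SPx: "S (P y) = 0" for y
    proof -
      have "S (P y) = S (T (P y) - S (P y))" by (subst x) (rule refl)
      also have "\<dots> = S (T (P y)) - S (S (P y))" by (rule blinfun.diff_right)
      also have "\<dots> = 0" unfolding TSx(1)[of "P y"] TSx(3)[of "P y"] by (rule diff_self)
      finally show ?thesis .
    qed
    then have TPx: "T (P y) = P y" for y using x[of y] by (simp only: SPx diff_zero)
    have SP: "S o\<^sub>L P = 0" by (rule blinfun_eqI) (simp add: SPx)
    define Q where "Q = S + P"
    have Qp: "Q \<in> right_projections"
      using S(1) P(1) SP by (auto simp: Q_def right_projections_def is_projection_add
          vN_add[OF von_neumann_algebra_right_vN])
    have PSx: "P (S y) = 0" for y
    proof (rule cinner_right_eqI)
      show "cinner z (P (S y)) = cinner z 0" for z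
        using is_projectionD(4)[OF right_projectionsD(2)[OF P(1)], of z "S y"]
          is_projectionD(4)[OF right_projectionsD(2)[OF S(1)], of "P z" y] SPx[of z] by simp
    qed
    have QS: "Q o\<^sub>L S = S"
      by (rule blinfun_eqI) (simp add: Q_def blinfun.add_left TSx PSx)
    have TQ: "T o\<^sub>L Q = Q"
      by (rule blinfun_eqI) (simp add: Q_def blinfun.add_left blinfun.add_right TSx TPx)
    have "Q \<in> C"
    proof (rule memI[OF Qp])
      fix F assume "F \<in> C"
      then consider "F \<in> D" | "F \<in> D'" using split by blast
      then show "Q o\<^sub>L F = F \<or> F o\<^sub>L Q = Q"
      proof cases
        case 1
        then show ?thesis using projection_le_trans[OF S(2) QS] by simp
      next
        case 2
        then show ?thesis using projection_le_trans[OF TQ T(2)] by simp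
      qed
    qed
    then consider "Q \<in> D" | "Q \<in> D'" using split by blast
    then show False
    proof cases
      case 1
      have "S = Q"
        by (rule projection_antisym[OF right_projectionsD(2)[OF S(1)] right_projectionsD(2)[OF Qp]
              QS S(2)[OF 1]])
      then have "P = 0" unfolding Q_def by (metis add_cancel_right_right)
      then show False using P(3) by blast
    next
      case 2
      have "Q = T"
        by (rule projection_antisym[OF right_projectionsD(2)[OF Qp] right_projectionsD(2)[OF T(1)]
              TQ T(2)[OF 2]])
      then have "P = T - S" unfolding Q_def by (metis add_diff_cancel_left')
      then show False using P(4) by blast
    qed
  qed
  define E where "E t = (SOME E. E \<in> C \<and> canonical_trace E = t)" for t
  have E: "E t \<in> C \<and> canonical_trace (E t) = t" if "t \<in> {0..1}" for t
    unfolding E_def by (rule someI_ex) (use ex[OF that] in blast)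
  have "R \<in> C" using C by (auto simp: \<A>_def)
  show ?thesis
  proof (intro exI[of _ E] ballI conjI impI)
    fix t :: real assume t: "t \<in> {0..1}"
    show "E t \<in> right_projections" "canonical_trace (E t) = t" using E[OF t] Cp by blast+
    show "E t o\<^sub>L R = R \<or> R o\<^sub>L E t = E t" using chain E[OF t] \<open>R \<in> C\<close> by blast
    show "E t o\<^sub>L E s = E s" if "s \<in> {0..1}" "s \<le> t" for s
      by (rule mono) (use E[OF t] E[OF that(1)] that(2) in simp_all)
  qed
qed


section \<open>Direct sums along orthogonal projections\<close>

lemma norm_sum_orthogonal_sq:
  fixes v :: "'i \<Rightarrow> 'a::complex_hilbert"
  assumes "finite A" "\<And>m n. m \<in> A \<Longrightarrow> n \<in> A \<Longrightarrow> m \<noteq> n \<Longrightarrow> cinner (v m) (v n) = 0"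
  shows "(norm (sum v A))\<^sup>2 = (\<Sum>n\<in>A. (norm (v n))\<^sup>2)"
proof -
  have "cinner (sum v A) (sum v A) = (\<Sum>m\<in>A. \<Sum>n\<in>A. cinner (v m) (v n))"
    unfolding cinner_sum_left unfolding cinner_sum_right by (rule refl)
  also have "\<dots> = (\<Sum>m\<in>A. \<Sum>n\<in>A. if m = n then cinner (v m) (v m) else 0)"
    using assms(2) by (intro sum.cong refl) auto
  also have "\<dots> = (\<Sum>n\<in>A. cinner (v n) (v n))"
    using assms(1) by (simp add: sum.delta')
  finally show ?thesis by (simp add: norm_eq_cinner)
qed

lemma summable_orthogonal:
  fixes v :: "nat \<Rightarrow> 'a::complex_hilbert"
  assumes orth: "\<And>m n. m \<noteq> n \<Longrightarrow> cinner (v m) (v n) = 0"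
    and bound: "\<And>k. (\<Sum>n<k. (norm (v n))\<^sup>2) \<le> c"
  shows "summable v"
proof -
  have "summable (\<lambda>n. (norm (v n))\<^sup>2)"
    by (rule summableI_nonneg_bounded[OF _ bound]) simp
  then have S: "\<exists>N. \<forall>m\<ge>N. \<forall>n. norm (\<Sum>i=m..<n. (norm (v i))\<^sup>2) < e" if "0 < e" for e :: real
    using that unfolding summable_Cauchy by blast
  show ?thesis
    unfolding summable_Cauchy
  proof (intro allI impI)
    fix e :: real assume "0 < e"
    then obtain N where N: "\<And>m n. m \<ge> N \<Longrightarrow> norm (\<Sum>i=m..<n. (norm (v i))\<^sup>2) < e\<^sup>2"
      using S[of "e\<^sup>2"] by auto
    have "norm (sum v {m..<n}) < e" if "m \<ge> N" for m n
    proof -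
      have "(norm (sum v {m..<n}))\<^sup>2 < e\<^sup>2"
        using N[OF that, of n] norm_sum_orthogonal_sq[of "{m..<n}" v] orth by simp
      then show ?thesis using \<open>0 < e\<close> by (simp add: power2_less_imp_less)
    qed
    then show "\<exists>N. \<forall>m\<ge>N. \<forall>n. norm (sum v {m..<n}) < e" by blast
  qed
qed

lemma projections_Bessel:
  fixes G :: "nat \<Rightarrow> 'a::complex_hilbert \<Rightarrow>\<^sub>L 'a"
  assumes G: "\<And>n. is_projection (G n)" and orth: "\<And>m n x. m \<noteq> n \<Longrightarrow> G m (G n x) = 0"
  shows "(\<Sum>n<k. (norm (G n x))\<^sup>2) \<le> (norm x)\<^sup>2"
proof -
  define y where "y = (\<Sum>n<k. G n x)"
  have "cinner (G m x) (G n x) = 0" if "m \<noteq> n" for m n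
    using orth[OF that, of x] by (simp add: is_projectionD(4)[OF G])
  then have yy: "(norm y)\<^sup>2 = (\<Sum>n<k. (norm (G n x))\<^sup>2)"
    unfolding y_def by (intro norm_sum_orthogonal_sq) auto
  have "cinner y x = of_real ((norm y)\<^sup>2)"
    by (simp add: y_def cinner_sum_left norm_projection_sq[OF G] yy[unfolded y_def])
  then have "(norm y)\<^sup>2 = norm (cinner y x)" by (simp only: norm_of_real abs_power2)
  also have "\<dots> \<le> norm y * norm x" by (rule cinner_Cauchy_Schwarz)
  finally have "norm y \<le> norm x"
    by (cases "norm y = 0") (auto simp: power2_eq_square)
  then show ?thesis using yy power_mono[of "norm y" "norm x" 2] by simp
qed

text \<open>Contractions acting between the same orthogonal blocks can be summed strongly.\<close>

lemma block_diagonal_series: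
  fixes G T :: "nat \<Rightarrow> 'a::complex_hilbert \<Rightarrow>\<^sub>L 'a"
  assumes G: "\<And>n. is_projection (G n)" and orth: "\<And>m n x. m \<noteq> n \<Longrightarrow> G m (G n x) = 0"
    and T: "\<And>n. clinear_op (T n)" "\<And>n x. norm (T n x) \<le> norm x"
    and TG: "\<And>n x. T n (G n x) = T n x" and GT: "\<And>n x. G n (T n x) = T n x"
  shows "\<exists>S. clinear_op S \<and> (\<forall>x. (\<lambda>n. T n x) sums S x)"
proof -
  have le: "norm (T n x) \<le> norm (G n x)" for n x using T(2)[of n "G n x"] by (simp add: TG)
  have ort: "cinner (T m x) (T n x) = 0" if "m \<noteq> n" for m n x
  proof -
    have "cinner (T m x) (T n x) = cinner (G m (T m x)) (G n (T n x))" by (simp only: GT)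
    also have "\<dots> = cinner (G n (G m (T m x))) (T n x)" by (simp add: is_projectionD(4)[OF G])
    finally show ?thesis using that orth[of n m] by simp
  qed
  have bd: "(\<Sum>n<k. (norm (T n x))\<^sup>2) \<le> (norm x)\<^sup>2" for k x
  proof -
    have "(\<Sum>n<k. (norm (T n x))\<^sup>2) \<le> (\<Sum>n<k. (norm (G n x))\<^sup>2)"
      by (rule sum_mono) (simp add: le power_mono)
    also have "\<dots> \<le> (norm x)\<^sup>2" by (rule projections_Bessel[OF G orth])
    finally show ?thesis .
  qed
  have ap: "(\<Sum>n<k. T n) x = (\<Sum>n<k. T n x)" for k x by (simp add: blinfun.sum_left)
  have cl: "clinear_op (\<Sum>n<k. T n)" for k
    by (induction k) (auto simp: clinear_op_add T(1))
  have nm: "norm ((\<Sum>n<k. T n) x) \<le> 1 * norm x" for k x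
  proof -
    have "(norm ((\<Sum>n<k. T n) x))\<^sup>2 \<le> (norm x)\<^sup>2"
      unfolding ap by (subst norm_sum_orthogonal_sq) (auto intro: ort bd)
    then have "norm ((\<Sum>n<k. T n) x) \<le> norm x" by (rule power2_le_imp_le) simp
    then show ?thesis by simp
  qed
  have "convergent (\<lambda>k. (\<Sum>n<k. T n) x)" for x
    unfolding ap using summable_orthogonal[of "\<lambda>n. T n x", OF ort bd]
    by (simp add: summable_iff_convergent)
  from clinear_op_pointwise_limit[of "\<lambda>k. \<Sum>n<k. T n", OF cl nm this]
  show ?thesis unfolding ap sums_def by blast
qed

lemma contraction_of_initial_projection:
  fixes T :: "'a::complex_hilbert \<Rightarrow>\<^sub>L 'a"
  assumes "clinear_op T" "is_projection (adj T o\<^sub>L T)"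
  shows "norm (T x) \<le> norm x"
proof -
  have "complex_of_real ((norm (T x))\<^sup>2) = cinner ((adj T o\<^sub>L T) x) x"
    by (simp only: cinner_self cinner_adj_left[OF assms(1)] blinfun_apply_blinfun_compose)
  also have "\<dots> = complex_of_real ((norm ((adj T o\<^sub>L T) x))\<^sup>2)"
    by (rule norm_projection_sq[OF assms(2)])
  finally have "(norm (T x))\<^sup>2 = (norm ((adj T o\<^sub>L T) x))\<^sup>2" using of_real_eq_iff by blast
  also have "\<dots> \<le> (norm x)\<^sup>2" by (intro power_mono norm_projection_le assms) simp
  finally show ?thesis by (rule power2_le_imp_le) simp
qed

lemma op_tensor_compose_apply:
  assumes "clinear_op A" "clinear_op B" "clinear_op A'" "clinear_op B'"
  shows "(A \<otimes>\<^sub>o B) ((A' \<otimes>\<^sub>o B') x) = ((A o\<^sub>L A') \<otimes>\<^sub>o (B o\<^sub>L B')) x"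
  using op_tensor_compose[OF assms] by (metis blinfun_apply_blinfun_compose)

lemma op_tensor_add_right:
  assumes "clinear_op A" "clinear_op B" "clinear_op B'"
  shows "A \<otimes>\<^sub>o (B + B') = (A \<otimes>\<^sub>o B) + (A \<otimes>\<^sub>o B')"
proof (rule op_tensor_eqI)
  have "f \<otimes>\<^sub>v (h + h') = f \<otimes>\<^sub>v h + f \<otimes>\<^sub>v h'" for f :: "('a, complex) l2" and h h' :: 'b
    by (rule l2_eqI) (simp add: tensor.rep_eq plus_l2.rep_eq scaleC_add_right)
  then show "((A \<otimes>\<^sub>o B) + (A \<otimes>\<^sub>o B')) (f \<otimes>\<^sub>v h) = A f \<otimes>\<^sub>v (B + B') h" for f h
    by (simp add: blinfun.add_left op_tensor_apply assms)
qed

text \<open>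
  $S = \sum_n F_n \otimes B_n$ in the strong operator topology, for sequences indexed by all
  natural numbers.
\<close>

definition is_block_sum :: "(nat \<Rightarrow> ('g, complex) l2 \<Rightarrow>\<^sub>L ('g, complex) l2) \<Rightarrow>
    (nat \<Rightarrow> 'h::complex_hilbert \<Rightarrow>\<^sub>L 'h) \<Rightarrow> (('g, 'h) l2 \<Rightarrow>\<^sub>L ('g, 'h) l2) \<Rightarrow> bool" where
  "is_block_sum F B S \<longleftrightarrow> clinear_op S \<and> (\<forall>x. (\<lambda>n. (F n \<otimes>\<^sub>o B n) x) sums S x)"

lemma is_block_sum_commute:
  assumes S: "is_block_sum F B S" and F: "\<And>n. clinear_op (F n)" and B: "\<And>n. clinear_op (B n)"
    and A: "clinear_op A" "\<And>n f. A (F n f) = F n (A f)"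
  shows "(A \<otimes>\<^sub>o id_blinfun) (S x) = S ((A \<otimes>\<^sub>o id_blinfun) x)"
proof -
  have AF: "A o\<^sub>L F n = F n o\<^sub>L A" for n by (rule blinfun_eqI) (simp add: A(2))
  have 1: "id_blinfun o\<^sub>L B n = B n" "B n o\<^sub>L id_blinfun = B n" for n by (auto intro: blinfun_eqI)
  have "(A \<otimes>\<^sub>o id_blinfun) ((F n \<otimes>\<^sub>o B n) x) = (F n \<otimes>\<^sub>o B n) ((A \<otimes>\<^sub>o id_blinfun) x)" for n
    by (simp add: op_tensor_compose_apply F B A(1) AF 1)
  moreover have "(\<lambda>n. (A \<otimes>\<^sub>o id_blinfun) ((F n \<otimes>\<^sub>o B n) x)) sums (A \<otimes>\<^sub>o id_blinfun) (S x)"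
    using S by (intro bounded_linear.sums[OF blinfun.bounded_linear_right]) (simp add: is_block_sum_def)
  moreover have "(\<lambda>n. (F n \<otimes>\<^sub>o B n) ((A \<otimes>\<^sub>o id_blinfun) x)) sums S ((A \<otimes>\<^sub>o id_blinfun) x)"
    using S by (simp add: is_block_sum_def)
  ultimately show ?thesis using sums_unique2 by simp
qed

lemma is_block_sum_mem:
  assumes S: "is_block_sum F B S" and M: "von_neumann_algebra M"
    and mem: "\<And>n. F n \<otimes>\<^sub>o B n \<in> M"
  shows "S \<in> M"
proof (rule vN_sot_limit[OF M, where A = "\<lambda>k. \<Sum>n<k. F n \<otimes>\<^sub>o B n"])
  show "(\<Sum>n<k. F n \<otimes>\<^sub>o B n) \<in> M" for k by (rule vN_sum[OF M mem])
  show "clinear_op S" using S by (simp add: is_block_sum_def)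
  show "(\<lambda>k. (\<Sum>n<k. F n \<otimes>\<^sub>o B n) x) \<longlonglongrightarrow> S x" for x
    using S by (simp add: is_block_sum_def sums_def blinfun.sum_left)
qed

text \<open>
  A decomposition of the identity into mutually orthogonal projections, some of which may vanish.
\<close>

definition orthogonal_decomposition :: "(nat \<Rightarrow> 'a::complex_hilbert \<Rightarrow>\<^sub>L 'a) \<Rightarrow> bool" where
  "orthogonal_decomposition F \<longleftrightarrow> (\<forall>n. is_projection (F n)) \<and>
    (\<forall>m n. m \<noteq> n \<longrightarrow> F m o\<^sub>L F n = 0) \<and> (\<forall>x. (\<lambda>n. F n x) sums x)"

context
  fixes F :: "nat \<Rightarrow> ('g, complex) l2 \<Rightarrow>\<^sub>L ('g, complex) l2"
  assumes decomp: "orthogonal_decomposition F"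
begin

lemma decomp_projection: "is_projection (F n)"
  using decomp by (simp add: orthogonal_decomposition_def)

lemma clinear_op_decomp: "clinear_op (F n)"
  by (rule is_projectionD(1)[OF decomp_projection])

lemma decomp_product: "F m o\<^sub>L F n = (if m = n then F n else 0)"
  using decomp decomp_projection[of n] by (simp add: orthogonal_decomposition_def is_projection_def)

lemma decomp_sums: "(\<lambda>n. F n f) sums f"
  using decomp by (simp add: orthogonal_decomposition_def)

lemma F_tensor_id_apply:
  fixes B :: "'h::complex_hilbert \<Rightarrow>\<^sub>L 'h"
  assumes "clinear_op B"
  shows "(F m \<otimes>\<^sub>o id_blinfun) ((F n \<otimes>\<^sub>o B) x) = (if m = n then (F n \<otimes>\<^sub>o B) x else 0)"
    and "(F m \<otimes>\<^sub>o B) ((F n \<otimes>\<^sub>o id_blinfun) x) = (if m = n then (F n \<otimes>\<^sub>o B) x else 0)"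
proof -
  have "id_blinfun o\<^sub>L B = B" "B o\<^sub>L id_blinfun = B" by (auto intro: blinfun_eqI)
  then show "(F m \<otimes>\<^sub>o id_blinfun) ((F n \<otimes>\<^sub>o B) x) = (if m = n then (F n \<otimes>\<^sub>o B) x else 0)"
    and "(F m \<otimes>\<^sub>o B) ((F n \<otimes>\<^sub>o id_blinfun) x) = (if m = n then (F n \<otimes>\<^sub>o B) x else 0)"
    by (simp_all add: op_tensor_compose_apply assms clinear_op_decomp decomp_product)
qed

lemma ex_block_sum:
  fixes B :: "nat \<Rightarrow> 'h::complex_hilbert \<Rightarrow>\<^sub>L 'h"
  assumes B: "\<And>n. clinear_op (B n)" "\<And>n. is_projection (adj (B n) o\<^sub>L B n)"
  shows "\<exists>S. is_block_sum F B S"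
  unfolding is_block_sum_def
proof (rule block_diagonal_series[where G = "\<lambda>n. F n \<otimes>\<^sub>o id_blinfun"])
  show "is_projection (F n \<otimes>\<^sub>o (id_blinfun :: 'h \<Rightarrow>\<^sub>L 'h))" for n
    by (rule is_projection_op_tensor[OF decomp_projection is_projection_id])
  show "clinear_op (F n \<otimes>\<^sub>o B n)" for n by (rule clinear_op_tensor[OF clinear_op_decomp B(1)])
  have "adj (F n \<otimes>\<^sub>o B n) o\<^sub>L (F n \<otimes>\<^sub>o B n) = F n \<otimes>\<^sub>o (adj (B n) o\<^sub>L B n)" for n
    by (simp add: adj_op_tensor clinear_op_decomp B(1) op_tensor_compose clinear_op_adj decomp_product
        is_projectionD(3)[OF decomp_projection])
  then show "norm ((F n \<otimes>\<^sub>o B n) x) \<le> norm x" for n x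
    by (intro contraction_of_initial_projection clinear_op_tensor clinear_op_decomp B(1))
      (simp add: is_projection_op_tensor decomp_projection B(2))
qed (simp_all add: F_tensor_id_apply B(1))

lemma sums_F_tensor_id: "(\<lambda>n. (F n \<otimes>\<^sub>o id_blinfun) x) sums (x :: ('g, 'h::complex_hilbert) l2)"
proof -
  have "is_projection (adj id_blinfun o\<^sub>L (id_blinfun :: 'h \<Rightarrow>\<^sub>L 'h))"
  proof -
    have "id_blinfun o\<^sub>L id_blinfun = (id_blinfun :: 'h \<Rightarrow>\<^sub>L 'h)" by (auto intro: blinfun_eqI)
    then show ?thesis by simp
  qed
  then obtain S :: "('g, 'h) l2 \<Rightarrow>\<^sub>L ('g, 'h) l2" where S: "is_block_sum F (\<lambda>_. id_blinfun) S"
    using ex_block_sum[of "\<lambda>_. id_blinfun"] by auto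
  have "S = id_blinfun"
  proof (rule tensor_ext)
    fix f :: "('g, complex) l2" and h :: 'h
    have "bounded_linear (\<lambda>f :: ('g, complex) l2. f \<otimes>\<^sub>v h)"
    proof (rule bounded_linear_intro[where K = "norm h"])
      fix f f' :: "('g, complex) l2" and r :: real
      show "(f + f') \<otimes>\<^sub>v h = f \<otimes>\<^sub>v h + f' \<otimes>\<^sub>v h"
        by (rule l2_eqI) (simp add: tensor.rep_eq plus_l2.rep_eq scaleC_add_left)
      show "(r *\<^sub>R f) \<otimes>\<^sub>v h = r *\<^sub>R (f \<otimes>\<^sub>v h)"
        by (rule l2_eqI) (simp add: tensor.rep_eq scaleR_l2.rep_eq scaleR_conv_of_real
            scaleR_scaleC[of r "_ :: 'h"] scaleC_scaleC)
    qed (simp add: norm_tensor)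
    from bounded_linear.sums[OF this decomp_sums[of f]]
    have "(\<lambda>n. (F n \<otimes>\<^sub>o id_blinfun) (f \<otimes>\<^sub>v h)) sums (f \<otimes>\<^sub>v h)"
      by (simp add: op_tensor_apply clinear_op_decomp)
    moreover have "(\<lambda>n. (F n \<otimes>\<^sub>o id_blinfun) (f \<otimes>\<^sub>v h)) sums S (f \<otimes>\<^sub>v h)"
      using S by (simp add: is_block_sum_def)
    ultimately show "S (f \<otimes>\<^sub>v h) = id_blinfun (f \<otimes>\<^sub>v h)" using sums_unique2 by simp
  qed
  then show ?thesis using S by (simp add: is_block_sum_def)
qed

text \<open>
  An operator is determined by its restrictions to the ranges of \<open>F n \<otimes>\<^sub>o id_blinfun\<close>; algebraic
  identities between block sums can therefore be checked for each \<open>n\<close> separately.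
\<close>

lemma eq_on_blocks:
  fixes A B :: "('g, 'h::complex_hilbert) l2 \<Rightarrow>\<^sub>L ('g, 'h) l2"
  assumes "\<And>n x. A ((F n \<otimes>\<^sub>o id_blinfun) x) = B ((F n \<otimes>\<^sub>o id_blinfun) x)"
  shows "A = B"
proof (rule blinfun_eqI)
  fix x
  have "(\<lambda>n. C ((F n \<otimes>\<^sub>o id_blinfun) x)) sums C x" for C :: "('g, 'h) l2 \<Rightarrow>\<^sub>L ('g, 'h) l2"
    by (rule bounded_linear.sums[OF blinfun.bounded_linear_right sums_F_tensor_id])
  from this[of A] this[of B] show "A x = B x" using sums_unique2 by (simp add: assms)
qed

context
  fixes B :: "nat \<Rightarrow> 'h::complex_hilbert \<Rightarrow>\<^sub>L 'h" and S
  assumes B: "\<And>n. clinear_op (B n)" and S: "is_block_sum F B S"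
begin

lemma clinear_op_block_sum: "clinear_op S"
  using S by (simp add: is_block_sum_def)

lemma block_sum_restrict: "S ((F n \<otimes>\<^sub>o id_blinfun) x) = (F n \<otimes>\<^sub>o B n) x"
proof -
  have "(\<lambda>m. (F m \<otimes>\<^sub>o B m) ((F n \<otimes>\<^sub>o id_blinfun) x)) sums S ((F n \<otimes>\<^sub>o id_blinfun) x)"
    using S by (simp add: is_block_sum_def)
  moreover have "(F m \<otimes>\<^sub>o B m) ((F n \<otimes>\<^sub>o id_blinfun) x) = (if m = n then (F m \<otimes>\<^sub>o B m) x else 0)" for m
    by (simp add: F_tensor_id_apply B)
  ultimately show ?thesis
    using sums_single[of n "\<lambda>m. (F m \<otimes>\<^sub>o B m) x"] sums_unique2 by simp
qed

lemma block_sum_range: "(F n \<otimes>\<^sub>o id_blinfun) (S x) = (F n \<otimes>\<^sub>o B n) x"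
proof -
  have "(\<lambda>m. (F n \<otimes>\<^sub>o id_blinfun) ((F m \<otimes>\<^sub>o B m) x)) sums (F n \<otimes>\<^sub>o id_blinfun) (S x)"
    using S by (intro bounded_linear.sums[OF blinfun.bounded_linear_right]) (simp add: is_block_sum_def)
  moreover have "(F n \<otimes>\<^sub>o id_blinfun) ((F m \<otimes>\<^sub>o B m) x) = (if m = n then (F m \<otimes>\<^sub>o B m) x else 0)" for m
    by (simp add: F_tensor_id_apply B)
  ultimately show ?thesis
    using sums_single[of n "\<lambda>m. (F m \<otimes>\<^sub>o B m) x"] sums_unique2 by simp
qed

lemma block_sum_adj_restrict: "adj S ((F n \<otimes>\<^sub>o id_blinfun) x) = (F n \<otimes>\<^sub>o adj (B n)) x"
proof (rule cinner_right_eqI)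
  fix z
  have "cinner z (adj S ((F n \<otimes>\<^sub>o id_blinfun) x)) = cinner (S z) ((F n \<otimes>\<^sub>o id_blinfun) x)"
    by (simp add: cinner_adj_right[OF clinear_op_block_sum])
  also have "\<dots> = cinner ((F n \<otimes>\<^sub>o id_blinfun) (S z)) x"
    by (simp add: is_projectionD(4)[OF is_projection_op_tensor[OF decomp_projection is_projection_id]])
  also have "\<dots> = cinner z (adj (F n \<otimes>\<^sub>o B n) x)"
    by (simp add: block_sum_range cinner_adj_right[OF clinear_op_tensor[OF clinear_op_decomp B]])
  finally show "cinner z (adj S ((F n \<otimes>\<^sub>o id_blinfun) x)) = cinner z ((F n \<otimes>\<^sub>o adj (B n)) x)"
    by (simp add: adj_op_tensor[OF clinear_op_decomp B] is_projectionD(3)[OF decomp_projection])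
qed

end

lemma block_sum_compose:
  fixes B C :: "nat \<Rightarrow> 'h::complex_hilbert \<Rightarrow>\<^sub>L 'h"
  assumes B: "\<And>n. clinear_op (B n)" and S: "is_block_sum F B S"
    and C: "\<And>n. clinear_op (C n)" and T: "is_block_sum F C T"
  shows "S (T ((F n \<otimes>\<^sub>o id_blinfun) x)) = (F n \<otimes>\<^sub>o (B n o\<^sub>L C n)) x"
    and "adj S (T ((F n \<otimes>\<^sub>o id_blinfun) x)) = (F n \<otimes>\<^sub>o (adj (B n) o\<^sub>L C n)) x"
    and "S (adj T ((F n \<otimes>\<^sub>o id_blinfun) x)) = (F n \<otimes>\<^sub>o (B n o\<^sub>L adj (C n))) x"
proof -
  have id: "id_blinfun o\<^sub>L D = D" for D :: "'h \<Rightarrow>\<^sub>L 'h" by (auto intro: blinfun_eqI)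
  have eq: "(F n \<otimes>\<^sub>o D) x = (F n \<otimes>\<^sub>o id_blinfun) ((F n \<otimes>\<^sub>o D) x)"
    if "clinear_op D" for D :: "'h \<Rightarrow>\<^sub>L 'h"
    by (simp add: F_tensor_id_apply that)
  show "S (T ((F n \<otimes>\<^sub>o id_blinfun) x)) = (F n \<otimes>\<^sub>o (B n o\<^sub>L C n)) x"
    unfolding block_sum_restrict[OF C T]
    by (subst eq[OF C], subst block_sum_restrict[OF B S])
      (simp add: op_tensor_compose_apply clinear_op_decomp B C decomp_product id)
  show "adj S (T ((F n \<otimes>\<^sub>o id_blinfun) x)) = (F n \<otimes>\<^sub>o (adj (B n) o\<^sub>L C n)) x"
    unfolding block_sum_restrict[OF C T]
    by (subst eq[OF C], subst block_sum_adj_restrict[OF B S])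
      (simp add: op_tensor_compose_apply clinear_op_decomp
        clinear_op_adj B C decomp_product id)
  show "S (adj T ((F n \<otimes>\<^sub>o id_blinfun) x)) = (F n \<otimes>\<^sub>o (B n o\<^sub>L adj (C n))) x"
    unfolding block_sum_adj_restrict[OF C T]
    by (subst eq[OF clinear_op_adj[OF C]], subst block_sum_restrict[OF B S])
      (simp add: op_tensor_compose_apply clinear_op_decomp
        clinear_op_adj B C decomp_product id)
qed

end

lemma has_sot_sum_sums:
  "has_sot_sum N A S \<longleftrightarrow> (\<forall>x. (\<lambda>n. if 1 \<le> n \<and> enat n \<le> N then A n x else 0) sums S x)"
proof -
  have "(\<Sum>n | 1 \<le> n \<and> n \<le> k \<and> enat n \<le> N. A n x)
      = (\<Sum>n\<le>k. if 1 \<le> n \<and> enat n \<le> N then A n x else 0)" for k x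
    by (rule sum.mono_neutral_cong_left) auto
  then show ?thesis by (simp add: has_sot_sum_iff sums_def_le)
qed


section \<open>The path of partial isometries\<close>

text \<open>
  The algebra behind \<open>W(t)\<^sup>*W(t) = E\<close>: the cross terms of the sum vanish either by orthogonality
  of the \<open>s\<close> or by orthogonality of the \<open>a\<close>.
\<close>

lemma initial_projection_of_sum:
  fixes a0 a1 a2 s0 s1 s2 q :: "'a::complex_hilbert \<Rightarrow>\<^sub>L 'a"
  assumes lin: "clinear_op a0" "clinear_op a1" "clinear_op a2"
    "clinear_op s0" "clinear_op s1" "clinear_op s2"
    and comm: "\<And>x. a0 (s0 x) = s0 (a0 x)" "\<And>x. a1 (s1 x) = s1 (a1 x)" "\<And>x. a2 (s2 x) = s2 (a2 x)"
    and comm': "\<And>i j x. i \<in> {a0, a1, a2} \<Longrightarrow> j \<in> {s0, s1, s2} \<Longrightarrow> adj i (j x) = j (adj i x)"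
    and unit: "\<And>x. adj a0 (a0 x) + adj a1 (a1 x) + adj a2 (a2 x) = x"
    and orth: "\<And>x. adj a0 (a1 x) = 0" "\<And>x. adj a1 (a0 x) = 0" "\<And>x. adj a0 (a2 x) = 0"
      "\<And>x. adj a2 (a0 x) = 0"
    and s: "\<And>x. adj s0 (s0 x) = q x" "\<And>x. adj s1 (s1 x) = q x" "\<And>x. adj s2 (s2 x) = q x"
      "\<And>x. adj s1 (s2 x) = 0" "\<And>x. adj s2 (s1 x) = 0"
  defines "W \<equiv> (a0 o\<^sub>L s0) + (a1 o\<^sub>L s1) + (a2 o\<^sub>L s2)"
  shows "adj W o\<^sub>L W = q"
proof (rule blinfun_eqI)
  fix x
  have adjW: "adj W = (adj s0 o\<^sub>L adj a0) + (adj s1 o\<^sub>L adj a1) + (adj s2 o\<^sub>L adj a2)"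
    unfolding W_def by (simp add: adj_add adj_compose clinear_op_add clinear_op_compose lin)
  have Wx: "W x = s0 (a0 x) + s1 (a1 x) + s2 (a2 x)"
    by (simp add: W_def blinfun.add_left comm)
  have c: "adj a0 (s0 y) = s0 (adj a0 y)" "adj a0 (s1 y) = s1 (adj a0 y)" "adj a0 (s2 y) = s2 (adj a0 y)"
    "adj a1 (s0 y) = s0 (adj a1 y)" "adj a1 (s1 y) = s1 (adj a1 y)" "adj a1 (s2 y) = s2 (adj a1 y)"
    "adj a2 (s0 y) = s0 (adj a2 y)" "adj a2 (s1 y) = s1 (adj a2 y)" "adj a2 (s2 y) = s2 (adj a2 y)"
    for y by (rule comm'; simp)+
  have "(adj W o\<^sub>L W) x = q (adj a0 (a0 x)) + q (adj a1 (a1 x)) + q (adj a2 (a2 x))"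
    unfolding adjW blinfun_apply_blinfun_compose Wx
    by (simp add: blinfun.add_left blinfun.add_right c orth s)
  also have "\<dots> = q (adj a0 (a0 x) + adj a1 (a1 x) + adj a2 (a2 x))"
    by (simp only: blinfun.add_right)
  finally show "(adj W o\<^sub>L W) x = q x" by (simp only: unit)
qed

lemma continuous_on_compression:
  fixes A :: "real \<Rightarrow> ('g::group_add, complex) l2 \<Rightarrow>\<^sub>L ('g, complex) l2"
    and S :: "('g, 'h::complex_hilbert) l2 \<Rightarrow>\<^sub>L ('g, 'h) l2"
  assumes mem: "\<And>t. t \<in> I \<Longrightarrow> A t \<in> right_vN" and cont: "continuous_on I (\<lambda>t. A t (chi 0))"
  shows "continuous_on I (\<lambda>t. adj (L_op 0) o\<^sub>L ((A t \<otimes>\<^sub>o id_blinfun) o\<^sub>L S))"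
proof -
  have lin: "clinear_op (A t)" if "t \<in> I" for t
    by (rule vN_clinear_op[OF von_neumann_algebra_right_vN mem[OF that]])
  define f where "f t = adj (L_op 0) o\<^sub>L (A t \<otimes>\<^sub>o (id_blinfun :: 'h \<Rightarrow>\<^sub>L 'h))" for t
  have le: "dist (f s) (f t) \<le> dist (A s (chi 0)) (A t (chi 0))" if "s \<in> I" "t \<in> I" for s t
  proof -
    have "f s - f t = adj (L_op 0) o\<^sub>L ((A s - A t) \<otimes>\<^sub>o id_blinfun)"
      unfolding f_def
      by (rule blinfun_eqI)
        (simp add: op_tensor_diff_left lin that blinfun.diff_left blinfun.diff_right)
    also have "norm \<dots> \<le> norm ((A s - A t) (chi 0))"
      by (rule norm_L_op_op_tensor_le) (intro vN_diff[OF von_neumann_algebra_right_vN] mem that)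
    finally show ?thesis by (simp add: dist_norm blinfun.diff_left)
  qed
  have "continuous_on I f"
    unfolding continuous_on_iff
  proof (intro ballI allI impI)
    fix t e assume "t \<in> I" "(0::real) < e"
    then obtain d where d: "d > 0" "\<And>s. s \<in> I \<Longrightarrow> dist s t < d \<Longrightarrow> dist (A s (chi 0)) (A t (chi 0)) < e"
      using cont unfolding continuous_on_iff by metis
    have "dist (f s) (f t) < e" if "s \<in> I" "dist s t < d" for s
      using le[OF that(1) \<open>t \<in> I\<close>] d(2)[OF that] by (rule order_le_less_trans)
    then show "\<exists>d>0. \<forall>s\<in>I. dist s t < d \<longrightarrow> dist (f s) (f t) < e" using d(1) by blast
  qed
  then have "continuous_on I (\<lambda>t. f t o\<^sub>L S)"
    by (rule bounded_linear.continuous_on[OF bounded_bilinear.bounded_linear_left[OF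
          bounded_bilinear_blinfun_compose]])
  moreover have "f t o\<^sub>L S = adj (L_op 0) o\<^sub>L ((A t \<otimes>\<^sub>o id_blinfun) o\<^sub>L S)" for t
    unfolding f_def by (rule blinfun_eqI) simp
  ultimately show ?thesis by simp
qed

lemma op_tensor_id_apply:
  assumes "clinear_op A" "clinear_op A'"
  shows "(A \<otimes>\<^sub>o id_blinfun) ((A' \<otimes>\<^sub>o (id_blinfun :: 'h::complex_hilbert \<Rightarrow>\<^sub>L 'h)) x) =
    ((A o\<^sub>L A') \<otimes>\<^sub>o id_blinfun) x"
proof -
  have "id_blinfun o\<^sub>L id_blinfun = (id_blinfun :: 'h \<Rightarrow>\<^sub>L 'h)" by (auto intro: blinfun_eqI)
  then show ?thesis by (simp add: op_tensor_compose_apply assms)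
qed

lemma block_sum_commute_right_vN:
  fixes B :: "nat \<Rightarrow> 'h::complex_hilbert \<Rightarrow>\<^sub>L 'h"
  assumes S: "is_block_sum F B S" and F: "\<And>n. clinear_op (F n)" and B: "\<And>n. clinear_op (B n)"
    and central: "\<And>n. F n \<in> left_vN"
    and A: "A \<in> right_vN"
  shows "(A \<otimes>\<^sub>o id_blinfun) (S x) = S ((A \<otimes>\<^sub>o id_blinfun) x)"
    and "(A \<otimes>\<^sub>o id_blinfun) (adj S x) = adj S ((A \<otimes>\<^sub>o id_blinfun) x)"
proof -
  have lin: "clinear_op A" if "A \<in> right_vN" for A :: "('a, complex) l2 \<Rightarrow>\<^sub>L ('a, complex) l2"
    by (rule vN_clinear_op[OF von_neumann_algebra_right_vN that])
  have comm: "(A \<otimes>\<^sub>o id_blinfun) (S x) = S ((A \<otimes>\<^sub>o id_blinfun) x)" if "A \<in> right_vN" for A x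
    by (rule is_block_sum_commute[OF S F B lin[OF that] right_vN_commutes_left_vN[OF that central]])
  then show "(A \<otimes>\<^sub>o id_blinfun) (S x) = S ((A \<otimes>\<^sub>o id_blinfun) x)" using A .
  have cS: "clinear_op S" using S by (simp add: is_block_sum_def)
  have A': "adj A \<in> right_vN" by (rule vN_adj[OF von_neumann_algebra_right_vN A])
  have adjA: "cinner ((adj A \<otimes>\<^sub>o (id_blinfun :: 'h \<Rightarrow>\<^sub>L 'h)) y) z = cinner y ((A \<otimes>\<^sub>o id_blinfun) z)" for y z
    using cinner_adj_left[OF clinear_op_tensor[OF lin[OF A] clinear_op_id], of y z]
    by (simp add: adj_op_tensor[OF lin[OF A] clinear_op_id])
  show "(A \<otimes>\<^sub>o id_blinfun) (adj S x) = adj S ((A \<otimes>\<^sub>o id_blinfun) x)"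
  proof (rule cinner_right_eqI)
    fix z
    have "cinner z ((A \<otimes>\<^sub>o id_blinfun) (adj S x)) = cinner (S ((adj A \<otimes>\<^sub>o id_blinfun) z)) x"
      by (simp only: cinner_adj_right[OF cS] adjA)
    also have "\<dots> = cinner ((adj A \<otimes>\<^sub>o id_blinfun) (S z)) x" by (simp only: comm[OF A'])
    also have "\<dots> = cinner z (adj S ((A \<otimes>\<^sub>o id_blinfun) x))"
      by (simp only: cinner_adj_right[OF cS] adjA)
    finally show "cinner z ((A \<otimes>\<^sub>o id_blinfun) (adj S x)) =
        cinner z (adj S ((A \<otimes>\<^sub>o id_blinfun) x))" .
  qed
qed

theorem lemma8p4:
  fixes R :: "('g::group_add, complex) l2 \<Rightarrow>\<^sub>L ('g, complex) l2"
    and N :: enat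
    and F :: "nat \<Rightarrow> ('g, complex) l2 \<Rightarrow>\<^sub>L ('g, complex) l2"
    and Q :: "nat \<Rightarrow> 'h::complex_hilbert \<Rightarrow>\<^sub>L 'h"
  assumes "\<nexists>B :: 'h set. finite B \<and> complex_vector.span B = UNIV"
    and "\<nexists>P. minimal_projection (right_vN :: (('g, complex) l2 \<Rightarrow>\<^sub>L ('g, complex) l2) set) P"
    and "R \<in> right_vN" and "is_projection R"
    and "mvn_equiv right_vN R (id_blinfun - R)"
    and "\<And>n. 1 \<le> n \<Longrightarrow> enat n \<le> N \<Longrightarrow> infinite_projection bounded_ops (Q n)"
    and "\<And>n. 1 \<le> n \<Longrightarrow> enat n \<le> N \<Longrightarrow> is_projection (F n) \<and> F n \<in> right_vN \<inter> left_vN"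
    and "\<And>m n. 1 \<le> m \<Longrightarrow> enat m \<le> N \<Longrightarrow> 1 \<le> n \<Longrightarrow> enat n \<le> N \<Longrightarrow> m \<noteq> n \<Longrightarrow> F m o\<^sub>L F n = 0"
    and "has_sot_sum N F id_blinfun"
  shows "\<exists>(E :: ('g, 'h) l2 \<Rightarrow>\<^sub>L ('g, 'h) l2) E\<^sub>R W.
      has_sot_sum N (\<lambda>n. F n \<otimes>\<^sub>o Q n) E \<and>
      has_sot_sum N (\<lambda>n. (R o\<^sub>L F n) \<otimes>\<^sub>o Q n) E\<^sub>R \<and>
      (\<forall>t\<in>{0..1::real}. W t \<in> vN_tensor right_vN bounded_ops \<and> partial_isometry (W t)) \<and>
      continuous_on {0..1} (\<lambda>t. adj (L_op 0) o\<^sub>L W t) \<and>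
      (\<forall>t\<in>{0..1}. adj (W t) o\<^sub>L W t = E) \<and>
      (\<forall>t\<in>{0..1}. op_le (W t o\<^sub>L adj (W t)) E) \<and>
      W 0 = E \<and>
      W 1 o\<^sub>L adj (W 1) = E\<^sub>R"
proof -
  note vN = von_neumann_algebra_right_vN
  \<comment> \<open>Indices outside \<open>{1..N}\<close> are given the summand \<open>0\<close>, so that all sums run over \<open>nat\<close>.\<close>
  define ix where "ix n \<longleftrightarrow> 1 \<le> n \<and> enat n \<le> N" for n
  define F' where "F' n = (if ix n then F n else 0)" for n
  define Q' where "Q' n = (if ix n then Q n else 0)" for n
  have F': "is_projection (F' n)" for n
    using assms(7) by (simp add: F'_def ix_def)
  have F'R: "F' n \<in> right_vN" for n
    using assms(7) by (simp add: F'_def ix_def vN_zero[OF vN])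
  have F'orth: "F' m o\<^sub>L F' n = 0" if "m \<noteq> n" for m n
  proof (cases "ix m \<and> ix n")
    case True
    then show ?thesis using assms(8)[of m n] that by (simp add: F'_def ix_def)
  next
    case False
    then show ?thesis by (intro blinfun_eqI) (auto simp: F'_def)
  qed
  have F'sum: "(\<lambda>n. F' n f) sums f" for f
  proof -
    have "(\<lambda>n. if 1 \<le> n \<and> enat n \<le> N then F n f else 0) sums f"
      using assms(9) by (simp add: has_sot_sum_sums)
    moreover have "(if 1 \<le> n \<and> enat n \<le> N then F n f else 0) = F' n f" for n
      by (simp add: F'_def ix_def)
    ultimately show ?thesis by simp
  qed
  have F'lin: "clinear_op (F' n)" for n by (rule is_projectionD(1)[OF F'])
  have F'central: "F' n \<in> left_vN" for n
    using assms(7)[of n] by (simp add: F'_def ix_def vN_zero[OF von_neumann_algebra_left_vN])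
  have Q': "is_projection (Q' n)" for n
    using assms(6) by (simp add: Q'_def ix_def infinite_projection_def)
  have "\<exists>S T. clinear_op S \<and> clinear_op T \<and> adj S o\<^sub>L S = Q' n \<and> adj T o\<^sub>L T = Q' n \<and>
      adj S o\<^sub>L T = 0 \<and> (S o\<^sub>L adj S) + (T o\<^sub>L adj T) = Q' n" for n
  proof (cases "ix n")
    case True
    then show ?thesis
      using infinite_projection_halving[OF assms(6)[of n]] by (simp add: Q'_def ix_def)
  next
    case False
    have "0 o\<^sub>L 0 = (0 :: 'h \<Rightarrow>\<^sub>L 'h)" by (auto intro: blinfun_eqI)
    with False show ?thesis by (intro exI[of _ 0]) (simp add: Q'_def)
  qed
  then obtain B1 B2 where B1: "\<And>n. clinear_op (B1 n)" "\<And>n. adj (B1 n) o\<^sub>L B1 n = Q' n"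
    and B2: "\<And>n. clinear_op (B2 n)" "\<And>n. adj (B2 n) o\<^sub>L B2 n = Q' n"
    and B12: "\<And>n. adj (B1 n) o\<^sub>L B2 n = 0" "\<And>n. (B1 n o\<^sub>L adj (B1 n)) + (B2 n o\<^sub>L adj (B2 n)) = Q' n"
    by metis
  have Q'lin: "clinear_op (Q' n)" and Q'Q': "adj (Q' n) o\<^sub>L Q' n = Q' n" and QQ: "Q' n o\<^sub>L Q' n = Q' n" for n
    using Q' by (auto simp: is_projection_def bounded_ops_iff)
  have blocks: "orthogonal_decomposition F'"
    using F' F'orth F'sum by (simp add: orthogonal_decomposition_def)
  obtain q where q: "is_block_sum F' Q' q"
    using ex_block_sum[OF blocks, of Q', OF Q'lin] Q' Q'Q' by auto
  obtain s1 where s1: "is_block_sum F' B1 s1"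
    using ex_block_sum[OF blocks, of B1, OF B1(1)] Q' B1(2) by auto
  obtain s2 where s2: "is_block_sum F' B2 s2"
    using ex_block_sum[OF blocks, of B2, OF B2(1)] Q' B2(2) by auto
  have lin: "clinear_op q" "clinear_op s1" "clinear_op s2"
    using q s1 s2 by (simp_all add: is_block_sum_def)
  note eqI = eq_on_blocks[OF blocks]
  note compose = block_sum_compose[OF blocks]
  note restrict = block_sum_restrict[OF blocks]
  note qr = restrict[OF Q'lin q]
  have qq: "adj q o\<^sub>L q = q" "q o\<^sub>L q = q" and s1s1: "adj s1 o\<^sub>L s1 = q" and s2s2: "adj s2 o\<^sub>L s2 = q"
    by (rule eqI, subst blinfun_apply_blinfun_compose,
        subst compose(2)[OF Q'lin q Q'lin q] compose(1)[OF Q'lin q Q'lin q]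
          compose(2)[OF B1(1) s1 B1(1) s1] compose(2)[OF B2(1) s2 B2(1) s2],
        simp only: qr Q'Q' QQ B1(2) B2(2))+
  have s1s2: "adj s1 o\<^sub>L s2 = 0"
    by (rule eqI) (simp add: compose[OF B1(1) s1 B2(1) s2] B12)
  then have s2s1: "adj s2 o\<^sub>L s1 = 0"
    using adj_compose[OF clinear_op_adj[OF lin(2)] lin(3)] by (simp add: adj_adj lin)
  have cuntz: "(s1 o\<^sub>L adj s1) + (s2 o\<^sub>L adj s2) = q"
  proof (rule eqI)
    fix n x
    have "(F' n \<otimes>\<^sub>o (B1 n o\<^sub>L adj (B1 n))) + (F' n \<otimes>\<^sub>o (B2 n o\<^sub>L adj (B2 n))) = F' n \<otimes>\<^sub>o Q' n"
      by (simp add: op_tensor_add_right[symmetric] F'lin clinear_op_compose clinear_op_adj B1(1)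
          B2(1) B12)
    then have sum: "(F' n \<otimes>\<^sub>o (B1 n o\<^sub>L adj (B1 n))) x + (F' n \<otimes>\<^sub>o (B2 n o\<^sub>L adj (B2 n))) x =
        (F' n \<otimes>\<^sub>o Q' n) x" by (metis blinfun.add_left)
    show "((s1 o\<^sub>L adj s1) + (s2 o\<^sub>L adj s2)) ((F' n \<otimes>\<^sub>o id_blinfun) x) =
        q ((F' n \<otimes>\<^sub>o id_blinfun) x)"
      by (simp add: blinfun.add_left compose(3)[OF B1(1) s1 B1(1) s1]
          compose(3)[OF B2(1) s2 B2(1) s2] qr sum)
  qed
  have qproj: "is_projection q"
  proof -
    have "adj q = q"
      using adj_compose[OF clinear_op_adj[OF lin(1)] lin(1)] by (simp only: adj_adj[OF lin(1)] qq)
    then show ?thesis using qq(2) lin(1) by (simp add: is_projection_def bounded_ops_iff)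
  qed

  have sx: "adj q (q x) = q x" "adj s1 (s1 x) = q x" "adj s2 (s2 x) = q x" "adj s1 (s2 x) = 0"
    "adj s2 (s1 x) = 0" "q (q x) = q x" "s1 (adj s1 x) + s2 (adj s2 x) = q x" for x
    using arg_cong[OF qq(1), of "\<lambda>A. A x"] arg_cong[OF s1s1, of "\<lambda>A. A x"]
      arg_cong[OF s2s2, of "\<lambda>A. A x"] arg_cong[OF s1s2, of "\<lambda>A. A x"]
      arg_cong[OF s2s1, of "\<lambda>A. A x"] arg_cong[OF qq(2), of "\<lambda>A. A x"]
      arg_cong[OF cuntz, of "\<lambda>A. A x"] by (simp_all add: blinfun.add_left)
  have qs: "q (q x) = q x" "q (s1 x) = s1 x" "q (s2 x) = s2 x" for x
    using sx(7)[of "s1 x"] sx(7)[of "s2 x"] initial_projection_absorb[OF lin(2) qproj sx(2), of x]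
      initial_projection_absorb[OF lin(3) qproj sx(3), of x] by (simp_all add: sx)
  note commq = block_sum_commute_right_vN(1)[OF q F'lin Q'lin F'central]
  note commr1 = block_sum_commute_right_vN(1)[OF s1 F'lin B1(1) F'central]
  note commr2 = block_sum_commute_right_vN(1)[OF s2 F'lin B2(1) F'central]
  note commr1' = block_sum_commute_right_vN(2)[OF s1 F'lin B1(1) F'central]
  note commr2' = block_sum_commute_right_vN(2)[OF s2 F'lin B2(1) F'central]

  \<comment> \<open>A partial isometry exchanging \<open>R\<close> and its complement, and a continuous chain through \<open>R\<close>.\<close>
  obtain V where V: "V \<in> right_vN" "adj V o\<^sub>L V = R" "V o\<^sub>L adj V = id_blinfun - R"
    using assms(5) by (auto simp: mvn_equiv_def)
  obtain E where E: "\<And>t. t \<in> {0..1::real} \<Longrightarrow> E t \<in> right_projections"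
      "\<And>t. t \<in> {0..1} \<Longrightarrow> canonical_trace (E t) = t"
      "\<And>t. t \<in> {0..1} \<Longrightarrow> E t o\<^sub>L R = R \<or> R o\<^sub>L E t = E t"
      "\<And>s t. s \<in> {0..1} \<Longrightarrow> t \<in> {0..1} \<Longrightarrow> s \<le> t \<Longrightarrow> E t o\<^sub>L E s = E s"
    using ex_projection_path[OF assms(2), of R] assms(3,4) unfolding right_projections_def by blast
  have E_mem: "E t \<in> right_vN" and E_proj: "is_projection (E t)" if "t \<in> {0..1}" for t
    using right_projectionsD[OF E(1)[OF that]] by blast+
  have E0: "E 0 = 0"
  proof (rule canonical_trace_strict[OF right_projections_zero E(1), symmetric])
    show "E 0 o\<^sub>L 0 = 0" by (rule blinfun_eqI) simp
    show "canonical_trace (E 0) \<le> canonical_trace (0 :: ('g, complex) l2 \<Rightarrow>\<^sub>L ('g, complex) l2)"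
      using E(2)[of 0] by (simp add: canonical_trace_def)
  qed simp
  have E1: "E 1 = id_blinfun"
  proof (rule canonical_trace_strict[OF E(1) right_projections_id])
    show "id_blinfun o\<^sub>L E 1 = E 1" by (rule blinfun_eqI) simp
    show "canonical_trace (id_blinfun :: ('g, complex) l2 \<Rightarrow>\<^sub>L ('g, complex) l2) \<le> canonical_trace (E 1)"
      using E(2)[of 1] by (simp add: canonical_trace_def norm_chi)
  qed simp
  have Vlin: "clinear_op V" and Rlin: "clinear_op R"
    using vN_clinear_op[OF vN] V(1) assms(3) by blast+
  have Vx: "adj V (V x) = R x" "V (adj V x) = x - R x" for x
    using arg_cong[OF V(2), of "\<lambda>A. A x"] arg_cong[OF V(3), of "\<lambda>A. A x"]
    by (simp_all add: blinfun.diff_left)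
  note Rx = is_projectionD(2)[OF assms(4)]
  have VR: "V (R x) = V x" for x by (rule initial_projection_absorb[OF Vlin assms(4) Vx(1)])
  have RV: "R (V x) = 0" for x
    using Vx(2)[of "V x"] by (simp add: Vx(1) VR)
  have V'R: "adj V (R x) = 0" for x
    by (rule cinner_right_eqI)
      (simp add: cinner_adj_right[OF Vlin, symmetric] is_projectionD(4)[OF assms(4), symmetric] RV)
  have RV': "R (adj V x) = adj V x" for x
    by (rule cinner_right_eqI)
      (simp add: cinner_adj_right[OF Vlin, symmetric] is_projectionD(4)[OF assms(4), symmetric] VR)

  \<comment> \<open>On the range of \<open>1 - E t\<close> the path is the identity of \<open>q\<close>, on that of \<open>E t\<close> it is
    \<open>R \<otimes> s1 + V\<^sup>* \<otimes> s2\<close>.\<close>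
  define A0 where "A0 t = id_blinfun - E t" for t
  define A1 where "A1 t = R o\<^sub>L E t" for t
  define A2 where "A2 t = adj V o\<^sub>L E t" for t
  have A_mem: "A0 t \<in> right_vN" "A1 t \<in> right_vN" "A2 t \<in> right_vN" if "t \<in> {0..1}" for t
    unfolding A0_def A1_def A2_def
    by (intro vN_diff[OF vN] vN_compose[OF vN] vN_adj[OF vN] vN_id[OF vN] E_mem that V(1) assms(3))+
  define W where "W t = ((A0 t \<otimes>\<^sub>o id_blinfun) o\<^sub>L q) + ((A1 t \<otimes>\<^sub>o id_blinfun) o\<^sub>L s1) +
      ((A2 t \<otimes>\<^sub>o id_blinfun) o\<^sub>L s2)" for t

  have W_init: "adj (W t) o\<^sub>L W t = q" and W_lin: "clinear_op (W t)" if t: "t \<in> {0..1}" for t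
  proof -
    note P = E_proj[OF t]
    have Elin: "clinear_op (E t)" by (rule is_projectionD(1)[OF P])
    note EE = is_projectionD(2)[OF P]
    have Alin: "clinear_op (A0 t)" "clinear_op (A1 t)" "clinear_op (A2 t)"
      using vN_clinear_op[OF vN] A_mem[OF t] by blast+
    have A': "adj (A0 t) \<in> right_vN" "adj (A1 t) \<in> right_vN" "adj (A2 t) \<in> right_vN"
      using vN_adj[OF vN] A_mem[OF t] by blast+
    have adjA: "adj (A0 t) = id_blinfun - E t" "adj (A1 t) = E t o\<^sub>L R" "adj (A2 t) = E t o\<^sub>L V"
      unfolding A0_def A1_def A2_def
      by (simp_all add: adj_diff adj_compose clinear_op_adj adj_adj Elin Rlin Vlin
          is_projectionD(3)[OF P] is_projectionD(3)[OF assms(4)])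
    have ER: "E t (R x) = R (E t x)" and EV: "E t (adj V (E t x)) = adj V (E t x)" for x
    proof -
      \<comment> \<open>\<open>V\<^sup>*\<close> vanishes on \<open>R\<close> and maps into \<open>R\<close>, so it preserves the range of \<open>E t\<close> if
        \<open>E t \<le> R\<close> and also if \<open>R \<le> E t\<close>.\<close>
      consider "E t o\<^sub>L R = R" | "R o\<^sub>L E t = E t" using E(3)[OF t] by blast
      then have "E t (R x) = R (E t x) \<and> E t (adj V (E t x)) = adj V (E t x)"
      proof cases
        case 1
        have 2: "E t (R y) = R y" "R (E t y) = R y" for y
          using arg_cong[OF 1, of "\<lambda>A. A y"]
            arg_cong[OF projection_absorb_commute[OF assms(4) P 1], of "\<lambda>A. A y"] by simp_all
        show ?thesis using 2(1)[of "adj V (E t x)"] by (simp add: 2 RV')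
      next
        case 2
        have 3: "R (E t y) = E t y" "E t (R y) = E t y" for y
          using arg_cong[OF 2, of "\<lambda>A. A y"]
            arg_cong[OF projection_absorb_commute[OF P assms(4) 2], of "\<lambda>A. A y"] by simp_all
        show ?thesis using V'R[of "E t x"] by (simp add: 3)
      qed
      then show "E t (R x) = R (E t x)" and "E t (adj V (E t x)) = adj V (E t x)" by blast+
    qed
    have EVz: "E t (V (x - E t x)) = 0" for x
    proof (rule cinner_right_eqI)
      fix z
      have "cinner z (E t (V (x - E t x))) = cinner (adj V (E t z)) (x - E t x)"
        by (simp only: is_projectionD(4)[OF P, symmetric] cinner_adj_left[OF Vlin])
      also have "\<dots> = cinner (adj V (E t z)) x - cinner (E t (adj V (E t z))) x"
        by (simp only: cinner_diff_right is_projectionD(4)[OF P])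
      finally show "cinner z (E t (V (x - E t x))) = cinner z 0" by (simp add: EV)
    qed
    have prods: "adj (A0 t) o\<^sub>L A0 t = id_blinfun - E t" "adj (A1 t) o\<^sub>L A1 t = R o\<^sub>L E t"
      "adj (A2 t) o\<^sub>L A2 t = E t - (R o\<^sub>L E t)"
      "adj (A0 t) o\<^sub>L A1 t = 0" "adj (A1 t) o\<^sub>L A0 t = 0"
      "adj (A0 t) o\<^sub>L A2 t = 0" "adj (A2 t) o\<^sub>L A0 t = 0"
      unfolding adjA unfolding A0_def A1_def A2_def
      by (rule blinfun_eqI, simp add: blinfun.diff_left blinfun.diff_right EE ER Rx Vx EV
          EVz[unfolded blinfun.diff_right])+
    let ?I = "id_blinfun :: 'h \<Rightarrow>\<^sub>L 'h"
    have adja: "adj (A0 t \<otimes>\<^sub>o ?I) = adj (A0 t) \<otimes>\<^sub>o ?I" "adj (A1 t \<otimes>\<^sub>o ?I) = adj (A1 t) \<otimes>\<^sub>o ?I"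
      "adj (A2 t \<otimes>\<^sub>o ?I) = adj (A2 t) \<otimes>\<^sub>o ?I"
      by (simp_all add: adj_op_tensor Alin)
    show "adj (W t) o\<^sub>L W t = q"
      unfolding W_def
    proof (rule initial_projection_of_sum)
      show "clinear_op (A0 t \<otimes>\<^sub>o ?I)" "clinear_op (A1 t \<otimes>\<^sub>o ?I)" "clinear_op (A2 t \<otimes>\<^sub>o ?I)"
        by (simp_all add: clinear_op_tensor Alin)
      show "clinear_op q" "clinear_op s1" "clinear_op s2" by (rule lin)+
      show "(A0 t \<otimes>\<^sub>o ?I) (q x) = q ((A0 t \<otimes>\<^sub>o ?I) x)"
        "(A1 t \<otimes>\<^sub>o ?I) (s1 x) = s1 ((A1 t \<otimes>\<^sub>o ?I) x)"
        "(A2 t \<otimes>\<^sub>o ?I) (s2 x) = s2 ((A2 t \<otimes>\<^sub>o ?I) x)" for x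
        by (rule commq commr1 commr2; rule A_mem[OF t])+
      show "adj i (j x) = j (adj i x)"
        if "i \<in> {A0 t \<otimes>\<^sub>o ?I, A1 t \<otimes>\<^sub>o ?I, A2 t \<otimes>\<^sub>o ?I}" "j \<in> {q, s1, s2}" for i j x
      proof -
        have "i = A0 t \<otimes>\<^sub>o ?I \<or> i = A1 t \<otimes>\<^sub>o ?I \<or> i = A2 t \<otimes>\<^sub>o ?I" using that(1) by simp
        then have "adj i = adj (A0 t) \<otimes>\<^sub>o ?I \<or> adj i = adj (A1 t) \<otimes>\<^sub>o ?I \<or>
            adj i = adj (A2 t) \<otimes>\<^sub>o ?I"
          by (elim disjE) (simp_all only: adja simp_thms)
        then obtain A where A: "A \<in> right_vN" and i: "adj i = A \<otimes>\<^sub>o ?I"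
          by (elim disjE) (rule that[OF A'(1)], assumption, rule that[OF A'(2)], assumption,
              rule that[OF A'(3)], assumption)
        have "j = q \<or> j = s1 \<or> j = s2" using that(2) by simp
        then show ?thesis
          unfolding i by (elim disjE) (simp_all only: commq[OF A] commr1[OF A] commr2[OF A])
      qed
      show "adj (A0 t \<otimes>\<^sub>o ?I) ((A0 t \<otimes>\<^sub>o ?I) x) + adj (A1 t \<otimes>\<^sub>o ?I) ((A1 t \<otimes>\<^sub>o ?I) x) +
          adj (A2 t \<otimes>\<^sub>o ?I) ((A2 t \<otimes>\<^sub>o ?I) x) = x" for x
        by (simp add: adja op_tensor_id_apply clinear_op_adj Alin prods op_tensor_diff_left Elin
            Rlin clinear_op_compose blinfun.diff_left)
      show "adj (A0 t \<otimes>\<^sub>o ?I) ((A1 t \<otimes>\<^sub>o ?I) x) = 0" "adj (A1 t \<otimes>\<^sub>o ?I) ((A0 t \<otimes>\<^sub>o ?I) x) = 0"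
        "adj (A0 t \<otimes>\<^sub>o ?I) ((A2 t \<otimes>\<^sub>o ?I) x) = 0" "adj (A2 t \<otimes>\<^sub>o ?I) ((A0 t \<otimes>\<^sub>o ?I) x) = 0" for x
        by (simp_all add: adja op_tensor_id_apply clinear_op_adj Alin prods)
      show "adj q (q x) = q x" "adj s1 (s1 x) = q x" "adj s2 (s2 x) = q x" "adj s1 (s2 x) = 0"
        "adj s2 (s1 x) = 0" for x
        by (rule sx)+
    qed
    show "clinear_op (W t)"
      unfolding W_def by (intro clinear_op_add clinear_op_compose clinear_op_tensor lin Alin clinear_op_id)
  qed

  have qW: "q (W t x) = W t x" if t: "t \<in> {0..1}" for t x
    by (simp add: W_def blinfun.add_left blinfun.add_right commq[OF A_mem(1)[OF t], symmetric]
        commq[OF A_mem(2)[OF t], symmetric] commq[OF A_mem(3)[OF t], symmetric] qs)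

  have "has_sot_sum N (\<lambda>n. F n \<otimes>\<^sub>o Q n) q"
  proof -
    have "(if 1 \<le> n \<and> enat n \<le> N then (F n \<otimes>\<^sub>o Q n) x else 0) = (F' n \<otimes>\<^sub>o Q' n) x" for n x
      by (simp add: F'_def Q'_def ix_def)
    then show ?thesis using q by (simp add: has_sot_sum_sums is_block_sum_def)
  qed
  moreover have "has_sot_sum N (\<lambda>n. (R o\<^sub>L F n) \<otimes>\<^sub>o Q n) ((R \<otimes>\<^sub>o id_blinfun) o\<^sub>L q)"
  proof -
    have 1: "id_blinfun o\<^sub>L Q' n = Q' n" for n by (auto intro: blinfun_eqI)
    have eq: "(if 1 \<le> n \<and> enat n \<le> N then ((R o\<^sub>L F n) \<otimes>\<^sub>o Q n) x else 0) =
        (R \<otimes>\<^sub>o id_blinfun) ((F' n \<otimes>\<^sub>o Q' n) x)" for n x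
    proof (cases "ix n")
      case True
      have "(R \<otimes>\<^sub>o id_blinfun) ((F' n \<otimes>\<^sub>o Q' n) x) = ((R o\<^sub>L F' n) \<otimes>\<^sub>o Q' n) x"
        by (simp add: op_tensor_compose_apply Rlin F'lin Q'lin 1)
      with True show ?thesis by (simp add: F'_def Q'_def ix_def)
    next
      case False
      then have "F' n = 0" by (simp add: F'_def)
      moreover have "\<not> (1 \<le> n \<and> enat n \<le> N)" using False unfolding ix_def .
      ultimately show ?thesis by (simp only: if_False op_tensor_zero_left blinfun.zero_left
          blinfun.zero_right)
    qed
    have "(\<lambda>n. (R \<otimes>\<^sub>o id_blinfun) ((F' n \<otimes>\<^sub>o Q' n) x)) sums (R \<otimes>\<^sub>o id_blinfun) (q x)" for x
      using q by (intro bounded_linear.sums[OF blinfun.bounded_linear_right]) (simp add: is_block_sum_def)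
    then show ?thesis unfolding has_sot_sum_sums eq by simp
  qed
  moreover have "W t \<in> vN_tensor right_vN bounded_ops \<and> partial_isometry (W t)" if t: "t \<in> {0..1}" for t
  proof
    show "partial_isometry (W t)"
      by (rule partial_isometry_of_initial_projection(1)[OF W_lin[OF t] qproj W_init[OF t]])
    let ?gens = "{A \<otimes>\<^sub>o B | A B. A \<in> (right_vN :: (('g, complex) l2 \<Rightarrow>\<^sub>L ('g, complex) l2) set) \<and>
        B \<in> (bounded_ops :: ('h \<Rightarrow>\<^sub>L 'h) set)}"
    have "?gens \<subseteq> bounded_ops"
      using vN_clinear_op[OF vN] by (auto simp: bounded_ops_iff intro!: clinear_op_tensor)
    then have M: "von_neumann_algebra (vN_tensor (right_vN :: (('g, complex) l2 \<Rightarrow>\<^sub>L ('g, complex) l2) set)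
        (bounded_ops :: ('h \<Rightarrow>\<^sub>L 'h) set))"
      unfolding vN_tensor_def by (rule von_neumann_algebra_vN_generated)
    have gen: "A \<otimes>\<^sub>o B \<in> vN_tensor right_vN bounded_ops" if "A \<in> right_vN" "clinear_op B"
      for A :: "('g, complex) l2 \<Rightarrow>\<^sub>L ('g, complex) l2" and B :: "'h \<Rightarrow>\<^sub>L 'h"
      unfolding vN_tensor_def
      by (rule subsetD[OF vN_generated_superset]) (use that in \<open>auto simp: bounded_ops_iff\<close>)
    have "q \<in> vN_tensor right_vN bounded_ops" "s1 \<in> vN_tensor right_vN bounded_ops"
      "s2 \<in> vN_tensor right_vN bounded_ops"
      by (rule is_block_sum_mem[OF q M gen[OF F'R Q'lin]] is_block_sum_mem[OF s1 M gen[OF F'R B1(1)]]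
          is_block_sum_mem[OF s2 M gen[OF F'R B2(1)]])+
    then show "W t \<in> vN_tensor right_vN bounded_ops"
      unfolding W_def by (intro vN_add[OF M] vN_compose[OF M] gen A_mem[OF t] clinear_op_id)
  qed
  moreover have "continuous_on {0..1} (\<lambda>t. adj (L_op 0) o\<^sub>L W t)"
  proof -
    have "continuous_on {0..1} (\<lambda>t. E t (chi 0))"
      unfolding continuous_on_iff
    proof (intro ballI allI impI)
      fix t e :: real assume t: "t \<in> {0..1}" and "0 < e"
      \<comment> \<open>The chain is parametrised by the trace, so the 2-distance is exactly computable.\<close>
      have dist: "(dist (E s (chi 0)) (E t (chi 0)))\<^sup>2 = \<bar>s - t\<bar>" if s: "s \<in> {0..1}" for s
      proof (cases "s \<le> t")
        case True
        have "(norm (E t (chi 0) - E s (chi 0)))\<^sup>2 = t - s"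
          using canonical_trace_diff[OF E(1)[OF s] E(1)[OF t] E(4)[OF s t True]] E(2)[OF s] E(2)[OF t]
          by (simp add: blinfun.diff_left)
        with True show ?thesis by (simp add: dist_norm norm_minus_commute)
      next
        case False
        then have "t \<le> s" by simp
        have "(norm (E s (chi 0) - E t (chi 0)))\<^sup>2 = s - t"
          using canonical_trace_diff[OF E(1)[OF t] E(1)[OF s] E(4)[OF t s \<open>t \<le> s\<close>]] E(2)[OF s] E(2)[OF t]
          by (simp add: blinfun.diff_left)
        with False show ?thesis by (simp add: dist_norm)
      qed
      have "dist (E s (chi 0)) (E t (chi 0)) < e" if s: "s \<in> {0..1}" and "dist s t < e\<^sup>2" for s
      proof -
        have "(dist (E s (chi 0)) (E t (chi 0)))\<^sup>2 < e\<^sup>2"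
          using that(2) unfolding dist[OF s] by (simp add: dist_real_def)
        then show ?thesis using \<open>0 < e\<close> by (simp add: power2_less_imp_less)
      qed
      then show "\<exists>d>0. \<forall>s\<in>{0..1}. dist s t < d \<longrightarrow> dist (E s (chi 0)) (E t (chi 0)) < e"
        using \<open>0 < e\<close> by (intro exI[of _ "e\<^sup>2"]) auto
    qed
    then have "continuous_on {0..1} (\<lambda>t. A0 t (chi 0))" "continuous_on {0..1} (\<lambda>t. A1 t (chi 0))"
      "continuous_on {0..1} (\<lambda>t. A2 t (chi 0))"
      by (auto simp: A0_def A1_def A2_def blinfun.diff_left intro!: continuous_intros)
    then have "continuous_on {0..1} (\<lambda>t. (adj (L_op 0) o\<^sub>L ((A0 t \<otimes>\<^sub>o id_blinfun) o\<^sub>L q)) +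
        (adj (L_op 0) o\<^sub>L ((A1 t \<otimes>\<^sub>o id_blinfun) o\<^sub>L s1)) +
        (adj (L_op 0) o\<^sub>L ((A2 t \<otimes>\<^sub>o id_blinfun) o\<^sub>L s2)))"
      using A_mem by (intro continuous_on_add continuous_on_compression)
    moreover have "adj (L_op 0) o\<^sub>L W t = (adj (L_op 0) o\<^sub>L ((A0 t \<otimes>\<^sub>o id_blinfun) o\<^sub>L q)) +
        (adj (L_op 0) o\<^sub>L ((A1 t \<otimes>\<^sub>o id_blinfun) o\<^sub>L s1)) +
        (adj (L_op 0) o\<^sub>L ((A2 t \<otimes>\<^sub>o id_blinfun) o\<^sub>L s2))" for t
      by (rule blinfun_eqI) (simp add: W_def blinfun.add_left blinfun.add_right)
    ultimately show ?thesis by simp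
  qed
  moreover have "op_le (W t o\<^sub>L adj (W t)) q" if t: "t \<in> {0..1}" for t
  proof -
    have "q o\<^sub>L (W t o\<^sub>L adj (W t)) = W t o\<^sub>L adj (W t)"
      by (rule blinfun_eqI) (simp add: qW[OF t])
    then show ?thesis
      using op_le_projection_iff[OF partial_isometry_of_initial_projection(2)[OF W_lin[OF t] qproj
            W_init[OF t]] qproj] by blast
  qed
  moreover have "W 0 = q"
  proof (rule blinfun_eqI)
    fix x
    have "A0 0 = id_blinfun" "A1 0 = 0" "A2 0 = 0"
      by (auto simp: A0_def A1_def A2_def E0 intro: blinfun_eqI)
    then show "W 0 x = q x" by (simp add: W_def blinfun.add_left)
  qed
  moreover have "W 1 o\<^sub>L adj (W 1) = (R \<otimes>\<^sub>o id_blinfun) o\<^sub>L q"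
  proof (rule blinfun_eqI)
    fix x
    let ?r = "R \<otimes>\<^sub>o (id_blinfun :: 'h \<Rightarrow>\<^sub>L 'h)" and ?v = "V \<otimes>\<^sub>o (id_blinfun :: 'h \<Rightarrow>\<^sub>L 'h)"
      and ?v' = "adj V \<otimes>\<^sub>o (id_blinfun :: 'h \<Rightarrow>\<^sub>L 'h)"
    have "A0 1 = 0" "A1 1 = R" "A2 1 = adj V"
      by (auto simp: A0_def A1_def A2_def E1 intro: blinfun_eqI)
    then have W1: "W 1 = (?r o\<^sub>L s1) + (?v' o\<^sub>L s2)" by (auto simp: W_def intro: blinfun_eqI)
    have adjW1: "adj (W 1) = (adj s1 o\<^sub>L ?r) + (adj s2 o\<^sub>L ?v)"
      unfolding W1
      by (simp add: adj_add adj_compose clinear_op_compose clinear_op_tensor clinear_op_adj lin Rlin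
          Vlin adj_op_tensor adj_adj is_projectionD(3)[OF assms(4)])
    have V': "adj V \<in> right_vN" by (rule vN_adj[OF vN V(1)])
    have ops: "R o\<^sub>L R = R" "R o\<^sub>L V = 0" "adj V o\<^sub>L R = 0"
      by (auto simp: Rx RV V'R intro: blinfun_eqI)
    have rr: "?r (?r y) = ?r y" "?r (?v y) = 0" "?v' (?r y) = 0" "?v' (?v y) = ?r y" for y
      by (simp_all add: op_tensor_id_apply clinear_op_adj Rlin Vlin ops V(2))
    have "(W 1 o\<^sub>L adj (W 1)) x = s1 (adj s1 (?r x)) + s2 (adj s2 (?r x))"
      unfolding W1 adjW1[unfolded W1]
      by (simp add: blinfun.add_left blinfun.add_right commr1[OF assms(3)] commr2[OF V']
          commr1'[OF assms(3)] commr2'[OF assms(3)] commr1'[OF V'] commr2'[OF V'] rr)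
    also have "\<dots> = q (?r x)" by (simp add: cuntz[symmetric] blinfun.add_left)
    finally show "(W 1 o\<^sub>L adj (W 1)) x = (?r o\<^sub>L q) x" by (simp add: commq[OF assms(3)])
  qed
  ultimately show ?thesis
    using W_init by (intro exI[of _ q] exI[of _ "(R \<otimes>\<^sub>o id_blinfun) o\<^sub>L q"] exI[of _ W]) blast
qed

end
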